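(* Let $\mathbb{G}$ be a connected abelian Lie group, let $\mathscr{A}$ be an abelian arrangement in $T\cong\mathbb{G}^d$, and suppose that $\mathscr{P}(\mathscr{A}_Y)$ is a corank-one M-ideal of $\mathscr{P}(\mathscr{A})$. Then there are a composition $\mathbf{k}=(k_1,\dots,k_m)$ and a continuous map $g\colon M(\mathscr{A}/Y)\to \mathrm{Conf}^{\mathbf{k}}(\mathbb{G})$ such that $\bar p\colon M(\mathscr{A})\to M(\mathscr{A}/Y)$ is the pullback along $g$ of the bundle $\pi\colon \mathrm{Conf}^{(\mathbf{k},1)}(\mathbb{G})\to \mathrm{Conf}^{\mathbf{k}}(\mathbb{G})$, $(S_1,\dots,S_m,S_{m+1})\mapsto(S_1,\dots,S_m)$; that is, there is a continuous map $h\colon M(\mathscr{A})\to \mathrm{Conf}^{(\mathbf{k},1)}(\mathbb{G})$ with $\pi\circ h=g\circ\bar p$ such that the resulting commutative square is a pullback square of topological spaces.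
   Context: Let $\Gamma\cong\mathbb{Z}^d$ be a finitely generated free abelian group and $T=\mathrm{Hom}(\Gamma,\mathbb{G})\cong\mathbb{G}^d$. For $\chi\in\Gamma$ put $H_\chi=\{t\in T\mid \chi\in\ker t\}$. An abelian arrangement $\mathscr{A}$ in $T$ is the set of all connected components of the subspaces $H_\chi$, $\chi\in\mathfrak{X}$, for a finite set $\mathfrak{X}\subseteq\Gamma\smallsetminus\{0\}$. Its complement is $M(\mathscr{A})=T\smallsetminus\bigcup_{\chi\in\mathfrak{X}}H_\chi$. Its poset of layers $\mathscr{P}(\mathscr{A})$ is the set of nonempty connected components of the intersections $\bigcap_{\chi\in S}H_\chi$, $S\subseteq\mathfrak{X}$, ordered by reverse inclusion. A subgroup $Y\subseteq T$ is admissible if there is a direct sum decomposition $\Gamma=\Gamma'\oplus\Gamma''$ with $\Gamma'$ of rank one such that $Y=\{t\in T\mid t|_{\Gamma''}\text{ is trivial}\}$. Then $T/Y\cong\mathrm{Hom}(\Gamma'',\mathbb{G})$, and $p\colon T\to T/Y$ denotes the projection. Put $\mathscr{A}_Y=\{H\in\mathscr{A}\mid H \text{ is a union of cosets of } Y\}$ and $\mathscr{A}/Y=\{p(H)\mid H\in\mathscr{A}_Y\}$, which is an abelian arrangement in $T/Y$. The map $p$ restricts to $\bar p\colon M(\mathscr{A})\to M(\mathscr{A}/Y)$. $\mathscr{P}(\mathscr{A}_Y)$ is an M-ideal of $\mathscr{P}(\mathscr{A})$ if for any two distinct $H_1,H_2\in\mathscr{A}\smallsetminus\mathscr{A}_Y$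 and any connected component $X$ of $H_1\cap H_2$ there is $H_3\in\mathscr{A}_Y$ with $H_3\supseteq X$. It is a corank-one M-ideal if, in addition, $Y$ is admissible and the rank of $\mathscr{P}(\mathscr{A}_Y)$ is one less than the rank of $\mathscr{P}(\mathscr{A})$. For a space $X$, $\mathrm{Conf}_k(X)\subseteq X^k$ is the ordered configuration space of $k$-tuples of pairwise distinct points. A composition $\mathbf{k}=(k_1,\dots,k_m)$ of $k$ is a sequence of positive integers with $k_1+\dots+k_m=k$; $\mathrm{Conf}^{\mathbf{k}}(X)=\mathrm{Conf}_k(X)/(\Sigma_{k_1}\times\dots\times\Sigma_{k_m})$ with the quotient topology, where the product of symmetric groups permutes coordinates. Its elements are tuples $(S_1,\dots,S_m)$ of pairwise disjoint subsets of $X$ with $|S_i|=k_i$. Also $(\mathbf{k},1)=(k_1,\dots,k_m,1)$. *)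

theory Defs
  imports "HOL-Analysis.Analysis" "HOL-Combinatorics.Permutations"
begin

section \<open>Abelian Lie groups\<close>

primrec Ck_on :: "nat \<Rightarrow> 'a::real_normed_vector set \<Rightarrow> ('a \<Rightarrow> 'b::real_normed_vector) \<Rightarrow> bool" where
  "Ck_on 0 S f \<longleftrightarrow> continuous_on S f"
| "Ck_on (Suc k) S f \<longleftrightarrow> (\<forall>x\<in>S. f differentiable (at x)) \<and>
     (\<forall>v. Ck_on k S (\<lambda>x. frechet_derivative f (at x) v))"

definition smooth_on :: "'a::real_normed_vector set \<Rightarrow> ('a \<Rightarrow> 'b::real_normed_vector) \<Rightarrow> bool" where
  "smooth_on S f \<longleftrightarrow> open S \<and> (\<forall>k. Ck_on k S f)"

text \<open>The model space is an arbitrary finite-dimensional normed space instead of a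
  \<open>euclidean_space\<close>, because the latter class excludes dimension 0.\<close>

definition smooth_atlas ::
  "('g::topological_space set \<times> ('g \<Rightarrow> 'e::real_normed_vector)) set \<Rightarrow> bool" where
  "smooth_atlas \<A> \<longleftrightarrow>
     (\<exists>B::'e set. finite B \<and> span B = UNIV) \<and>
     (\<forall>(U, \<phi>)\<in>\<A>. open U \<and> open (\<phi> ` U) \<and> homeomorphism U (\<phi> ` U) \<phi> (inv_into U \<phi>)) \<and>
     \<Union>(fst ` \<A>) = UNIV \<and>
     (\<forall>(U, \<phi>)\<in>\<A>. \<forall>(V, \<psi>)\<in>\<A>. smooth_on (\<phi> ` (U \<inter> V)) (\<psi> \<circ> inv_into U \<phi>))"

definition abelian_lie_group_atlas ::
  "('g::{topological_ab_group_add, t2_space, second_countable_topology} set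
     \<times> ('g \<Rightarrow> 'e::real_normed_vector)) set \<Rightarrow> bool" where
  "abelian_lie_group_atlas \<A> \<longleftrightarrow>
     smooth_atlas \<A> \<and>
     (\<forall>(U, \<phi>)\<in>\<A>. \<forall>(V, \<psi>)\<in>\<A>. \<forall>(W, \<theta>)\<in>\<A>.
        smooth_on {(x, y). x \<in> \<phi> ` U \<and> y \<in> \<psi> ` V \<and> inv_into U \<phi> x + inv_into V \<psi> y \<in> W}
          (\<lambda>(x, y). \<theta> (inv_into U \<phi> x + inv_into V \<psi> y))) \<and>
     (\<forall>(U, \<phi>)\<in>\<A>. \<forall>(W, \<theta>)\<in>\<A>.
        smooth_on {x \<in> \<phi> ` U. - inv_into U \<phi> x \<in> W} (\<lambda>x. \<theta> (- inv_into U \<phi> x)))"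


section \<open>Free abelian groups\<close>

definition add_subgroup :: "'c::ab_group_add set \<Rightarrow> bool" where
  "add_subgroup S \<longleftrightarrow> 0 \<in> S \<and> (\<forall>x\<in>S. \<forall>y\<in>S. x + y \<in> S) \<and> (\<forall>x\<in>S. - x \<in> S)"

text \<open>The group \<open>\<int>\<^sup>d\<close> is represented by the integer sequences that vanish from index \<open>d\<close> on.\<close>

definition free_abelian_of_rank :: "nat \<Rightarrow> 'c::ab_group_add set \<Rightarrow> bool" where
  "free_abelian_of_rank d S \<longleftrightarrow> add_subgroup S \<and>
     (\<exists>f :: (nat \<Rightarrow> int) \<Rightarrow> 'c. bij_betw f {v. \<forall>i\<ge>d. v i = 0} S \<and>
        (\<forall>u\<in>{v. \<forall>i\<ge>d. v i = 0}. \<forall>v\<in>{v. \<forall>i\<ge>d. v i = 0}. f (\<lambda>i. u i + v i) = f u + f v))"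

definition direct_sum_decomposition :: "'c::ab_group_add set \<Rightarrow> 'c set \<Rightarrow> bool" where
  "direct_sum_decomposition S1 S2 \<longleftrightarrow> add_subgroup S1 \<and> add_subgroup S2 \<and>
     S1 \<inter> S2 = {0} \<and> (\<forall>x. \<exists>a\<in>S1. \<exists>b\<in>S2. x = a + b)"


section \<open>Quotient topologies and pullback squares\<close>

definition quotient_topology :: "'a topology \<Rightarrow> ('a \<Rightarrow> 'b) \<Rightarrow> 'b topology" where
  "quotient_topology X q =
     topology (\<lambda>U. U \<subseteq> q ` topspace X \<and> openin X {x \<in> topspace X. q x \<in> U})"

lemma openin_quotient_topology:
  "openin (quotient_topology X q) U \<longleftrightarrow>
     U \<subseteq> q ` topspace X \<and> openin X {x \<in> topspace X. q x \<in> U}"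
proof -
  have "istopology (\<lambda>U. U \<subseteq> q ` topspace X \<and> openin X {x \<in> topspace X. q x \<in> U})"
    unfolding istopology_def
  proof (intro conjI allI impI)
    fix S T
    assume S: "S \<subseteq> q ` topspace X \<and> openin X {x \<in> topspace X. q x \<in> S}"
      and T: "T \<subseteq> q ` topspace X \<and> openin X {x \<in> topspace X. q x \<in> T}"
    have "{x \<in> topspace X. q x \<in> S \<inter> T} =
        {x \<in> topspace X. q x \<in> S} \<inter> {x \<in> topspace X. q x \<in> T}" by auto
    then show "openin X {x \<in> topspace X. q x \<in> S \<inter> T}"
      using S T by (simp only: openin_Int)
    show "S \<inter> T \<subseteq> q ` topspace X" using S by auto
  next
    fix K
    assume K: "\<forall>S\<in>K. S \<subseteq> q ` topspace X \<and> openin X {x \<in> topspace X. q x \<in> S}"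
    have "{x \<in> topspace X. q x \<in> \<Union>K} = \<Union>((\<lambda>S. {x \<in> topspace X. q x \<in> S}) ` K)" by auto
    then show "openin X {x \<in> topspace X. q x \<in> \<Union>K}"
      using K by (simp only:) (rule openin_Union, blast)
    show "\<Union>K \<subseteq> q ` topspace X" using K by auto
  qed
  then show ?thesis by (simp add: quotient_topology_def topology_inverse')
qed

lemma topspace_quotient_topology [simp]: "topspace (quotient_topology X q) = q ` topspace X"
proof -
  have "{x \<in> topspace X. q x \<in> q ` topspace X} = topspace X" by auto
  then have "openin (quotient_topology X q) (q ` topspace X)"
    by (simp add: openin_quotient_topology)
  moreover have "topspace (quotient_topology X q) \<subseteq> q ` topspace X"
    using openin_topspace[of "quotient_topology X q"] unfolding openin_quotient_topology
    by (rule conjunct1)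
  ultimately show ?thesis by (simp only: subset_antisym openin_subset)
qed

lemma quotient_map_quotient_topology: "quotient_map X (quotient_topology X q) q"
  by (auto simp: quotient_map_def openin_quotient_topology)

text \<open>The square with top \<open>h : W \<rightarrow> E\<close>, left side \<open>p : W \<rightarrow> B\<close>, right side \<open>r : E \<rightarrow> C\<close> and
  bottom \<open>g : B \<rightarrow> C\<close> is a pullback square.\<close>

definition pullback_square ::
  "'w topology \<Rightarrow> 'e topology \<Rightarrow> 'b topology \<Rightarrow> 'c topology \<Rightarrow>
     ('w \<Rightarrow> 'e) \<Rightarrow> ('w \<Rightarrow> 'b) \<Rightarrow> ('e \<Rightarrow> 'c) \<Rightarrow> ('b \<Rightarrow> 'c) \<Rightarrow> bool" where
  "pullback_square W E B C h p r g \<longleftrightarrow>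
     continuous_map W E h \<and> continuous_map W B p \<and>
     continuous_map E C r \<and> continuous_map B C g \<and>
     (\<forall>w\<in>topspace W. r (h w) = g (p w)) \<and>
     homeomorphic_map W (subtopology (prod_topology B E) {(b, e). g b = r e}) (\<lambda>w. (p w, h w))"


section \<open>Configuration spaces\<close>

definition Conf :: "nat \<Rightarrow> 'a topology \<Rightarrow> (nat \<Rightarrow> 'a) topology" where
  "Conf k X = subtopology (product_topology (\<lambda>_. X) {..<k}) {x. inj_on x {..<k}}"

definition composition :: "nat list \<Rightarrow> bool" where
  "composition ks \<longleftrightarrow> ks \<noteq> [] \<and> (\<forall>k\<in>set ks. 0 < k)"

definition block :: "nat list \<Rightarrow> nat \<Rightarrow> nat set" where
  "block ks i = {sum_list (take i ks)..<sum_list (take (Suc i) ks)}"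

definition block_sets :: "nat list \<Rightarrow> (nat \<Rightarrow> 'a) \<Rightarrow> 'a set list" where
  "block_sets ks x = map (\<lambda>i. x ` block ks i) [0..<length ks]"

text \<open>The orbit of a configuration \<open>x\<close> under \<open>\<Sigma>\<^bsub>k\<^sub>1\<^esub> \<times> \<dots> \<times> \<Sigma>\<^bsub>k\<^sub>m\<^esub>\<close> is represented by the tuple
  \<open>(S\<^sub>1, \<dots>, S\<^sub>m)\<close> of the sets of its values on the blocks; see \<open>block_sets_eq_iff\<close> below.\<close>

definition Conf_colored :: "nat list \<Rightarrow> 'a topology \<Rightarrow> 'a set list topology" where
  "Conf_colored ks X = quotient_topology (Conf (sum_list ks) X) (block_sets ks)"

lemma topspace_Conf:
  "topspace (Conf k X) = {x \<in> {..<k} \<rightarrow>\<^sub>E topspace X. inj_on x {..<k}}"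
  by (auto simp: Conf_def)

lemma UN_block: "(\<Union>i<length ks. block ks i) = {..<sum_list ks}"
proof (induction ks rule: rev_induct)
  case Nil
  then show ?case by simp
next
  case (snoc k ks)
  have "block (ks @ [k]) i = block ks i" if "i < length ks" for i
    using that by (simp add: block_def)
  moreover have "block (ks @ [k]) (length ks) = {sum_list ks..<sum_list ks + k}"
    by (simp add: block_def)
  ultimately have "(\<Union>i<length (ks @ [k]). block (ks @ [k]) i)
      = (\<Union>i<length ks. block ks i) \<union> {sum_list ks..<sum_list ks + k}"
    by (auto simp: lessThan_Suc)
  then show ?case using snoc by auto
qed

lemma block_sets_eq_iff:
  assumes x: "x \<in> topspace (Conf (sum_list ks) X)" and y: "y \<in> topspace (Conf (sum_list ks) X)"
  shows "block_sets ks x = block_sets ks y \<longleftrightarrow>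
    (\<exists>\<sigma>. \<sigma> permutes {..<sum_list ks} \<and> (\<forall>i<length ks. \<sigma> ` block ks i = block ks i) \<and>
      (\<forall>j<sum_list ks. y j = x (\<sigma> j)))"
proof
  let ?n = "sum_list ks"
  have ix: "inj_on x {..<?n}" and iy: "inj_on y {..<?n}"
    using x y by (auto simp: topspace_Conf)
  have sub: "block ks i \<subseteq> {..<?n}" if "i < length ks" for i
    unfolding UN_block[symmetric] using that by (intro UN_upper) simp
  {
    assume eq: "block_sets ks x = block_sets ks y"
    have blk: "x ` block ks i = y ` block ks i" if "i < length ks" for i
      using eq that unfolding block_sets_def by simp
    define \<sigma> where "\<sigma> j = (if j < ?n then inv_into {..<?n} x (y j) else j)" for j
    have mem: "\<exists>l\<in>block ks i. y j = x l" if "i < length ks" "j \<in> block ks i" for i j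
    proof -
      have "y j \<in> x ` block ks i" using blk[OF that(1)] that(2) by simp
      then show ?thesis by auto
    qed
    have \<sigma>blk: "\<sigma> j \<in> block ks i \<and> x (\<sigma> j) = y j" if ij: "i < length ks" "j \<in> block ks i" for i j
    proof -
      obtain l where l: "l \<in> block ks i" "y j = x l" using mem[OF ij] by blast
      have "j < ?n" "l < ?n" using sub[OF ij(1)] ij(2) l(1) by auto
      then have "\<sigma> j = l" using l(2) ix by (simp add: \<sigma>_def inv_into_f_f)
      then show ?thesis using l by simp
    qed
    have ex: "\<exists>i<length ks. j \<in> block ks i" if "j < ?n" for j
    proof -
      have "j \<in> (\<Union>i<length ks. block ks i)" using that by (simp add: UN_block)
      then show ?thesis by auto
    qed
    have val: "x (\<sigma> j) = y j" "\<sigma> j < ?n" if j: "j < ?n" for j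
    proof -
      obtain i where i: "i < length ks" "j \<in> block ks i" using ex[OF j] by blast
      show "x (\<sigma> j) = y j" using \<sigma>blk[OF i] by blast
      show "\<sigma> j < ?n" using \<sigma>blk[OF i] sub[OF i(1)] by auto
    qed
    have inj: "inj_on \<sigma> {..<?n}"
    proof (rule inj_onI)
      fix a b assume ab: "a \<in> {..<?n}" "b \<in> {..<?n}" "\<sigma> a = \<sigma> b"
      then have "y a = y b" using val(1)[of a] val(1)[of b] by simp
      then show "a = b" using inj_onD[OF iy] ab by blast
    qed
    have "\<sigma> ` {..<?n} = {..<?n}"
      by (rule endo_inj_surj) (use inj val(2) in auto)
    then have "bij_betw \<sigma> {..<?n} {..<?n}" using inj by (simp add: bij_betw_def)
    then have perm: "\<sigma> permutes {..<?n}"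
      by (rule bij_imp_permutes) (simp add: \<sigma>_def)
    have "\<sigma> ` block ks i = block ks i" if "i < length ks" for i
    proof (rule endo_inj_surj)
      show "finite (block ks i)" by (simp add: block_def)
      show "\<sigma> ` block ks i \<subseteq> block ks i" using \<sigma>blk[OF that] by auto
      show "inj_on \<sigma> (block ks i)" using inj sub[OF that] by (rule inj_on_subset)
    qed
    with perm val(1) show "\<exists>\<sigma>. \<sigma> permutes {..<?n} \<and>
        (\<forall>i<length ks. \<sigma> ` block ks i = block ks i) \<and> (\<forall>j<?n. y j = x (\<sigma> j))"
      by (intro exI[of _ \<sigma>] conjI allI impI) (simp_all only:)
  next
    assume "\<exists>\<sigma>. \<sigma> permutes {..<?n} \<and>
        (\<forall>i<length ks. \<sigma> ` block ks i = block ks i) \<and> (\<forall>j<?n. y j = x (\<sigma> j))"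
    then obtain \<sigma> where \<sigma>: "\<And>i. i < length ks \<Longrightarrow> \<sigma> ` block ks i = block ks i"
      "\<And>j. j < ?n \<Longrightarrow> y j = x (\<sigma> j)" by blast
    have "y ` block ks i = x ` block ks i" if "i < length ks" for i
    proof -
      have "y ` block ks i = (\<lambda>j. x (\<sigma> j)) ` block ks i"
      proof (rule image_cong[OF refl])
        fix j assume "j \<in> block ks i"
        then have "j < ?n" using sub[OF that] by auto
        then show "y j = x (\<sigma> j)" by (rule \<sigma>(2))
      qed
      also have "\<dots> = x ` \<sigma> ` block ks i" by (simp only: image_image)
      finally show ?thesis by (simp only: \<sigma>(1)[OF that])
    qed
    then show "block_sets ks x = block_sets ks y" by (simp add: block_sets_def)
  }
qed


section \<open>Abelian arrangements\<close>

definition torus :: "('c::ab_group_add \<Rightarrow> 'g::ab_group_add) set" where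
  "torus = {t. Modules.additive t}"

text \<open>The torus carries the topology of pointwise convergence, which is the topology of \<open>\<G>\<^sup>d\<close>
  under the identification given by any basis of \<open>\<Gamma>\<close>.\<close>

definition torus_topology :: "('c::ab_group_add \<Rightarrow> 'g::topological_ab_group_add) topology" where
  "torus_topology = top_of_set torus"

definition hyper :: "'c::ab_group_add \<Rightarrow> ('c \<Rightarrow> 'g::ab_group_add) set" where
  "hyper \<gamma> = {t \<in> torus. t \<gamma> = 0}"

definition arrangement :: "'c::ab_group_add set \<Rightarrow> ('c \<Rightarrow> 'g::topological_ab_group_add) set set" where
  "arrangement \<XX> = (\<Union>\<gamma>\<in>\<XX>. components (hyper \<gamma>))"

definition arrangement_complement :: "'c::ab_group_add set \<Rightarrow> ('c \<Rightarrow> 'g::ab_group_add) set" where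
  "arrangement_complement \<XX> = torus - (\<Union>\<gamma>\<in>\<XX>. hyper \<gamma>)"

text \<open>Intersecting with the torus matters only for the empty subfamily of \<open>\<XX>\<close>.\<close>

definition layers :: "'c::ab_group_add set \<Rightarrow> ('c \<Rightarrow> 'g::topological_ab_group_add) set set" where
  "layers \<XX> = (\<Union>S\<in>Pow \<XX>. components (torus \<inter> (\<Inter>\<gamma>\<in>S. hyper \<gamma>)))"

text \<open>The rank of a poset of sets, ordered by reverse inclusion, is the length of a longest chain.\<close>

definition has_chain_of_length :: "'a set set \<Rightarrow> nat \<Rightarrow> bool" where
  "has_chain_of_length P n \<longleftrightarrow>
     (\<exists>c :: nat \<Rightarrow> 'a set. (\<forall>i\<le>n. c i \<in> P) \<and> (\<forall>i<n. c (Suc i) \<subset> c i))"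

definition has_rank :: "'a set set \<Rightarrow> nat \<Rightarrow> bool" where
  "has_rank P r \<longleftrightarrow> has_chain_of_length P r \<and> (\<forall>n>r. \<not> has_chain_of_length P n)"

definition admissible :: "('c::ab_group_add \<Rightarrow> 'g::ab_group_add) set \<Rightarrow> bool" where
  "admissible Y \<longleftrightarrow>
     (\<exists>\<Gamma>1 \<Gamma>2. direct_sum_decomposition \<Gamma>1 \<Gamma>2 \<and> free_abelian_of_rank 1 \<Gamma>1 \<and>
        Y = {t \<in> torus. \<forall>\<gamma>\<in>\<Gamma>2. t \<gamma> = 0})"

definition coset :: "('c \<Rightarrow> 'g::ab_group_add) set \<Rightarrow> ('c \<Rightarrow> 'g) \<Rightarrow> ('c \<Rightarrow> 'g) set" where
  "coset Y t = (\<lambda>y x. t x + y x) ` Y"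

definition torus_quotient_topology ::
  "('c::ab_group_add \<Rightarrow> 'g::topological_ab_group_add) set \<Rightarrow> ('c \<Rightarrow> 'g) set topology" where
  "torus_quotient_topology Y = quotient_topology torus_topology (coset Y)"

definition union_of_cosets ::
  "('c::ab_group_add \<Rightarrow> 'g::ab_group_add) set \<Rightarrow> ('c \<Rightarrow> 'g) set \<Rightarrow> bool" where
  "union_of_cosets Y H \<longleftrightarrow> (\<exists>C \<subseteq> coset Y ` torus. H = \<Union>C)"

definition sub_arrangement ::
  "'c::ab_group_add set \<Rightarrow> ('c \<Rightarrow> 'g::topological_ab_group_add) set \<Rightarrow> ('c \<Rightarrow> 'g) set set" where
  "sub_arrangement \<XX> Y = {H \<in> arrangement \<XX>. union_of_cosets Y H}"

definition quotient_arrangement ::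
  "'c::ab_group_add set \<Rightarrow> ('c \<Rightarrow> 'g::topological_ab_group_add) set \<Rightarrow> ('c \<Rightarrow> 'g) set set set" where
  "quotient_arrangement \<XX> Y = (\<lambda>H. coset Y ` H) ` sub_arrangement \<XX> Y"

definition quotient_complement ::
  "'c::ab_group_add set \<Rightarrow> ('c \<Rightarrow> 'g::topological_ab_group_add) set \<Rightarrow> ('c \<Rightarrow> 'g) set set" where
  "quotient_complement \<XX> Y = coset Y ` torus - \<Union>(quotient_arrangement \<XX> Y)"

text \<open>A set of characters that defines \<open>sub_arrangement \<XX> Y\<close>; see
  \<open>arrangement_sub_characters\<close> below.\<close>

definition sub_characters ::
  "'c::ab_group_add set \<Rightarrow> ('c \<Rightarrow> 'g::topological_ab_group_add) set \<Rightarrow> 'c set" where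
  "sub_characters \<XX> Y = {\<gamma> \<in> \<XX>. components (hyper \<gamma>) \<subseteq> sub_arrangement \<XX> Y}"

definition M_ideal ::
  "'c::ab_group_add set \<Rightarrow> ('c \<Rightarrow> 'g::topological_ab_group_add) set \<Rightarrow> bool" where
  "M_ideal \<XX> Y \<longleftrightarrow>
     (\<forall>H1 \<in> arrangement \<XX> - sub_arrangement \<XX> Y. \<forall>H2 \<in> arrangement \<XX> - sub_arrangement \<XX> Y.
        H1 \<noteq> H2 \<longrightarrow> (\<forall>X \<in> components (H1 \<inter> H2). \<exists>H3 \<in> sub_arrangement \<XX> Y. X \<subseteq> H3))"

definition corank_one_M_ideal ::
  "'c::ab_group_add set \<Rightarrow> ('c \<Rightarrow> 'g::topological_ab_group_add) set \<Rightarrow> bool" where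
  "corank_one_M_ideal \<XX> Y \<longleftrightarrow> M_ideal \<XX> Y \<and> admissible Y \<and>
     (\<exists>r. has_rank (layers (sub_characters \<XX> Y) :: ('c \<Rightarrow> 'g) set set) r \<and>
          has_rank (layers \<XX> :: ('c \<Rightarrow> 'g) set set) (Suc r))"

lemma hyper_translate:
  fixes s t :: "'c::ab_group_add \<Rightarrow> 'g::ab_group_add"
  assumes "s \<in> hyper \<gamma>" "t \<in> hyper \<gamma>"
  shows "(\<lambda>x. s x + t x) \<in> hyper \<gamma>" "(\<lambda>x. s x - t x) \<in> hyper \<gamma>"
  using assms by (auto simp: hyper_def torus_def Modules.additive_def algebra_simps)

lemma translate_component_subset:
  fixes C C' :: "('c::ab_group_add \<Rightarrow> 'g::topological_ab_group_add) set"
  assumes C: "C \<in> components (hyper \<gamma>)" and C': "C' \<in> components (hyper \<gamma>)"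
    and s: "s \<in> hyper \<gamma>" and c: "c \<in> C" "(\<lambda>x. s x + c x) \<in> C'"
  shows "(\<lambda>t x. s x + t x) ` C \<subseteq> C'"
proof (rule components_maximal[OF C'])
  show "connected ((\<lambda>t x. s x + t x) ` C)"
  proof (rule connected_continuous_image)
    show "continuous_on C (\<lambda>t x. s x + t x)"
    proof (rule continuous_on_coordinatewise_then_product)
      fix x
      show "continuous_on C (\<lambda>t. s x + t x)"
        by (intro continuous_on_add continuous_on_const
            continuous_on_subset[OF continuous_on_product_coordinates subset_UNIV])
    qed
    show "connected C" using C by (rule in_components_connected)
  qed
  show "(\<lambda>t x. s x + t x) ` C \<subseteq> hyper \<gamma>"
    by (intro image_subsetI hyper_translate(1)[OF s] subsetD[OF in_components_subset[OF C]])
  have "(\<lambda>x. s x + c x) \<in> (\<lambda>t x. s x + t x) ` C" using c(1) by (rule imageI)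
  with c(2) show "C' \<inter> (\<lambda>t x. s x + t x) ` C \<noteq> {}" by (metis IntI empty_iff)
qed

lemma union_of_cosets_component:
  fixes C C' :: "('c::ab_group_add \<Rightarrow> 'g::topological_ab_group_add) set"
  assumes C: "C \<in> components (hyper \<gamma>)" and C': "C' \<in> components (hyper \<gamma>)"
    and u: "union_of_cosets Y C"
  shows "union_of_cosets Y C'"
proof -
  obtain c c' where c: "c \<in> C" and c': "c' \<in> C'"
    using in_components_nonempty[OF C] in_components_nonempty[OF C'] by auto
  define s where "s = (\<lambda>x. c' x - c x)"
  have mem: "c \<in> hyper \<gamma>" "c' \<in> hyper \<gamma>"
    using subsetD[OF in_components_subset[OF C] c] subsetD[OF in_components_subset[OF C'] c'] .
  have s: "s \<in> hyper \<gamma>" and ms: "(\<lambda>x. - s x) \<in> hyper \<gamma>"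
    using hyper_translate(2)[OF mem(2) mem(1)] hyper_translate(2)[OF mem] by (simp_all add: s_def)
  have 1: "(\<lambda>t x. s x + t x) ` C \<subseteq> C'"
    by (rule translate_component_subset[OF C C' s c]) (simp add: s_def c')
  have 2: "(\<lambda>t x. - s x + t x) ` C' \<subseteq> C"
    by (rule translate_component_subset[OF C' C ms c']) (simp add: s_def c)
  have "C' \<subseteq> (\<lambda>t x. s x + t x) ` C"
  proof
    fix t assume "t \<in> C'"
    then have "(\<lambda>x. - s x + t x) \<in> C" by (rule subsetD[OF 2, OF imageI])
    then show "t \<in> (\<lambda>t x. s x + t x) ` C" by (rule rev_image_eqI) simp
  qed
  with 1 have eq: "C' = (\<lambda>t x. s x + t x) ` C" by (rule subset_antisym[rotated])
  obtain D where D: "D \<subseteq> torus" "C = \<Union>(coset Y ` D)"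
    using u unfolding union_of_cosets_def subset_image_iff by auto
  have tr: "(\<lambda>t x. s x + t x) ` coset Y d = coset Y (\<lambda>x. s x + d x)" for d
    by (simp add: coset_def image_image add.assoc)
  have "C' = \<Union>(coset Y ` (\<lambda>d x. s x + d x) ` D)"
    unfolding eq D(2) by (simp add: image_UN image_image tr)
  moreover have "(\<lambda>d x. s x + d x) ` D \<subseteq> torus"
  proof (rule image_subsetI)
    fix d assume "d \<in> D"
    then have "d \<in> torus" using D(1) by (rule subsetD[rotated])
    then show "(\<lambda>x. s x + d x) \<in> torus"
      using s by (simp add: hyper_def torus_def Modules.additive_def algebra_simps)
  qed
  then have "coset Y ` (\<lambda>d x. s x + d x) ` D \<subseteq> coset Y ` torus" by (rule image_mono)
  ultimately show ?thesis unfolding union_of_cosets_def by (intro exI conjI)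
qed

lemma arrangement_sub_characters:
  fixes Y :: "('c::ab_group_add \<Rightarrow> 'g::topological_ab_group_add) set"
  shows "arrangement (sub_characters \<XX> Y) = sub_arrangement \<XX> Y"
proof
  show "arrangement (sub_characters \<XX> Y) \<subseteq> sub_arrangement \<XX> Y"
    by (auto simp: arrangement_def sub_characters_def)
  show "sub_arrangement \<XX> Y \<subseteq> arrangement (sub_characters \<XX> Y)"
  proof
    fix H assume "H \<in> sub_arrangement \<XX> Y"
    then obtain \<gamma> where \<gamma>: "\<gamma> \<in> \<XX>" "H \<in> components (hyper \<gamma>)" and u: "union_of_cosets Y H"
      by (auto simp: sub_arrangement_def arrangement_def)
    have "components (hyper \<gamma>) \<subseteq> sub_arrangement \<XX> Y"
    proof
      fix C :: "('c \<Rightarrow> 'g) set"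
      assume C: "C \<in> components (hyper \<gamma>)"
      then have "C \<in> arrangement \<XX>" unfolding arrangement_def by (rule UN_I[OF \<gamma>(1)])
      with union_of_cosets_component[OF \<gamma>(2) C u] show "C \<in> sub_arrangement \<XX> Y"
        by (simp add: sub_arrangement_def)
    qed
    with \<gamma>(1) have "\<gamma> \<in> sub_characters \<XX> Y" by (simp add: sub_characters_def)
    then show "H \<in> arrangement (sub_characters \<XX> Y)"
      unfolding arrangement_def using \<gamma>(2) by (rule UN_I)
  qed
qed

end

theory Submission
  imports Defs
begin

text \<open>
  Write \<open>\<Gamma> = \<int>e \<oplus> \<Gamma>''\<close> and view a point of \<open>T\<close> as a pair \<open>(t, x)\<close> of its restriction \<open>t\<close> to \<open>\<Gamma>''\<close> and its
  value \<open>x\<close> at \<open>e\<close>. A character \<open>n e + \<beta>\<close> with \<open>n \<noteq> 0\<close> cuts the fibre over \<open>t\<close> in the roots of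
  \<open>n x = - t \<beta>\<close>. Let \<open>S t\<close> be the finite set of all these roots; a single block \<open>\<^bold>k = (k)\<close> with
  \<open>k = |S t|\<close> and \<open>g t = S t\<close> suffices. A component \<open>H\<close> of \<open>H\<^sub>\<chi>\<close>, for such a \<open>\<chi>\<close>, is stable under translation by
  a connected group that acts transitively on \<open>T/Y\<close>, so it has equally many points in all fibres; by the
  M-ideal condition different components do not meet over \<open>M(\<A>/Y)\<close>, hence \<open>|S t|\<close> is constant there.
  Local inverses of \<open>x \<mapsto> n x\<close> lift \<open>g\<close> locally to ordered configurations.

  Of the Lie group structure only three facts are used: local compactness, existence of local \<open>n\<close>-th
  division near \<open>0\<close>, and discreteness of the \<open>n\<close>-torsion. Together with connectedness they give
  divisibility, and finiteness of the torsion by a growth argument.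
\<close>

section \<open>Integer multiples and bases of free abelian groups\<close>

text \<open>Connected abelian Lie groups are products of lines and circles, which would make
  divisibility and finite torsion evident. The proof does without this classification and without an
  exponential map: it looks at x \<mapsto> n x in one chart at 0, where its strict derivative is n
  times the identity. This is local, whereas finiteness of the n-torsion is global, and discreteness
  of the torsion alone does not bound it in a noncompact group. Hence the comparison of growth:
  dividing by n enlarges word length by a constant factor only, torsion multiplies the number of
  points, and polynomial growth caps that number. The members of the arrangement are components, not
  the H_\<chi> themselves, and one point of a fibre may satisfy several equations. So the points of
  \<open>S t\<close> are not counted equation by equation; they are carried to another fibre, each
  by a shift attached to a component through it, and the M-ideal condition keeps the images of
  distinct points apart. Corank one enters by supplying a character with nonzero coefficient at e,
  which makes k positive.\<close>

definition nmul :: "nat \<Rightarrow> 'a::ab_group_add \<Rightarrow> 'a" where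
  "nmul n x = (\<Sum>i<n. x)"

text \<open>At most one of the two terms is nonzero. Avoiding a case split on the sign lets
  additivity and continuity in x be inherited from \<open>nmul\<close>.\<close>

definition imul :: "int \<Rightarrow> 'a::ab_group_add \<Rightarrow> 'a" where
  "imul k x = nmul (nat k) x - nmul (nat (- k)) x"

lemma nmul_0 [simp]: "nmul 0 x = 0" and nmul_Suc: "nmul (Suc n) x = x + nmul n x"
  by (simp_all add: nmul_def add.commute)

lemma nmul_zero [simp]: "nmul n 0 = 0"
  by (simp add: nmul_def)

lemma nmul_add: "nmul (m + n) x = nmul m x + nmul n x"
  by (induction m) (simp_all add: nmul_Suc add.assoc)

lemma nmul_plus: "nmul n (x + y) = nmul n x + nmul n y"
  by (simp add: nmul_def sum.distrib)

lemma nmul_minus: "nmul n (- x) = - nmul n x"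
  by (simp add: nmul_def sum_negf)

lemma nmul_diff: "nmul n (x - y) = nmul n x - nmul n y"
  by (simp add: nmul_def sum_subtractf)

lemma continuous_on_nmul [continuous_intros]:
  fixes f :: "'a::topological_space \<Rightarrow> 'b::topological_ab_group_add"
  assumes "continuous_on S f"
  shows "continuous_on S (\<lambda>x. nmul n (f x))"
  unfolding nmul_def by (intro continuous_intros assms)

lemma imul_of_nat [simp]: "imul (int n) x = nmul n x"
  by (simp add: imul_def)

lemma imul_0 [simp]: "imul 0 x = 0" and imul_1 [simp]: "imul 1 x = x"
  and imul_zero [simp]: "imul k 0 = 0"
  by (simp_all add: imul_def nmul_def)

lemma imul_uminus: "imul (- k) x = - imul k x"
  by (simp add: imul_def)

lemma imul_diff_of_nat: "imul (int m - int n) x = nmul m x - nmul n x"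
proof (cases "n \<le> m")
  case True
  then obtain d where "m = n + d" using le_Suc_ex by blast
  then show ?thesis by (simp add: imul_def nmul_add)
next
  case False
  then obtain d where "n = m + d" using le_Suc_ex nat_le_linear by blast
  then show ?thesis by (simp add: imul_def nmul_add)
qed

lemma imul_add: "imul (j + k) x = imul j x + imul k x"
proof -
  obtain a b where j: "j = int a - int b" by (rule int_diff_cases)
  obtain c d where k: "k = int c - int d" by (rule int_diff_cases)
  have "j + k = int (a + c) - int (b + d)" by (simp add: j k)
  then show ?thesis
    unfolding j k by (simp only: imul_diff_of_nat nmul_add) (simp add: algebra_simps)
qed

lemma imul_plus: "imul k (x + y) = imul k x + imul k y"
  by (simp add: imul_def nmul_plus)

lemma imul_minus: "imul k (- x) = - imul k x"
  by (simp add: imul_def nmul_minus)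

lemma imul_diff: "imul k (x - y) = imul k x - imul k y"
  by (simp add: imul_def nmul_diff)

lemma imul_sum: "imul k (\<Sum>i\<in>A. f i) = (\<Sum>i\<in>A. imul k (f i))"
  by (induction A rule: infinite_finite_induct) (simp_all add: imul_plus)

lemma imul_imul_commute: "imul j (imul k x) = imul k (imul j x)"
proof -
  have "nmul m (imul k x) = imul k (nmul m x)" for m
    by (simp add: nmul_def imul_sum)
  then show ?thesis by (simp add: imul_def[of j] imul_diff)
qed

text \<open>Reduces division by k \<noteq> 0 and the kernel of \<open>imul k\<close> to a positive
  multiplier, where the chart argument applies.\<close>

lemma imul_sgn: "imul (sgn k) (imul k x) = nmul (nat \<bar>k\<bar>) x"
  by (cases k "0::int" rule: linorder_cases) (simp_all add: imul_def nmul_def)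

lemma continuous_on_imul [continuous_intros]:
  fixes f :: "'a::topological_space \<Rightarrow> 'b::topological_ab_group_add"
  assumes "continuous_on S f"
  shows "continuous_on S (\<lambda>x. imul k (f x))"
  unfolding imul_def by (intro continuous_intros assms)

lemma additive_imul:
  assumes "Modules.additive t"
  shows "t (imul k x) = imul k (t x)"
proof -
  interpret additive t by fact
  have "t (nmul n x) = nmul n (t x)" for n
    by (simp add: nmul_def sum)
  then show ?thesis by (simp add: imul_def diff)
qed

text \<open>Here b consists of the images of the unit vectors and c is the inverse of the given
  bijection. That bijection is only assumed to respect sums, so its values at 0, at negatives and at
  multiples of unit vectors are derived first.\<close>

lemma free_abelian_coordinates:
  fixes S :: "'c::ab_group_add set"
  assumes "free_abelian_of_rank d S"
  shows "\<exists>(b :: nat \<Rightarrow> 'c) (c :: 'c \<Rightarrow> nat \<Rightarrow> int). (\<forall>i<d. b i \<in> S) \<and>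
    (\<forall>x\<in>S. x = (\<Sum>i<d. imul (c x i) (b i))) \<and>
    (\<forall>x\<in>S. \<forall>y\<in>S. \<forall>i. c (x + y) i = c x i + c y i) \<and>
    (\<forall>i<d. \<forall>j. c (b i) j = (if i = j then 1 else 0))"
proof -
  define V where "V = {v :: nat \<Rightarrow> int. \<forall>i\<ge>d. v i = 0}"
  obtain f where f: "bij_betw f V S"
      and fadd: "\<And>u v. u \<in> V \<Longrightarrow> v \<in> V \<Longrightarrow> f (\<lambda>i. u i + v i) = f u + f v"
      and sub: "add_subgroup S"
    using assms unfolding free_abelian_of_rank_def V_def by blast
  define \<delta> where "\<delta> i k = (\<lambda>j. if j = i then k else 0)" for i :: nat and k :: int
  define b where "b i = f (\<delta> i 1)" for i
  define c where "c = inv_into V f"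
  have \<delta>V: "\<delta> i k \<in> V" if "i < d" for i k using that by (auto simp: V_def \<delta>_def)
  have \<delta>add: "(\<lambda>j. \<delta> i k j + \<delta> i l j) = \<delta> i (k + l)" for i k l by (auto simp: \<delta>_def)
  have f0: "f (\<lambda>_. 0) = 0"
    using fadd[of "\<lambda>_. 0" "\<lambda>_. 0"] by (simp add: V_def)
  have f\<delta>: "f (\<delta> i k) = imul k (b i)" if i: "i < d" for i k
  proof -
    have \<delta>0: "f (\<delta> i 0) = 0" using f0 by (simp add: \<delta>_def)
    have nat: "f (\<delta> i (int n)) = nmul n (b i)" for n
    proof (induction n)
      case 0
      then show ?case using \<delta>0 by simp
    next
      case (Suc n)
      have "f (\<delta> i (1 + int n)) = f (\<delta> i 1) + f (\<delta> i (int n))"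
        using fadd[OF \<delta>V[OF i] \<delta>V[OF i], of 1 "int n"] by (simp add: \<delta>add)
      then show ?case using Suc by (simp add: nmul_Suc b_def add.commute)
    qed
    have "f (\<delta> i (- k)) = - f (\<delta> i k)" for k
      using fadd[OF \<delta>V[OF i] \<delta>V[OF i], of "-k" k] \<delta>0 by (simp add: \<delta>add add_eq_0_iff2)
    with nat show ?thesis by (cases k rule: int_cases2) (simp_all add: imul_uminus)
  qed
  have expand: "f v = (\<Sum>i<d. imul (v i) (b i))" if v: "v \<in> V" for v
  proof -
    \<comment> \<open>Truncate v after m coordinates; each induction step adds one multiple of a
      unit vector.\<close>
    have "f (\<lambda>i. if i < m then v i else 0) = (\<Sum>i<m. imul (v i) (b i))" if "m \<le> d" for m
      using that
    proof (induction m)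
      case 0
      then show ?case by (simp add: f0)
    next
      case (Suc m)
      have "(\<lambda>i. if i < Suc m then v i else 0) = (\<lambda>i. (if i < m then v i else 0) + \<delta> m (v m) i)"
        by (auto simp: \<delta>_def)
      moreover have "(\<lambda>i. if i < m then v i else 0) \<in> V" using v by (auto simp: V_def)
      ultimately have "f (\<lambda>i. if i < Suc m then v i else 0)
          = f (\<lambda>i. if i < m then v i else 0) + f (\<delta> m (v m))"
        using fadd \<delta>V Suc.prems by simp
      with Suc show ?case by (simp add: f\<delta>)
    qed
    moreover have "(\<lambda>i. if i < d then v i else 0) = v" using v by (auto simp: V_def)
    ultimately show ?thesis by (metis order_refl)
  qed
  have cV: "c x \<in> V" and fc: "f (c x) = x" if "x \<in> S" for x
    using f that by (auto simp: c_def bij_betw_def inv_into_into f_inv_into_f)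
  have cf: "c (f v) = v" if "v \<in> V" for v
    using f that by (simp add: c_def bij_betw_def)
  show ?thesis
  proof (intro exI conjI allI impI ballI)
    show "b i \<in> S" if "i < d" for i
      using f \<delta>V[OF that] by (auto simp: b_def bij_betw_def)
    show "x = (\<Sum>i<d. imul (c x i) (b i))" if "x \<in> S" for x
      using expand[OF cV[OF that]] fc[OF that] by simp
    show "c (x + y) i = c x i + c y i" if "x \<in> S" "y \<in> S" for x y i
    proof -
      have "(\<lambda>i. c x i + c y i) \<in> V" using cV that by (simp add: V_def)
      from cf[OF this] show ?thesis
        by (simp add: fadd[OF cV[OF that(1)] cV[OF that(2)]] fc that)
    qed
    show "c (b i) j = (if i = j then 1 else 0)" if "i < d" for i j
      using cf[OF \<delta>V[OF that], of 1] by (simp add: b_def \<delta>_def)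
  qed
qed

section \<open>Finite-dimensional normed spaces and strict derivatives\<close>

text \<open>Comparison of the l1-norm of coordinates with the given norm. The l1-sphere K lives
  among functions vanishing off B, inside a box that is compact by Tychonoff; independence makes the
  norm positive on K, and a lower bound m there yields C = 1 / m.\<close>

lemma representation_bounded:
  fixes B :: "'e::real_normed_vector set"
  assumes B: "finite B" "independent B" "span B = UNIV"
  obtains C where "C > 0" "\<And>x. (\<Sum>b\<in>B. \<bar>representation B x b\<bar>) \<le> C * norm x"
proof -
  define K where "K = {f :: 'e \<Rightarrow> real. (\<forall>b. f b \<in> (if b \<in> B then {-1..1} else {0})) \<and> (\<Sum>b\<in>B. \<bar>f b\<bar>) = 1}"
  define N where "N f = norm (\<Sum>b\<in>B. f b *\<^sub>R b)" for f :: "'e \<Rightarrow> real"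
  have sum_rep: "(\<Sum>b\<in>B. representation B x b *\<^sub>R b) = x" for x
    using real_vector.sum_representation_eq[of B x B] B by simp
  have coord: "continuous_on S (\<lambda>f. f b)" for S :: "('e \<Rightarrow> real) set" and b
    by (rule continuous_on_subset[OF continuous_on_product_coordinates subset_UNIV])
  have "compactin (product_topology (\<lambda>_. euclidean) UNIV)
      (PiE UNIV (\<lambda>b :: 'e. if b \<in> B then {-1..1} else {0 :: real}))"
    by (subst compactin_PiE) auto
  then have box: "compact (PiE UNIV (\<lambda>b :: 'e. if b \<in> B then {-1..1} else {0 :: real}))"
    by (simp add: euclidean_product_topology)
  have "closed {f :: 'e \<Rightarrow> real. (\<Sum>b\<in>B. \<bar>f b\<bar>) = 1}"
    by (rule closed_Collect_eq) (intro continuous_intros coord)+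
  moreover have "K = PiE UNIV (\<lambda>b :: 'e. if b \<in> B then {-1..1} else {0 :: real}) \<inter> {f. (\<Sum>b\<in>B. \<bar>f b\<bar>) = 1}"
    by (auto simp: K_def PiE_def Pi_def)
  ultimately have K: "compact K" using box by (auto intro: compact_Int_closed)
  have contN: "continuous_on K N"
    unfolding N_def by (intro continuous_intros coord)
  have pos: "N f > 0" if "f \<in> K" for f
  proof (rule ccontr)
    assume "\<not> N f > 0"
    then have "(\<Sum>b\<in>B. f b *\<^sub>R b) = 0" by (simp add: N_def)
    then have "f b = 0" if "b \<in> B" for b
      using B that independentD[OF B(2) B(1) subset_refl] by blast
    then show False using that by (simp add: K_def)
  qed
  \<comment> \<open>In dimension 0 the sphere is empty and any positive m works.\<close>
  obtain m where m: "m > 0" "\<And>f. f \<in> K \<Longrightarrow> m \<le> N f"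
  proof (cases "K = {}")
    case True
    then show ?thesis using that[of 1] by simp
  next
    case False
    from continuous_attains_inf[OF K False contN] show ?thesis using that pos by blast
  qed
  have "(\<Sum>b\<in>B. \<bar>representation B x b\<bar>) \<le> (1 / m) * norm x" for x
  proof (cases "(\<Sum>b\<in>B. \<bar>representation B x b\<bar>) = 0")
    case True
    then show ?thesis using m by simp
  next
    case False
    define s where "s = (\<Sum>b\<in>B. \<bar>representation B x b\<bar>)"
    have s: "s > 0" using False by (simp add: s_def sum_nonneg less_le)
    define f where "f b = representation B x b / s" for b
    have le: "\<bar>representation B x b\<bar> \<le> s" if "b \<in> B" for b
      unfolding s_def using B(1) that by (intro member_le_sum) auto
    have "f b \<in> (if b \<in> B then {-1..1} else {0})" for b
    proof (cases "b \<in> B")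
      case True
      then show ?thesis using le[OF True] s by (auto simp: f_def abs_le_iff field_simps)
    next
      case False
      then show ?thesis using real_vector.representation_ne_zero[of B x b] by (auto simp: f_def)
    qed
    moreover have "(\<Sum>b\<in>B. \<bar>f b\<bar>) = 1"
      using s by (simp add: f_def abs_divide flip: sum_divide_distrib) (simp add: s_def)
    ultimately have "f \<in> K" by (simp add: K_def)
    moreover have "(\<Sum>b\<in>B. f b *\<^sub>R b) = (1 / s) *\<^sub>R (\<Sum>b\<in>B. representation B x b *\<^sub>R b)"
      by (simp add: f_def scaleR_sum_right)
    then have "N f = norm x / s" using s by (simp add: N_def sum_rep)
    ultimately have "m \<le> norm x / s" using m by metis
    then show ?thesis using s m by (simp add: field_simps flip: s_def)
  qed
  then show ?thesis using that[of "1 / m"] m(1) by simp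
qed

lemma finite_span_basis:
  fixes B :: "'e::real_normed_vector set"
  assumes "finite B" "span B = UNIV"
  obtains B' :: "'e set" where "finite B'" "independent B'" "span B' = UNIV"
proof -
  obtain B' where B': "B' \<subseteq> B" "independent B'" "B \<subseteq> span B'"
    using maximal_independent_subset[of B] by blast
  then have "span B' = UNIV"
    using assms(2) span_minimal[OF B'(3) subspace_span] by auto
  then show ?thesis using that B' assms(1) finite_subset by blast
qed

text \<open>A ball is a closed part of the image of a compact box of coordinates. Completeness for
  the fixed point theorem and local compactness of the group both rest on this.\<close>

lemma compact_cball_finite_dimensional:
  fixes B :: "'e::real_normed_vector set"
  assumes "finite B" "span B = UNIV"
  shows "compact (cball (a :: 'e) r)"
proof -
  obtain B' :: "'e set" where B': "finite B'" "independent B'" "span B' = UNIV"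
    using finite_span_basis[OF assms] .
  obtain C where C: "C > 0" "\<And>x. (\<Sum>b\<in>B'. \<bar>representation B' x b\<bar>) \<le> C * norm x"
    using representation_bounded[OF B'] by metis
  let ?P = "PiE UNIV (\<lambda>b :: 'e. {- (C * r)..C * r})"
  let ?l = "\<lambda>f :: 'e \<Rightarrow> real. a + (\<Sum>b\<in>B'. f b *\<^sub>R b)"
  have "compactin (product_topology (\<lambda>_. euclidean) UNIV) ?P"
    by (subst compactin_PiE) auto
  then have P: "compact ?P" by (simp add: euclidean_product_topology)
  have "continuous_on ?P ?l"
    by (intro continuous_intros continuous_on_subset[OF continuous_on_product_coordinates subset_UNIV])
  then have "compact (?l ` ?P)" using P by (rule compact_continuous_image)
  moreover have "cball a r \<subseteq> ?l ` ?P"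
  proof
    fix y assume y: "y \<in> cball a r"
    have rep: "\<bar>representation B' (y - a) b\<bar> \<le> C * r" for b
    proof (cases "b \<in> B'")
      case True
      have "\<bar>representation B' (y - a) b\<bar> \<le> (\<Sum>b\<in>B'. \<bar>representation B' (y - a) b\<bar>)"
        using B'(1) True by (intro member_le_sum) auto
      also have "\<dots> \<le> C * norm (y - a)" by (rule C)
      also have "\<dots> \<le> C * r" using y C(1) by (simp add: dist_norm norm_minus_commute)
      finally show ?thesis .
    next
      case False
      then have "representation B' (y - a) b = 0"
        using real_vector.representation_ne_zero by blast
      moreover have "0 \<le> r" using y by (simp add: dist_norm) (metis norm_ge_zero order_trans)
      ultimately show ?thesis using C(1) by simp
    qed
    have "- (C * r) \<le> representation B' (y - a) b \<and> representation B' (y - a) b \<le> C * r" for b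
      using rep[of b] by linarith
    then have "representation B' (y - a) \<in> ?P" by (simp add: PiE_def Pi_def)
    then have mem: "?l (representation B' (y - a)) \<in> ?l ` ?P" by (rule imageI)
    have eq: "?l (representation B' (y - a)) = y"
      using real_vector.sum_representation_eq[of B' "y - a" B'] B' by simp
    show "y \<in> ?l ` ?P" using mem unfolding eq .
  qed
  then have "?l ` ?P \<inter> cball a r = cball a r" by blast
  ultimately show ?thesis using compact_Int_closed[of "?l ` ?P" "cball a r"] by simp
qed

text \<open>The derivative is close to L on a whole ball, first on each basis vector and then, as
  these are finite in number, in operator norm. The mean value inequality for F - L turns this into
  a two-point estimate.\<close>

lemma C1_strict_derivative:
  fixes F :: "'a::real_normed_vector \<Rightarrow> 'b::real_normed_vector" and B :: "'a set"
  assumes B: "finite B" "span B = UNIV"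
    and S: "open S" "p \<in> S" and C1: "Ck_on (Suc 0) S F"
    and L: "(F has_derivative L) (at p)" and \<epsilon>: "\<epsilon> > 0"
  obtains \<delta> where "\<delta> > 0" "ball p \<delta> \<subseteq> S"
    "\<And>x y. x \<in> ball p \<delta> \<Longrightarrow> y \<in> ball p \<delta> \<Longrightarrow> norm (F x - F y - L (x - y)) \<le> \<epsilon> * norm (x - y)"
proof -
  obtain B' :: "'a set" where B': "finite B'" "independent B'" "span B' = UNIV"
    using finite_span_basis[OF B] .
  obtain C where C: "C > 0" "\<And>x. (\<Sum>b\<in>B'. \<bar>representation B' x b\<bar>) \<le> C * norm x"
    using representation_bounded[OF B'] by metis
  define D where "D x = frechet_derivative F (at x)" for x
  have D: "(F has_derivative D x) (at x)" if "x \<in> S" for x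
    using C1 that by (simp add: D_def flip: frechet_derivative_works)
  have Dp: "D p = L" using D[OF S(2)] L by (rule has_derivative_unique)
  have cont: "continuous_on S (\<lambda>x. D x v)" for v
    using C1 by (simp add: D_def)
  \<comment> \<open>The factor 1 / C pays for the later passage from basis vectors to arbitrary
    v.\<close>
  have "\<forall>\<^sub>F x in at p. \<forall>b\<in>B'. dist (D x b) (D p b) < \<epsilon> / C"
  proof (rule eventually_ball_finite[OF B'(1)], rule ballI)
    fix b
    have "isCont (\<lambda>x. D x b) p" using cont S by (simp add: continuous_on_eq_continuous_at)
    then show "\<forall>\<^sub>F x in at p. dist (D x b) (D p b) < \<epsilon> / C"
      unfolding isCont_def by (rule tendstoD) (use \<epsilon> C(1) in simp)
  qed
  then obtain d1 where d1: "d1 > 0" "\<And>x b. x \<noteq> p \<Longrightarrow> dist x p < d1 \<Longrightarrow> b \<in> B' \<Longrightarrow> dist (D x b) (D p b) < \<epsilon> / C"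
    unfolding eventually_at by auto
  obtain d2 where d2: "d2 > 0" "ball p d2 \<subseteq> S" using S openE by blast
  define \<delta> where "\<delta> = min d1 d2"
  have \<delta>: "\<delta> > 0" "ball p \<delta> \<subseteq> S" using d1 d2 by (auto simp: \<delta>_def)
  have on: "onorm (\<lambda>v. D x v - L v) \<le> \<epsilon>" if x: "x \<in> ball p \<delta>" for x
  proof (rule onorm_bound)
    fix v
    have lin: "linear (\<lambda>v. D x v - L v)"
      using has_derivative_linear[OF D[OF subsetD[OF \<delta>(2) x]]] has_derivative_linear[OF L]
      by (rule linear_compose_sub)
    have le: "norm (D x b - L b) \<le> \<epsilon> / C" if "b \<in> B'" for b
    proof (cases "x = p")
      case True
      then show ?thesis using \<epsilon> C(1) by (simp add: Dp)
    next
      case False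
      have "dist x p < d1" using x by (simp add: \<delta>_def dist_commute)
      from d1(2)[OF False this that] show ?thesis by (simp add: Dp dist_norm)
    qed
    have "D x v - L v = (\<Sum>b\<in>B'. representation B' v b *\<^sub>R (D x b - L b))"
    proof -
      have "(\<Sum>b\<in>B'. representation B' v b *\<^sub>R b) = v"
        using real_vector.sum_representation_eq[of B' v B'] B' by simp
      moreover have "D x (\<Sum>b\<in>B'. representation B' v b *\<^sub>R b) - L (\<Sum>b\<in>B'. representation B' v b *\<^sub>R b)
          = (\<Sum>b\<in>B'. representation B' v b *\<^sub>R (D x b - L b))"
        by (simp only: linear_sum[OF lin] linear_scale[OF lin])
      ultimately show ?thesis by simp
    qed
    also have "norm \<dots> \<le> (\<Sum>b\<in>B'. \<bar>representation B' v b\<bar> * (\<epsilon> / C))"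
    proof (rule sum_norm_le)
      fix b assume "b \<in> B'"
      then show "norm (representation B' v b *\<^sub>R (D x b - L b)) \<le> \<bar>representation B' v b\<bar> * (\<epsilon> / C)"
        unfolding norm_scaleR by (intro mult_left_mono le abs_ge_zero)
    qed
    also have "\<dots> \<le> (C * norm v) * (\<epsilon> / C)"
      unfolding sum_distrib_right[symmetric] using C \<epsilon> by (intro mult_right_mono) auto
    finally show "norm (D x v - L v) \<le> \<epsilon> * norm v" using C(1) by (simp add: field_simps)
  qed (use \<epsilon> in simp)
  have "norm ((F x - L x) - (F y - L y)) \<le> \<epsilon> * norm (x - y)"
    if "x \<in> ball p \<delta>" "y \<in> ball p \<delta>" for x y
  proof (rule differentiable_bound[OF convex_ball _ on that(1) that(2)])
    fix z assume z: "z \<in> ball p \<delta>"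
    then have "z \<in> S" using \<delta>(2) by blast
    have L': "(L has_derivative L) (at z)"
      by (rule bounded_linear_imp_has_derivative[OF has_derivative_bounded_linear[OF L]])
    show "((\<lambda>x. F x - L x) has_derivative (\<lambda>v. D z v - L v)) (at z within ball p \<delta>)"
      by (rule has_derivative_at_withinI[OF has_derivative_diff[OF D[OF \<open>z \<in> S\<close>] L']])
  qed
  moreover have "(F x - L x) - (F y - L y) = F x - F y - L (x - y)" for x y
    by (simp add: linear_diff[OF has_derivative_linear[OF L]])
  ultimately have "norm (F x - F y - L (x - y)) \<le> \<epsilon> * norm (x - y)"
    if "x \<in> ball p \<delta>" "y \<in> ball p \<delta>" for x y
    using that by metis
  with \<delta> show ?thesis using that by blast
qed

text \<open>The fixed point of the Newton map \<open>z \<mapsto> z - (f z - y) / n\<close>.\<close>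

lemma strict_derivative_surjective:
  fixes f :: "'e::real_normed_vector \<Rightarrow> 'e" and B :: "'e set"
  assumes B: "finite B" "span B = UNIV" and \<delta>: "\<delta> > 0" and n: "n \<ge> 1"
    and f: "\<And>x y. x \<in> ball a \<delta> \<Longrightarrow> y \<in> ball a \<delta> \<Longrightarrow>
      norm (f x - f y - real n *\<^sub>R (x - y)) \<le> (1/2) * norm (x - y)"
  shows "ball (f a) (\<delta> / 4) \<subseteq> f ` ball a \<delta>"
proof
  fix y assume y: "y \<in> ball (f a) (\<delta> / 4)"
  define T where "T z = z - (1 / real n) *\<^sub>R (f z - y)" for z
  \<comment> \<open>T moves the centre by at most \<delta> / 4 and halves distances, so it maps the
    ball of radius \<delta> / 2 into itself.\<close>
  define K where "K = cball a (\<delta> / 2)"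
  have Kb: "K \<subseteq> ball a \<delta>" using \<delta> by (auto simp: K_def)
  have aK: "a \<in> K" using \<delta> by (simp add: K_def)
  have T: "norm (T z - T w) \<le> (1/2) * norm (z - w)" if "z \<in> K" "w \<in> K" for z w
  proof -
    have "T z - T w = - ((1 / real n) *\<^sub>R (f z - f w - real n *\<^sub>R (z - w)))"
      using n by (simp add: T_def algebra_simps)
    then have "norm (T z - T w) = (1 / real n) * norm (f z - f w - real n *\<^sub>R (z - w))"
      by simp
    also have "\<dots> \<le> 1 * norm (f z - f w - real n *\<^sub>R (z - w))"
      using n by (intro mult_right_mono) auto
    also have "\<dots> \<le> (1/2) * norm (z - w)"
      unfolding mult_1 by (intro f subsetD[OF Kb] that)
    finally show ?thesis .
  qed
  have "\<exists>!x\<in>K. T x = x"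
  proof (rule Banach_fix)
    show "complete K" unfolding K_def
      by (intro compact_imp_complete compact_cball_finite_dimensional[OF B])
    show "K \<noteq> {}" using aK by blast
    show "T ` K \<subseteq> K"
    proof (rule image_subsetI)
      fix z assume z: "z \<in> K"
      have "norm (T a - a) = (1 / real n) * norm (f a - y)" by (simp add: T_def)
      also have "\<dots> \<le> 1 * norm (f a - y)" using n by (intro mult_right_mono) auto
      also have "\<dots> \<le> \<delta> / 4" using y by (simp add: dist_norm)
      finally have "norm (T a - a) \<le> \<delta> / 4" .
      moreover have "norm (T z - T a) \<le> \<delta> / 4"
        using T[OF z aK] z by (simp add: K_def dist_norm norm_minus_commute)
      ultimately have "norm (T z - a) \<le> \<delta> / 4 + \<delta> / 4" using norm_triangle_ineq[of "T z - T a" "T a - a"] by simp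
      then show "T z \<in> K" by (simp add: K_def dist_norm norm_minus_commute)
    qed
    show "dist (T z) (T w) \<le> (1/2) * dist z w" if "z \<in> K" "w \<in> K" for z w
      using T[OF that] by (simp add: dist_norm)
  qed auto
  then obtain x where x: "x \<in> K" "T x = x" by blast
  then have "f x = y" using n by (simp add: T_def)
  then show "y \<in> f ` ball a \<delta>" using x Kb by blast
qed

section \<open>Multiplication by integers in a chart of an abelian Lie group\<close>

lemma norm_Pair_add_le: "norm (u, v) \<le> norm u + norm v"
  by (simp add: norm_Pair sqrt_sum_squares_le_sum)

text \<open>Makes the two-point estimate available for the group law, a function of two
  variables.\<close>

lemma span_UNIV_prod:
  fixes B :: "'e::real_normed_vector set"
  assumes "finite B" "span B = UNIV"
  obtains B2 :: "('e \<times> 'e) set" where "finite B2" "span B2 = UNIV"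
proof -
  let ?B2 = "(\<lambda>u. (u, 0)) ` B \<union> (\<lambda>v. (0, v)) ` B :: ('e \<times> 'e) set"
  have lin: "linear (\<lambda>u :: 'e. (u, 0 :: 'e))" "linear (\<lambda>v :: 'e. (0 :: 'e, v))"
    by (simp_all add: linear_iff)
  have "(u, v) \<in> span ?B2" for u v
  proof -
    have "(u, 0) \<in> (\<lambda>u. (u, 0 :: 'e)) ` span B" by (rule image_eqI[of _ _ u]) (simp_all add: assms(2))
    then have "(u, 0) \<in> span ?B2"
      unfolding linear_span_image[OF lin(1), symmetric] by (rule subsetD[OF span_mono[OF Un_upper1]])
    moreover have "(0, v) \<in> (\<lambda>v. (0 :: 'e, v)) ` span B" by (rule image_eqI[of _ _ v]) (simp_all add: assms(2))
    then have "(0, v) \<in> span ?B2"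
      unfolding linear_span_image[OF lin(2), symmetric] by (rule subsetD[OF span_mono[OF Un_upper2]])
    ultimately have "(u, 0) + (0, v) \<in> span ?B2" by (rule span_add)
    then show ?thesis by simp
  qed
  then have "span ?B2 = UNIV" by (intro equalityI subset_UNIV subrelI)
  moreover have "finite ?B2" using assms(1) by simp
  ultimately show ?thesis by (intro that)
qed

locale lie_chart =
  fixes U :: "'g::{topological_ab_group_add, t2_space} set"
    and \<phi> :: "'g \<Rightarrow> 'e::real_normed_vector" and B :: "'e set"
  assumes B: "finite B" "span B = UNIV"
    and U: "open U" "0 \<in> U" and \<phi>U: "open (\<phi> ` U)"
    and hom: "homeomorphism U (\<phi> ` U) \<phi> (inv_into U \<phi>)"
    and smooth: "smooth_on {(x, y). x \<in> \<phi> ` U \<and> y \<in> \<phi> ` U \<and> inv_into U \<phi> x + inv_into U \<phi> y \<in> U}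
          (\<lambda>(x, y). \<phi> (inv_into U \<phi> x + inv_into U \<phi> y))"
begin

abbreviation "\<psi> \<equiv> inv_into U \<phi>"
abbreviation "a \<equiv> \<phi> 0"
definition "W = {(x, y). x \<in> \<phi> ` U \<and> y \<in> \<phi> ` U \<and> \<psi> x + \<psi> y \<in> U}"
definition "F = (\<lambda>(x, y). \<phi> (\<psi> x + \<psi> y))"
text \<open>Multiplication by n read in the chart. It is meaningful only where the multiple stays in
  U, which \<open>strict_derivative_f\<close> ensures near \<open>a\<close>.\<close>

definition "f n x = \<phi> (nmul n (\<psi> x))"

lemma inj: "inj_on \<phi> U"
  by (rule inj_on_inverseI[of _ "inv_into U \<phi>"]) (use hom in \<open>simp add: homeomorphism_def\<close>)

lemma \<psi>\<phi>: "z \<in> U \<Longrightarrow> \<psi> (\<phi> z) = z"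
  using inj by simp

lemma \<psi>a [simp]: "\<psi> a = 0"
  using \<psi>\<phi> U by blast

lemma \<phi>\<psi>: "x \<in> \<phi> ` U \<Longrightarrow> \<phi> (\<psi> x) = x" and \<psi>_in: "x \<in> \<phi> ` U \<Longrightarrow> \<psi> x \<in> U"
  by (simp_all add: f_inv_into_f inv_into_into)

lemma f_a [simp]: "f n a = a"
  by (simp add: f_def)

lemma openW: "open W" and C1F: "Ck_on (Suc 0) W F"
  using smooth unfolding smooth_on_def W_def[symmetric] F_def[symmetric] by blast+

lemma aaW: "(a, a) \<in> W"
  using U by (simp add: W_def)

lemma F_right: "x \<in> \<phi> ` U \<Longrightarrow> F (x, a) = x" and F_left: "x \<in> \<phi> ` U \<Longrightarrow> F (a, x) = x"
  by (simp_all add: F_def \<phi>\<psi>)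

text \<open>By the unit law both partial maps of F are identities near \<open>a\<close>, hence so
  are the partial derivatives; linearity gives the rest.\<close>

lemma F_derivative: "(F has_derivative (\<lambda>(u, v). u + v)) (at (a, a))"
proof -
  obtain D where D: "(F has_derivative D) (at (a, a))"
    using C1F aaW by (auto simp: differentiable_def)
  have aU: "a \<in> \<phi> ` U" using U by blast
  have "((\<lambda>x. F (x, a)) has_derivative (\<lambda>u. D (u, 0))) (at a)"
    by (rule has_derivative_compose[of "\<lambda>x. (x, a)" "\<lambda>u. (u, 0)", OF _ D])
      (auto intro!: derivative_eq_intros)
  then have "((\<lambda>x. x) has_derivative (\<lambda>u. D (u, 0))) (at a)"
    by (rule has_derivative_transform_within_open[OF _ \<phi>U aU F_right])
  from has_derivative_unique[OF this has_derivative_ident] have 1: "D (u, 0) = u" for u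
    by (rule fun_cong)
  have "((\<lambda>x. F (a, x)) has_derivative (\<lambda>u. D (0, u))) (at a)"
    by (rule has_derivative_compose[of "\<lambda>x. (a, x)" "\<lambda>u. (0, u)", OF _ D])
      (auto intro!: derivative_eq_intros)
  then have "((\<lambda>x. x) has_derivative (\<lambda>u. D (0, u))) (at a)"
    by (rule has_derivative_transform_within_open[OF _ \<phi>U aU F_left])
  from has_derivative_unique[OF this has_derivative_ident] have 2: "D (0, u) = u" for u
    by (rule fun_cong)
  have "D (u, v) = u + v" for u v
    using linear_add[OF has_derivative_linear[OF D], of "(u, 0)" "(0, v)"] 1 2 by simp
  then have "D = (\<lambda>(u, v). u + v)" by auto
  with D show ?thesis by simp
qed

text \<open>As (n + 1) x = x + n x, the map \<open>f (Suc n)\<close> is F along the graph of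
  \<open>f n\<close>, with derivative the identity plus n times the identity. The two-point form is
  what later gives both injectivity and a contraction; \<epsilon> is generalized because the
  induction step needs a smaller one.\<close>

lemma strict_derivative_f:
  assumes "\<epsilon> > 0"
  shows "\<exists>\<delta>>0. ball a \<delta> \<subseteq> \<phi> ` U \<and> (\<forall>x\<in>ball a \<delta>. nmul n (\<psi> x) \<in> U) \<and>
    (\<forall>x\<in>ball a \<delta>. \<forall>y\<in>ball a \<delta>. norm (f n x - f n y - real n *\<^sub>R (x - y)) \<le> \<epsilon> * norm (x - y))"
  using assms
proof (induction n arbitrary: \<epsilon>)
  case 0
  obtain \<delta> where "\<delta> > 0" "ball a \<delta> \<subseteq> \<phi> ` U" using \<phi>U U(2) openE by blast
  then show ?case using U 0 by (intro exI[of _ \<delta>]) (simp add: f_def)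
next
  case (Suc n)
  \<comment> \<open>The denominator cancels the Lipschitz constant n + 2 of x \<mapsto> (x,
    \<open>f n x\<close>); the cap 1 in \<epsilon>2 makes \<open>f n\<close> Lipschitz with constant
    n + 1.\<close>
  define \<epsilon>1 where "\<epsilon>1 = \<epsilon> / (2 * (real n + 2))"
  define \<epsilon>2 where "\<epsilon>2 = min 1 (\<epsilon> / 2)"
  have \<epsilon>: "\<epsilon>1 > 0" "\<epsilon>2 > 0" using Suc.prems by (auto simp: \<epsilon>1_def \<epsilon>2_def)
  obtain \<delta>2 where \<delta>2: "\<delta>2 > 0" "ball a \<delta>2 \<subseteq> \<phi> ` U" "\<And>x. x \<in> ball a \<delta>2 \<Longrightarrow> nmul n (\<psi> x) \<in> U"
    "\<And>x y. x \<in> ball a \<delta>2 \<Longrightarrow> y \<in> ball a \<delta>2 \<Longrightarrow>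
      norm (f n x - f n y - real n *\<^sub>R (x - y)) \<le> \<epsilon>2 * norm (x - y)"
    using Suc.IH[OF \<epsilon>(2)] by blast
  obtain B2 :: "('e \<times> 'e) set" where B2: "finite B2" "span B2 = UNIV"
    using span_UNIV_prod[OF B] .
  obtain \<delta>1 where \<delta>1: "\<delta>1 > 0" "ball (a, a) \<delta>1 \<subseteq> W"
    and \<delta>1': "\<And>p q. p \<in> ball (a, a) \<delta>1 \<Longrightarrow> q \<in> ball (a, a) \<delta>1 \<Longrightarrow>
      norm (F p - F q - (\<lambda>(u, v). u + v) (p - q)) \<le> \<epsilon>1 * norm (p - q)"
    using C1_strict_derivative[OF B2 openW aaW C1F F_derivative \<epsilon>(1)] by blast
  define \<delta> where "\<delta> = min \<delta>2 (\<delta>1 / (real n + 2))"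
  have \<delta>: "\<delta> > 0" "ball a \<delta> \<subseteq> ball a \<delta>2" using \<delta>1 \<delta>2 by (auto simp: \<delta>_def)
  have lip: "norm (f n x - f n y) \<le> (real n + 1) * norm (x - y)"
    if "x \<in> ball a \<delta>" "y \<in> ball a \<delta>" for x y
  proof -
    have "norm (f n x - f n y) \<le> norm (f n x - f n y - real n *\<^sub>R (x - y)) + norm (real n *\<^sub>R (x - y))"
      using norm_triangle_ineq[of "f n x - f n y - real n *\<^sub>R (x - y)" "real n *\<^sub>R (x - y)"] by simp
    also have "\<dots> \<le> \<epsilon>2 * norm (x - y) + real n * norm (x - y)"
      using that by (intro add_mono \<delta>2(4) subsetD[OF \<delta>(2)]) simp_all
    also have "\<dots> \<le> 1 * norm (x - y) + real n * norm (x - y)"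
      by (intro add_mono mult_right_mono) (auto simp: \<epsilon>2_def)
    finally show ?thesis by (simp add: algebra_simps)
  qed
  have a\<delta>: "a \<in> ball a \<delta>" using \<delta> by simp
  have pair: "norm ((x, f n x) - (y, f n y)) \<le> (real n + 2) * norm (x - y)"
    if "x \<in> ball a \<delta>" "y \<in> ball a \<delta>" for x y
    using norm_Pair_add_le[of "x - y" "f n x - f n y"] lip[OF that] by (simp add: algebra_simps)
  have inW: "(x, f n x) \<in> ball (a, a) \<delta>1" if x: "x \<in> ball a \<delta>" for x
  proof -
    have "norm ((x, f n x) - (a, f n a)) \<le> (real n + 2) * norm (x - a)" by (rule pair[OF x a\<delta>])
    also have "norm (x - a) < \<delta>1 / (real n + 2)"
      using x by (simp add: \<delta>_def dist_norm norm_minus_commute)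
    then have "(real n + 2) * norm (x - a) < \<delta>1" by (simp add: field_simps)
    finally show ?thesis by (simp only: mem_ball dist_norm f_a norm_minus_commute[of "(a, a)"])
  qed
  have \<psi>f: "\<psi> (f n x) = nmul n (\<psi> x)" if "x \<in> ball a \<delta>" for x
    unfolding f_def by (intro \<psi>\<phi> \<delta>2(3) subsetD[OF \<delta>(2)] that)
  have fSuc: "f (Suc n) x = F (x, f n x)" if "x \<in> ball a \<delta>" for x
    using \<psi>f[OF that] by (simp add: F_def nmul_Suc f_def[of "Suc n"])
  have "nmul (Suc n) (\<psi> x) \<in> U" if x: "x \<in> ball a \<delta>" for x
  proof -
    have "(x, f n x) \<in> W" using inW[OF x] \<delta>1(2) by blast
    then show ?thesis using \<psi>f[OF x] by (simp add: W_def nmul_Suc)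
  qed
  moreover have "norm (f (Suc n) x - f (Suc n) y - real (Suc n) *\<^sub>R (x - y)) \<le> \<epsilon> * norm (x - y)"
    if xy: "x \<in> ball a \<delta>" "y \<in> ball a \<delta>" for x y
  proof -
    have "f (Suc n) x - f (Suc n) y - real (Suc n) *\<^sub>R (x - y)
      = (F (x, f n x) - F (y, f n y) - (\<lambda>(u, v). u + v) ((x, f n x) - (y, f n y)))
        + (f n x - f n y - real n *\<^sub>R (x - y))"
      using xy by (simp add: fSuc algebra_simps)
    then have "norm (f (Suc n) x - f (Suc n) y - real (Suc n) *\<^sub>R (x - y))
      \<le> norm (F (x, f n x) - F (y, f n y) - (\<lambda>(u, v). u + v) ((x, f n x) - (y, f n y)))
        + norm (f n x - f n y - real n *\<^sub>R (x - y))"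
      using norm_triangle_ineq by metis
    also have "\<dots> \<le> \<epsilon>1 * norm ((x, f n x) - (y, f n y)) + \<epsilon>2 * norm (x - y)"
      by (intro add_mono \<delta>1' \<delta>2(4) inW xy subsetD[OF \<delta>(2)])
    also have "\<dots> \<le> \<epsilon>1 * ((real n + 2) * norm (x - y)) + (\<epsilon> / 2) * norm (x - y)"
      using \<epsilon> pair[OF xy] by (intro add_mono mult_left_mono mult_right_mono) (auto simp: \<epsilon>2_def)
    also have "\<epsilon>1 * ((real n + 2) * norm (x - y)) = (\<epsilon> / 2) * norm (x - y)"
      by (simp add: \<epsilon>1_def field_simps)
    finally show ?thesis by simp
  qed
  ultimately show ?case using \<delta> \<delta>2(2) by (intro exI[of _ \<delta>]) blast
qed

lemma nbhd_from_chart: "r > 0 \<Longrightarrow> open {z \<in> U. \<phi> z \<in> ball a r}"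
  using continuous_open_preimage[of U \<phi> "ball a r"] hom U(1)
  by (simp add: homeomorphism_def Int_def vimage_def del: mem_ball)

lemma compact_nbhd: "\<exists>K :: 'g set. compact K \<and> 0 \<in> interior K"
proof -
  obtain r where r: "r > 0" "cball a r \<subseteq> \<phi> ` U"
    using \<phi>U U(2) open_contains_cball by blast
  have "compact (\<psi> ` cball a r)"
    using hom r by (intro compact_continuous_image compact_cball_finite_dimensional[OF B])
      (auto simp: homeomorphism_def intro: continuous_on_subset)
  moreover have "{z \<in> U. \<phi> z \<in> ball a r} \<subseteq> \<psi> ` cball a r"
  proof
    fix z assume z: "z \<in> {z \<in> U. \<phi> z \<in> ball a r}"
    then have "\<psi> (\<phi> z) \<in> \<psi> ` cball a r" by (intro imageI) auto
    then show "z \<in> \<psi> ` cball a r" using z \<psi>\<phi> by simp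
  qed
  then have "0 \<in> interior (\<psi> ` cball a r)"
    using nbhd_from_chart[OF r(1)] U(2) r(1) by (intro interiorI) auto
  ultimately show ?thesis by blast
qed

text \<open>With error 1/2 and n \<ge> 1, the map \<open>f n\<close> contracts distances by a factor
  of at most 2 near \<open>a\<close>. So it is injective there, which excludes small torsion, and
  its inverse is Lipschitz, which makes the local division continuous.\<close>

lemma torsion_division:
  assumes n: "n \<ge> 1"
  shows discrete_torsion: "\<exists>N :: 'g set. open N \<and> 0 \<in> N \<and> (\<forall>x\<in>N. nmul n x = 0 \<longrightarrow> x = 0)"
    and local_division: "\<exists>N \<rho>. open N \<and> (0 :: 'g) \<in> N \<and> continuous_on N \<rho> \<and> \<rho> 0 = 0 \<and> (\<forall>y\<in>N. nmul n (\<rho> y) = (y :: 'g))"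
proof -
  obtain \<delta> where \<delta>: "\<delta> > 0" "ball a \<delta> \<subseteq> \<phi> ` U" "\<And>x. x \<in> ball a \<delta> \<Longrightarrow> nmul n (\<psi> x) \<in> U"
    and f: "\<And>x y. x \<in> ball a \<delta> \<Longrightarrow> y \<in> ball a \<delta> \<Longrightarrow>
      norm (f n x - f n y - real n *\<^sub>R (x - y)) \<le> (1/2) * norm (x - y)"
    using strict_derivative_f[of "1/2" n] by force
  have lip: "norm (x - y) \<le> 2 * norm (f n x - f n y)" if "x \<in> ball a \<delta>" "y \<in> ball a \<delta>" for x y
  proof -
    have "norm (x - y) \<le> real n * norm (x - y)"
      using mult_right_mono[of 1 "real n" "norm (x - y)"] n by simp
    also have "\<dots> = norm (real n *\<^sub>R (x - y))" by simp
    also have "\<dots> \<le> norm (f n x - f n y) + norm (f n x - f n y - real n *\<^sub>R (x - y))"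
      using norm_triangle_ineq4[of "f n x - f n y" "f n x - f n y - real n *\<^sub>R (x - y)"] by simp
    also have "\<dots> \<le> norm (f n x - f n y) + (1/2) * norm (x - y)" using f[OF that] by simp
    finally show ?thesis by simp
  qed
  show "\<exists>N :: 'g set. open N \<and> 0 \<in> N \<and> (\<forall>x\<in>N. nmul n x = 0 \<longrightarrow> x = 0)"
  proof (intro exI conjI ballI impI)
    show "open {z \<in> U. \<phi> z \<in> ball a \<delta>}" by (rule nbhd_from_chart[OF \<delta>(1)])
    show "0 \<in> {z \<in> U. \<phi> z \<in> ball a \<delta>}" using U \<delta> by simp
    fix x assume x: "x \<in> {z \<in> U. \<phi> z \<in> ball a \<delta>}" and "nmul n x = 0"
    then have "f n (\<phi> x) = f n a" by (simp add: f_def \<psi>\<phi>)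
    then have "\<phi> x = a" using lip[of "\<phi> x" a] x \<delta>(1) by simp
    then show "x = 0" using x U(2) inj by (auto dest: inj_onD)
  qed
  define \<eta> where "\<eta> = inv_into (ball a \<delta>) (f n)"
  have sub: "ball a (\<delta> / 4) \<subseteq> f n ` ball a \<delta>"
    using strict_derivative_surjective[OF B \<delta>(1) n, of a "f n", OF f] by simp
  have \<eta>: "\<eta> y \<in> ball a \<delta>" "f n (\<eta> y) = y" if "y \<in> ball a (\<delta> / 4)" for y
    using that sub unfolding \<eta>_def by (blast intro: inv_into_into f_inv_into_f)+
  have "continuous_on (ball a (\<delta> / 4)) \<eta>"
  proof (rule continuous_onI)
    fix y and e :: real assume y: "y \<in> ball a (\<delta> / 4)" and e: "e > 0"
    show "\<exists>d>0. \<forall>z\<in>ball a (\<delta> / 4). dist z y < d \<longrightarrow> dist (\<eta> z) (\<eta> y) \<le> e"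
    proof (intro exI conjI ballI impI)
      fix z assume z: "z \<in> ball a (\<delta> / 4)" "dist z y < e / 2"
      show "dist (\<eta> z) (\<eta> y) \<le> e"
        using lip[OF \<eta>(1)[OF z(1)] \<eta>(1)[OF y]] z(2)
        unfolding \<eta>(2)[OF y] \<eta>(2)[OF z(1)] dist_norm by linarith
    qed (use e in simp)
  qed
  note \<eta>_cont = this
  define N where "N = {z \<in> U. \<phi> z \<in> ball a (\<delta> / 4)}"
  define \<rho> where "\<rho> z = \<psi> (\<eta> (\<phi> z))" for z
  show "\<exists>N \<rho>. open N \<and> (0 :: 'g) \<in> N \<and> continuous_on N \<rho> \<and> \<rho> 0 = 0 \<and> (\<forall>y\<in>N. nmul n (\<rho> y) = (y :: 'g))"
  proof (intro exI conjI ballI)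
    show "open N" unfolding N_def using \<delta> by (intro nbhd_from_chart) simp
    show "0 \<in> N" using U \<delta> by (simp add: N_def)
    show "continuous_on N \<rho>"
      unfolding \<rho>_def
    proof (rule continuous_on_compose2[of "\<phi> ` U" \<psi>])
      show "continuous_on (\<phi> ` U) \<psi>" using hom by (simp add: homeomorphism_def)
      show "continuous_on N (\<lambda>z. \<eta> (\<phi> z))"
        by (rule continuous_on_compose2[OF \<eta>_cont])
          (use hom in \<open>auto simp: N_def homeomorphism_def intro: continuous_on_subset\<close>)
      show "(\<lambda>z. \<eta> (\<phi> z)) ` N \<subseteq> \<phi> ` U"
        using \<eta>(1) \<delta>(2) by (auto simp: N_def simp del: mem_ball)
    qed
    have a4: "a \<in> ball a (\<delta> / 4)" using \<delta> by simp
    have "\<eta> a = a" using lip[OF \<eta>(1)[OF a4], of a] \<delta>(1) \<eta>(2)[OF a4] by simp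
    then show "\<rho> 0 = 0" by (simp add: \<rho>_def)
    fix y assume y: "y \<in> N"
    then have y4: "\<phi> y \<in> ball a (\<delta> / 4)" by (simp add: N_def)
    have "\<phi> (nmul n (\<rho> y)) = \<phi> y" using \<eta>(2)[OF y4] by (simp add: f_def \<rho>_def)
    moreover have "nmul n (\<rho> y) \<in> U" unfolding \<rho>_def by (rule \<delta>(3)[OF \<eta>(1)[OF y4]])
    ultimately show "nmul n (\<rho> y) = y" using inj y by (auto simp: N_def dest: inj_onD)
  qed
qed

end

text \<open>Any chart containing 0 serves; smoothness of addition is taken with this one chart for
  both arguments and for the result.\<close>

lemma abelian_lie_group_chart:
  fixes atlas :: "('g::{topological_ab_group_add, t2_space, second_countable_topology} set
                    \<times> ('g \<Rightarrow> 'e::real_normed_vector)) set"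
  assumes "abelian_lie_group_atlas atlas"
  obtains U and \<phi> :: "'g \<Rightarrow> 'e" and B where "lie_chart U \<phi> B"
proof -
  have sm: "smooth_atlas atlas" using assms by (simp add: abelian_lie_group_atlas_def)
  then have "0 \<in> \<Union>(fst ` atlas)" by (simp add: smooth_atlas_def)
  then obtain U \<phi> where U: "(U, \<phi>) \<in> atlas" "0 \<in> U" by force
  obtain B :: "'e set" where B: "finite B" "span B = UNIV"
    using sm unfolding smooth_atlas_def by blast
  have "\<forall>(U, \<phi>)\<in>atlas. open U \<and> open (\<phi> ` U) \<and> homeomorphism U (\<phi> ` U) \<phi> (inv_into U \<phi>)"
    using sm unfolding smooth_atlas_def by (elim conjE)
  note chart = bspec[OF this U(1), unfolded prod.case]
  have "\<forall>(U, \<phi>)\<in>atlas. \<forall>(V, \<psi>)\<in>atlas. \<forall>(W, \<theta>)\<in>atlas.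
        smooth_on {(x, y). x \<in> \<phi> ` U \<and> y \<in> \<psi> ` V \<and> inv_into U \<phi> x + inv_into V \<psi> y \<in> W}
          (\<lambda>(x, y). \<theta> (inv_into U \<phi> x + inv_into V \<psi> y))"
    using assms unfolding abelian_lie_group_atlas_def by (elim conjE)
  from bspec[OF this U(1), unfolded prod.case]
  have "\<forall>(V, \<psi>)\<in>atlas. \<forall>(W, \<theta>)\<in>atlas.
        smooth_on {(x, y). x \<in> \<phi> ` U \<and> y \<in> \<psi> ` V \<and> inv_into U \<phi> x + inv_into V \<psi> y \<in> W}
          (\<lambda>(x, y). \<theta> (inv_into U \<phi> x + inv_into V \<psi> y))" .
  from bspec[OF this U(1), unfolded prod.case]
  have "\<forall>(W, \<theta>)\<in>atlas.
        smooth_on {(x, y). x \<in> \<phi> ` U \<and> y \<in> \<phi> ` U \<and> inv_into U \<phi> x + inv_into U \<phi> y \<in> W}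
          (\<lambda>(x, y). \<theta> (inv_into U \<phi> x + inv_into U \<phi> y))" .
  note mult = bspec[OF this U(1), unfolded prod.case]
  have "lie_chart U \<phi> B"
    using B U(2) chart mult by (intro lie_chart.intro) blast+
  then show ?thesis by (rule that)
qed

section \<open>Divisibility and finiteness of torsion\<close>

text \<open>If b < M, the powers of M / b would outgrow A; the exponent 1 excludes b = 0.\<close>

lemma nat_le_of_power_bound:
  fixes M A b :: nat
  assumes "\<And>i. M ^ i \<le> A * b ^ i"
  shows "M \<le> b"
proof (rule ccontr)
  assume "\<not> M \<le> b"
  then have lt: "b < M" by simp
  have b: "b > 0" using assms[of 1] lt by (cases "b = 0") auto
  have "real M / real b > 1" using lt b by simp
  then obtain i where i: "real A < (real M / real b) ^ i" using real_arch_pow by blast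
  have "real (M ^ i) \<le> real (A * b ^ i)" using assms of_nat_mono by blast
  then have "(real M / real b) ^ i \<le> real A" using b by (simp add: power_divide divide_le_eq)
  with i show False by simp
qed

lemma open_translate_diff:
  fixes N :: "'g::topological_ab_group_add set"
  assumes "open N"
  shows "open {z. z - x \<in> N}"
proof -
  have "open ((\<lambda>z. z - x) -` N)"
    by (rule open_vimage[OF assms]) (intro continuous_intros)
  then show ?thesis by (simp add: vimage_def)
qed

text \<open>The set and its complement are both unions of translates of N, so both are open. Serves
  for the group of n-th multiples and for the group generated by a neighbourhood of 0.\<close>

lemma open_subgroup_eq_UNIV:
  fixes H N :: "'g::topological_ab_group_add set"
  assumes conn: "connected (UNIV :: 'g set)"
    and H: "\<And>x y. x \<in> H \<Longrightarrow> y \<in> H \<Longrightarrow> x - y \<in> H" and N: "open N" "0 \<in> N" "N \<subseteq> H"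
  shows "H = UNIV"
proof -
  have add: "x + y \<in> H" if "x \<in> H" "y \<in> H" for x y
    using H[OF that(1) H[OF H[OF that(2) that(2)] that(2)]] by simp
  have "open H"
  proof (subst open_subopen, rule ballI)
    fix x assume x: "x \<in> H"
    have "{z. z - x \<in> N} \<subseteq> H"
    proof
      fix z assume "z \<in> {z. z - x \<in> N}"
      then have "x + (z - x) \<in> H" using x N(3) by (intro add) auto
      then show "z \<in> H" by simp
    qed
    then show "\<exists>T. open T \<and> x \<in> T \<and> T \<subseteq> H"
      using open_translate_diff[OF N(1)] N(2) by (intro exI[of _ "{z. z - x \<in> N}"]) simp
  qed
  moreover have "open (- H)"
  proof (subst open_subopen, rule ballI)
    fix x assume x: "x \<in> - H"
    have "{z. z - x \<in> N} \<subseteq> - H"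
    proof
      fix z assume z: "z \<in> {z. z - x \<in> N}"
      have "z \<notin> H"
      proof
        assume zH: "z \<in> H"
        have "z - x \<in> H" using z N(3) by blast
        from H[OF zH this] have "x \<in> H" by simp
        with x show False by simp
      qed
      then show "z \<in> - H" by simp
    qed
    then show "\<exists>T. open T \<and> x \<in> T \<and> T \<subseteq> - H"
      using open_translate_diff[OF N(1)] N(2) by (intro exI[of _ "{z. z - x \<in> N}"]) simp
  qed
  ultimately have "H \<inter> UNIV = {} \<or> - H \<inter> UNIV = {}"
    by (intro connectedD[OF conn]) auto
  then show ?thesis using N by auto
qed

section \<open>Sumsets as word balls, and packings\<close>

primrec sumset_power :: "'g::ab_group_add set \<Rightarrow> nat \<Rightarrow> 'g set" where
  "sumset_power V 0 = {0}"
| "sumset_power V (Suc k) = {a + b | a b. a \<in> sumset_power V k \<and> b \<in> V}"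

text \<open>A packing at scale W. In the same picture \<open>sumset_power V k\<close> is the ball of
  radius k for word length in V.\<close>

definition separated :: "'g::ab_group_add set \<Rightarrow> 'g set \<Rightarrow> bool" where
  "separated W E \<longleftrightarrow> (\<forall>a\<in>E. \<forall>b\<in>E. a - b \<in> W \<longrightarrow> a = b)"

lemma sumset_power_add:
  "x \<in> sumset_power V k \<Longrightarrow> y \<in> sumset_power V l \<Longrightarrow> x + y \<in> sumset_power V (k + l)"
proof (induction l arbitrary: y)
  case (Suc l)
  then obtain a b where ab: "y = a + b" "a \<in> sumset_power V l" "b \<in> V" by auto
  have "x + a \<in> sumset_power V (k + l)" using Suc.IH Suc.prems(1) ab(2) .
  then have "(x + a) + b \<in> sumset_power V (Suc (k + l))" unfolding sumset_power.simps using ab(3) by blast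
  then show ?case by (simp add: ab(1) add.assoc)
qed simp

lemma sumset_power_minus:
  assumes "\<And>v. v \<in> V \<Longrightarrow> - v \<in> V"
  shows "x \<in> sumset_power V k \<Longrightarrow> - x \<in> sumset_power V k"
proof (induction k arbitrary: x)
  case (Suc k)
  then obtain a b where ab: "x = a + b" "a \<in> sumset_power V k" "b \<in> V" by auto
  have "- a + - b \<in> sumset_power V (Suc k)"
    unfolding sumset_power.simps using Suc.IH[OF ab(2)] assms[OF ab(3)] by blast
  then show ?case by (simp add: ab(1))
qed simp

lemma sumset_power_mono:
  assumes "0 \<in> V" "k \<le> l"
  shows "sumset_power V k \<subseteq> sumset_power V l"
  using assms(2)
proof (induction l rule: dec_induct)
  case (step l)
  have "sumset_power V l \<subseteq> sumset_power V (Suc l)"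
  proof
    fix x assume "x \<in> sumset_power V l"
    then have "x + 0 \<in> sumset_power V (Suc l)" unfolding sumset_power.simps using assms(1) by blast
    then show "x \<in> sumset_power V (Suc l)" by simp
  qed
  with step show ?case by blast
qed simp

text \<open>Pigeonhole: two points of E in one translate of N differ by an element of W. The bound
  is uniform in the centre x.\<close>

lemma separated_card_le_cover:
  assumes C: "finite C" "\<And>v. v \<in> V \<Longrightarrow> \<exists>c\<in>C. v - c \<in> N"
    and N: "\<And>a b. a \<in> N \<Longrightarrow> b \<in> N \<Longrightarrow> a - b \<in> W"
    and E: "separated W E" "\<And>e. e \<in> E \<Longrightarrow> e - x \<in> V"
  shows "finite E" "card E \<le> card C"
proof -
  define c where "c e = (SOME c. c \<in> C \<and> e - x - c \<in> N)" for e
  have "c e \<in> C \<and> e - x - c e \<in> N" if "e \<in> E" for e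
    unfolding c_def by (rule someI_ex) (use C(2)[OF E(2)[OF that]] in blast)
  then have c: "\<And>e. e \<in> E \<Longrightarrow> c e \<in> C" "\<And>e. e \<in> E \<Longrightarrow> e - x - c e \<in> N" by blast+
  have inj: "inj_on c E"
  proof (rule inj_onI)
    fix a b assume ab: "a \<in> E" "b \<in> E" "c a = c b"
    have "(a - x - c a) - (b - x - c b) \<in> W" using c(2)[OF ab(1)] c(2)[OF ab(2)] by (rule N)
    then have "a - b \<in> W" using ab(3) by simp
    then show "a = b" using E(1) ab by (simp add: separated_def)
  qed
  have sub: "c ` E \<subseteq> C" using c(1) by blast
  show "finite E" using inj_on_finite[OF inj sub C(1)] .
  show "card E \<le> card C" using card_inj_on_le[OF inj sub C(1)] .
qed

text \<open>Greedy selection: keep a point, discard the at most m points within V of it, repeat.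
  This leads from a packing at scale W back to one at scale V for the price of a factor m.\<close>

lemma separated_refine:
  assumes V: "0 \<in> V" "\<And>v. v \<in> V \<Longrightarrow> - v \<in> V"
    and bound: "\<And>E x. separated W E \<Longrightarrow> (\<And>e. e \<in> E \<Longrightarrow> e - x \<in> V) \<Longrightarrow> card E \<le> m"
  shows "finite E \<Longrightarrow> separated W E \<Longrightarrow> \<exists>E'\<subseteq>E. separated V E' \<and> card E \<le> m * card E'"
proof (induction E rule: finite_psubset_induct)
  case (psubset E)
  show ?case
  proof (cases "E = {}")
    case True
    then show ?thesis by (simp add: separated_def)
  next
    case False
    then obtain a where a: "a \<in> E" by blast
    define R where "R = {b \<in> E. b - a \<in> V}"
    have aR: "a \<in> R" using a V(1) by (simp add: R_def)
    have "separated W R" "separated W (E - R)" using psubset.prems by (auto simp: separated_def R_def)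
    then have cR: "card R \<le> m" by (intro bound[of R a]) (auto simp: R_def)
    have "E - R \<subset> E" using a aR by blast
    then obtain E' where E': "E' \<subseteq> E - R" "separated V E'" "card (E - R) \<le> m * card E'"
      using psubset.IH[OF _ \<open>separated W (E - R)\<close>] by metis
    have fin: "finite E'" using E'(1) psubset.hyps finite_subset by blast
    have new: "a \<notin> E'" using E'(1) aR by blast
    have 1: "b - a \<notin> V" if "b \<in> E'" for b using that E'(1) by (auto simp: R_def)
    have 2: "a - b \<notin> V" if "b \<in> E'" for b using 1[OF that] V(2)[of "a - b"] by auto
    have "separated V (insert a E')"
      unfolding separated_def using 1 2 E'(2)[unfolded separated_def] by blast
    moreover have "insert a E' \<subseteq> E" using a E'(1) by blast
    moreover have "card E = card R + card (E - R)"
      using psubset.hyps by (subst card_Diff_subset) (auto simp: R_def card_mono)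
    then have "card E \<le> m * card (insert a E')" using cR E'(3) fin new by simp
    ultimately show ?thesis by blast
  qed
qed

section \<open>Connected groups with local division and discrete torsion\<close>

locale lie_type_group =
  fixes K :: "'g::{topological_ab_group_add, t2_space} set"
  assumes conn: "connected (UNIV :: 'g set)"
    and K: "compact K" "0 \<in> interior K"
    and discrete_torsion: "\<And>n. n \<ge> 1 \<Longrightarrow> \<exists>N :: 'g set. open N \<and> 0 \<in> N \<and> (\<forall>x\<in>N. nmul n x = 0 \<longrightarrow> x = 0)"
    and local_division: "\<And>n. n \<ge> 1 \<Longrightarrow> \<exists>N \<rho>. open N \<and> (0 :: 'g) \<in> N \<and> continuous_on N \<rho> \<and> \<rho> 0 = 0 \<and>
      (\<forall>y\<in>N. nmul n (\<rho> y) = y)"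
begin

lemma divisible:
  assumes "n \<ge> 1"
  shows "\<exists>x :: 'g. nmul n x = y"
proof -
  obtain N and \<rho> :: "'g \<Rightarrow> 'g" where N: "open N" "0 \<in> N" "\<And>y. y \<in> N \<Longrightarrow> nmul n (\<rho> y) = y"
    using local_division[OF assms] by blast
  have "range (nmul n) = (UNIV :: 'g set)"
  proof (rule open_subgroup_eq_UNIV[OF conn _ N(1,2)])
    show "x - y \<in> range (nmul n)" if "x \<in> range (nmul n)" "y \<in> range (nmul n)" for x y :: 'g
      using that by (auto simp flip: nmul_diff)
    show "N \<subseteq> range (nmul n)"
    proof
      fix y assume "y \<in> N"
      from N(3)[OF this, symmetric] show "y \<in> range (nmul n)" by (rule range_eqI)
    qed
  qed
  then have "y \<in> range (nmul n)" by simp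
  then show ?thesis by (auto simp: eq_commute)
qed

definition "V = K \<union> uminus ` K"

lemma compact_V: "compact V"
  unfolding V_def using K(1) by (intro compact_Un compact_continuous_image continuous_on_minus continuous_on_id)

lemma V_minus: "v \<in> V \<Longrightarrow> - v \<in> V"
  by (auto simp: V_def)

lemma zero_interior_V: "0 \<in> interior V"
  using K(2) interior_mono[of K V] by (auto simp: V_def)

lemma zero_V: "0 \<in> V"
  using zero_interior_V interior_subset by blast

abbreviation "P \<equiv> sumset_power V"

lemma exhaust_P: "\<exists>k. x \<in> P k"
proof -
  have "(\<Union>k. P k) = UNIV"
  proof (rule open_subgroup_eq_UNIV[OF conn _ open_interior zero_interior_V])
    show "x - y \<in> (\<Union>k. P k)" if "x \<in> (\<Union>k. P k)" "y \<in> (\<Union>k. P k)" for x y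
    proof -
      obtain k l where kl: "x \<in> P k" "y \<in> P l" using \<open>x \<in> (\<Union>k. P k)\<close> \<open>y \<in> (\<Union>k. P k)\<close> by blast
      have "- y \<in> P l" using V_minus kl(2) by (rule sumset_power_minus)
      from sumset_power_add[OF kl(1) this] show ?thesis unfolding diff_conv_add_uminus by blast
    qed
    have "V \<subseteq> P (Suc 0)" by auto
    then show "interior V \<subseteq> (\<Union>k. P k)" using interior_subset by blast
  qed
  then show ?thesis by blast
qed

lemma finite_subset_P:
  assumes "finite A"
  shows "\<exists>k\<ge>1. A \<subseteq> P k"
  using assms
proof (induction A)
  case (insert x A)
  then obtain k where k: "k \<ge> 1" "A \<subseteq> P k" by blast
  obtain l where l: "x \<in> P l" using exhaust_P by blast
  have "insert x A \<subseteq> P (max k l)"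
    using k l sumset_power_mono[OF zero_V, of k "max k l"] sumset_power_mono[OF zero_V, of l "max k l"] by auto
  then show ?case using k(1) by (intro exI[of _ "max k l"]) auto
qed auto

lemma compact_cover_translates:
  assumes "compact S" "open N" "0 \<in> N"
  obtains C where "finite C" "C \<subseteq> S" "\<And>v. v \<in> S \<Longrightarrow> \<exists>c\<in>C. v - c \<in> (N :: 'g set)"
proof -
  have "S \<subseteq> (\<Union>c\<in>S. {z. z - c \<in> N})" using assms(3) by auto
  from compactE_image[OF assms(1) open_translate_diff[OF assms(2)] this]
  obtain C where "C \<subseteq> S" "finite C" "S \<subseteq> (\<Union>c\<in>C. {z. z - c \<in> N})" by blast
  then show ?thesis by (intro that) auto
qed

text \<open>V is covered by finitely many translates of a neighbourhood on which the local division
  has values in V. The finitely many centres are divided arbitrarily, so their quotients have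
  bounded length; dividing a sum of k elements termwise then costs the factor
  \<open>Suc l\<close>.\<close>

lemma bounded_division:
  assumes n: "n \<ge> 1"
  shows "\<exists>c. \<forall>k. \<forall>y\<in>P k. \<exists>x\<in>P (c * k). nmul n x = y"
proof -
  obtain N \<rho> where N: "open N" "(0 :: 'g) \<in> N" "continuous_on N \<rho>" "\<rho> 0 = 0" "\<And>y. y \<in> N \<Longrightarrow> nmul n (\<rho> y) = (y :: 'g)"
    using local_division[OF n] by blast
  define N' where "N' = N \<inter> \<rho> -` interior V"
  have "open N'" unfolding N'_def using N(1,3) by (intro continuous_open_preimage) auto
  moreover have "0 \<in> N'" using N zero_interior_V by (simp add: N'_def)
  ultimately obtain C where C: "finite C" "C \<subseteq> V" "\<And>v. v \<in> V \<Longrightarrow> \<exists>c\<in>C. v - c \<in> N'"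
    using compact_cover_translates[OF compact_V] by blast
  obtain s :: "'g \<Rightarrow> 'g" where s: "\<And>c. nmul n (s c) = c" using divisible[OF n] by metis
  obtain l where l: "s ` C \<subseteq> P l" using finite_subset_P[of "s ` C"] C(1) by blast
  have V: "\<exists>x\<in>P (Suc l). nmul n x = v" if v: "v \<in> V" for v
  proof -
    obtain c where c: "c \<in> C" "v - c \<in> N'" using C(3)[OF v] by blast
    have "\<rho> (v - c) \<in> V" using c(2) interior_subset by (auto simp: N'_def)
    then have "s c + \<rho> (v - c) \<in> P (Suc l)" unfolding sumset_power.simps using c(1) l by blast
    moreover have "nmul n (s c + \<rho> (v - c)) = v"
      using N(5)[of "v - c"] c(2) by (simp add: nmul_plus s N'_def)
    ultimately show ?thesis by blast
  qed
  have "\<exists>x\<in>P (Suc l * k). nmul n x = y" if "y \<in> P k" for k y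
    using that
  proof (induction k arbitrary: y)
    case (Suc k)
    then obtain a b where ab: "y = a + b" "a \<in> P k" "b \<in> V" by auto
    obtain x where x: "x \<in> P (Suc l * k)" "nmul n x = a" using Suc.IH[OF ab(2)] by blast
    obtain z where z: "z \<in> P (Suc l)" "nmul n z = b" using V[OF ab(3)] by blast
    have "x + z \<in> P (Suc l * k + Suc l)" using x(1) z(1) by (rule sumset_power_add)
    then have "x + z \<in> P (Suc l * Suc k)" by (simp add: algebra_simps del: sumset_power.simps)
    moreover have "nmul n (x + z) = y" by (simp add: nmul_plus x z ab)
    ultimately show ?case by blast
  qed simp
  then show ?thesis by blast
qed

text \<open>Polynomial growth, which is where commutativity enters: \<open>V + V \<subseteq> F + V\<close> with \<open>F\<close> finite,
  so \<open>P k\<close> is covered by the translates of \<open>V\<close> by sums of at most \<open>k\<close> elements of \<open>F\<close>.\<close>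

lemma polynomial_growth:
  shows "\<exists>r. \<forall>k. \<exists>L. finite L \<and> card L \<le> (k + 1) ^ r \<and> (\<forall>x\<in>P k. \<exists>l\<in>L. x - l \<in> V)"
proof -
  have "compact ((\<lambda>(x, y). x + y) ` (V \<times> V))"
  proof (rule compact_continuous_image)
    show "continuous_on (V \<times> V) (\<lambda>(x, y). x + y)"
      unfolding split_beta' by (rule continuous_on_add[OF continuous_on_fst[OF continuous_on_id] continuous_on_snd[OF continuous_on_id]])
    show "compact (V \<times> V)" by (rule compact_Times[OF compact_V compact_V])
  qed
  from compact_cover_translates[OF this open_interior zero_interior_V]
  obtain F where F1: "finite F"
    and F2: "\<And>v. v \<in> (\<lambda>(x, y). x + y) ` (V \<times> V) \<Longrightarrow> \<exists>c\<in>F. v - c \<in> interior V"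
    by metis
  have F: "\<exists>f\<in>F. x + y - f \<in> V" if "x \<in> V" "y \<in> V" for x y
  proof -
    have "x + y \<in> (\<lambda>(x, y). x + y) ` (V \<times> V)" using that by (intro image_eqI[of _ _ "(x, y)"]) auto
    from F2[OF this] show ?thesis using interior_subset[of V] by blast
  qed
  \<comment> \<open>By commutativity a sum of elements of F is known from its multiplicities; with
    each of them at most k there are (k + 1) ^ card F of these.\<close>
  define s where "s \<alpha> = (\<Sum>f\<in>F. nmul (\<alpha> f) f)" for \<alpha> :: "'g \<Rightarrow> nat"
  define L where "L k = s ` (F \<rightarrow>\<^sub>E {..k})" for k
  have cover: "\<exists>l\<in>L k. x - l \<in> V" if "x \<in> P k" for k x
    using that
  proof (induction k arbitrary: x)
    case 0
    have "s (restrict (\<lambda>_. 0) F) = 0" by (simp add: s_def)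
    then have "0 \<in> L 0" unfolding L_def by (intro image_eqI[of _ _ "restrict (\<lambda>_. 0) F"]) simp_all
    moreover have "x - 0 \<in> V" using 0 zero_V by simp
    ultimately show ?case by blast
  next
    case (Suc k)
    then obtain a b where ab: "x = a + b" "a \<in> P k" "b \<in> V" by auto
    obtain l where l: "l \<in> L k" "a - l \<in> V" using Suc.IH[OF ab(2)] by blast
    obtain f where f: "f \<in> F" "(a - l) + b - f \<in> V" using F[OF l(2) ab(3)] by blast
    obtain \<alpha> where \<alpha>: "\<alpha> \<in> F \<rightarrow>\<^sub>E {..k}" "l = s \<alpha>" using l(1) by (auto simp: L_def)
    have "s (\<alpha>(f := Suc (\<alpha> f))) = nmul (Suc (\<alpha> f)) f + (\<Sum>g\<in>F - {f}. nmul (\<alpha> g) g)"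
      using F1 f(1) by (simp add: s_def sum.remove[of F f])
    also have "\<dots> = f + s \<alpha>"
      using F1 f(1) by (simp add: s_def sum.remove[of F f] nmul_Suc)
    finally have "s (\<alpha>(f := Suc (\<alpha> f))) = f + l" using \<alpha>(2) by simp
    moreover have "\<alpha>(f := Suc (\<alpha> f)) \<in> F \<rightarrow>\<^sub>E {..Suc k}"
      using \<alpha>(1) f(1) by (auto simp: PiE_iff extensional_def intro: le_SucI)
    ultimately have "f + l \<in> L (Suc k)" unfolding L_def by (rule image_eqI[OF sym])
    moreover have "x - (f + l) \<in> V" using f(2) by (simp add: ab(1) algebra_simps)
    ultimately show ?case by blast
  qed
  have fin: "finite (F \<rightarrow>\<^sub>E {..k})" for k :: nat using F1 by (intro finite_PiE) simp_all
  have "card (L k) \<le> card (F \<rightarrow>\<^sub>E {..k})" for k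
    unfolding L_def by (rule card_image_le[OF fin])
  also have "card (F \<rightarrow>\<^sub>E {..k}) = (k + 1) ^ card F" for k :: nat
    using F1 by (simp add: card_PiE)
  finally have "finite (L k) \<and> card (L k) \<le> (k + 1) ^ card F \<and> (\<forall>x\<in>P k. \<exists>l\<in>L k. x - l \<in> V)" for k
    using cover fin by (simp only: L_def finite_imageI simp_thms) blast
  note bound = this
  show ?thesis
  proof (intro exI allI)
    show "finite (L k) \<and> card (L k) \<le> (k + 1) ^ card F \<and> (\<forall>x\<in>P k. \<exists>l\<in>L k. x - l \<in> V)" for k
      by (rule bound)
  qed
qed

text \<open>A large finite set \<open>\<Delta>\<close> of \<open>n\<close>-torsion elements would make packing numbers grow too fast:
  the \<open>n\<close>-th parts of a separated set in \<open>P k\<close> come in \<open>card \<Delta>\<close> translates inside \<open>P ((c + 1) k)\<close>.\<close>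

lemma finite_torsion:
  assumes n: "n \<ge> 1"
  shows "finite {x :: 'g. nmul n x = 0}"
proof -
  obtain N0 :: "'g set" where N0: "open N0" "0 \<in> N0" "\<And>x. x \<in> N0 \<Longrightarrow> nmul n x = 0 \<Longrightarrow> x = 0"
    using discrete_torsion[OF n] by blast
  \<comment> \<open>Chosen so that \<open>q (a, \<delta>) - q (b, \<epsilon>) \<in> W\<close> below
    forces a = b after multiplication by n, and then \<delta> = \<epsilon> inside
    \<open>N0\<close>.\<close>
  define W where "W = {x \<in> N0. nmul n x \<in> V}"
  define W0 where "W0 = N0 \<inter> nmul n -` interior V \<inter> interior V"
  have "open (nmul n -` interior V)"
    by (rule open_vimage[OF open_interior]) (intro continuous_intros)
  then have W0: "open W0" "0 \<in> W0" using N0 zero_interior_V by (auto simp: W0_def)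
  have W0W: "W0 \<subseteq> W" "W0 \<subseteq> V" using interior_subset by (auto simp: W0_def W_def)
  define N1 where "N1 = (\<lambda>z :: 'g \<times> 'g. fst z - snd z) -` W0"
  have N1: "open N1"
    unfolding N1_def
    by (rule open_vimage[OF W0(1) continuous_on_diff[OF continuous_on_fst[OF continuous_on_id] continuous_on_snd[OF continuous_on_id]]])
  have N1': "(0, 0) \<in> N1" using W0(2) by (simp add: N1_def)
  obtain A1 A2 where A: "open A1" "open A2" "(0 :: 'g, 0 :: 'g) \<in> A1 \<times> A2" "A1 \<times> A2 \<subseteq> N1"
    using open_prod_elim[OF N1 N1'] by blast
  \<comment> \<open>Differences of elements of N lie in W and in V, so a single cover of V by
    translates of N bounds packings at both scales.\<close>
  define N where "N = A1 \<inter> A2"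
  have N: "open N" "0 \<in> N" "\<And>a b. a \<in> N \<Longrightarrow> b \<in> N \<Longrightarrow> a - b \<in> W0"
    using A by (auto simp: N_def N1_def)
  obtain C where "finite C" "C \<subseteq> V" and C0: "\<And>v. v \<in> V \<Longrightarrow> \<exists>c\<in>C. v - c \<in> N"
    by (rule compact_cover_translates[OF compact_V N(1,2)]) blast
  note C = this(1) C0
  define m where "m = card C"
  have NW: "a - b \<in> W" if "a \<in> N" "b \<in> N" for a b
    by (rule subsetD[OF W0W(1) N(3)[OF that]])
  have NV: "a - b \<in> V" if "a \<in> N" "b \<in> N" for a b
    by (rule subsetD[OF W0W(2) N(3)[OF that]])
  have boundW: "card E \<le> m" if "separated W E" "\<And>e. e \<in> E \<Longrightarrow> e - x \<in> V" for E x
    unfolding m_def by (rule separated_card_le_cover(2)[of C V N W]) (fact C NW that)+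
  have boundV: "finite E" "card E \<le> m" if "separated V E" "\<And>e. e \<in> E \<Longrightarrow> e - x \<in> V" for E x
    unfolding m_def by (rule separated_card_le_cover[of C V N V]; fact C NV that)+
  obtain c where c: "\<forall>k. \<forall>y\<in>P k. \<exists>x\<in>P (c * k). nmul n x = y"
    using bounded_division[OF n] by blast
  obtain r where r: "\<forall>k. \<exists>L. finite L \<and> card L \<le> (k + 1) ^ r \<and> (\<forall>x\<in>P k. \<exists>l\<in>L. x - l \<in> V)"
    using polynomial_growth by blast
  \<comment> \<open>Each of the polynomially many translates of V covering \<open>P k\<close> holds
    at most m points of a packing.\<close>
  have upper: "card E \<le> (k + 1) ^ r * m" if E: "separated V E" "E \<subseteq> P k" for E k
  proof -
    obtain L where L: "finite L" "card L \<le> (k + 1) ^ r" "\<forall>x\<in>P k. \<exists>l\<in>L. x - l \<in> V"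
      using r[rule_format, of k] by blast
    define E' where "E' l = {e \<in> E. e - l \<in> V}" for l
    have E': "finite (E' l)" "card (E' l) \<le> m" for l
    proof -
      have "separated V (E' l)" using E(1) unfolding separated_def E'_def by blast
      note bounds = boundV[OF this, of l]
      show "finite (E' l)" by (rule bounds(1)) (simp add: E'_def)
      show "card (E' l) \<le> m" by (rule bounds(2)) (simp add: E'_def)
    qed
    have "E \<subseteq> (\<Union>l\<in>L. E' l)" using L(3) E(2) unfolding E'_def by blast
    then have "card E \<le> card (\<Union>l\<in>L. E' l)" by (intro card_mono finite_UN_I L(1) E'(1))
    also have "\<dots> \<le> (\<Sum>l\<in>L. card (E' l))" by (rule card_UN_le[OF L(1)])
    also have "\<dots> \<le> card L * m" using sum_bounded_above[of L "\<lambda>l. card (E' l)" m, OF E'(2)] by simp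
    also have "\<dots> \<le> (k + 1) ^ r * m" using L(2) by (rule mult_right_mono) simp
    finally show ?thesis .
  qed
  have bdd: "card \<Delta> \<le> m * (c + 1) ^ r" if \<Delta>: "finite \<Delta>" "\<Delta> \<subseteq> {x :: 'g. nmul n x = 0}" for \<Delta>
  proof -
    obtain j where j: "j \<ge> 1" "\<Delta> \<subseteq> P j" using finite_subset_P[OF \<Delta>(1)] by blast
    \<comment> \<open>One round multiplies the radius by c + 1 and the cardinality by at least card
      \<Delta> / m. The condition j \<le> k places \<Delta> inside \<open>P k\<close>, which
      accounts for the summand 1 in c + 1.\<close>
    have step: "\<exists>E1. finite E1 \<and> separated V E1 \<and> E1 \<subseteq> P ((c + 1) * k) \<and> card E * card \<Delta> \<le> m * card E1"
      if k: "j \<le> k" and E: "finite E" "separated V E" "E \<subseteq> P k" for k E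
    proof -
      have "\<forall>y\<in>E. \<exists>x\<in>P (c * k). nmul n x = y" using subsetD[OF E(3)] c by blast
      then obtain s where s: "\<And>y. y \<in> E \<Longrightarrow> s y \<in> P (c * k)" "\<And>y. y \<in> E \<Longrightarrow> nmul n (s y) = y"
        by metis
      define q where "q = (\<lambda>(a, \<delta>). s a + \<delta>)"
      have key: "a = b \<and> \<delta> = \<epsilon>" if "a \<in> E" "b \<in> E" "\<delta> \<in> \<Delta>" "\<epsilon> \<in> \<Delta>" "q (a, \<delta>) - q (b, \<epsilon>) \<in> W" for a b \<delta> \<epsilon>
      proof -
        have t: "nmul n \<delta> = 0" "nmul n \<epsilon> = 0" using that \<Delta>(2) by auto
        have "nmul n (q (a, \<delta>) - q (b, \<epsilon>)) = a - b"
          using t s(2)[OF that(1)] s(2)[OF that(2)] by (simp add: q_def nmul_plus nmul_diff)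
        then have "a - b \<in> V" using that(5) by (simp add: W_def)
        with E(2)[unfolded separated_def, rule_format, OF that(1,2)] have ab: "a = b" .
        then have "\<delta> - \<epsilon> \<in> N0" using that(5) by (simp add: q_def W_def)
        moreover have "nmul n (\<delta> - \<epsilon>) = 0" using t by (simp add: nmul_diff)
        ultimately have "\<delta> - \<epsilon> = 0" by (rule N0(3))
        then show ?thesis using ab by simp
      qed
      define E' where "E' = q ` (E \<times> \<Delta>)"
      have "0 \<in> W" using W0 W0W by blast
      have inj: "inj_on q (E \<times> \<Delta>)"
      proof (rule inj_onI)
        fix u v assume u: "u \<in> E \<times> \<Delta>" and v: "v \<in> E \<times> \<Delta>" and "q u = q v"
        then have "q (fst u, snd u) - q (fst v, snd v) \<in> W" using \<open>0 \<in> W\<close> by simp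
        with u v have "fst u = fst v \<and> snd u = snd v" by (intro key) (simp_all add: mem_Times_iff)
        then show "u = v" by (simp add: prod_eq_iff)
      qed
      have sepE': "separated W E'" unfolding separated_def
      proof (intro ballI impI)
        fix x y assume xy: "x \<in> E'" "y \<in> E'" "x - y \<in> W"
        obtain u where u: "x = q u" "u \<in> E \<times> \<Delta>" using xy(1) unfolding E'_def by (rule imageE)
        obtain v where v: "y = q v" "v \<in> E \<times> \<Delta>" using xy(2) unfolding E'_def by (rule imageE)
        have "q (fst u, snd u) - q (fst v, snd v) \<in> W" using xy(3) by (simp only: u v prod.collapse)
        with u(2) v(2) have "fst u = fst v \<and> snd u = snd v" by (intro key) (simp_all add: mem_Times_iff)
        then have "u = v" by (simp add: prod_eq_iff)
        then show "x = y" by (simp add: u(1) v(1))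
      qed
      have finE': "finite E'" unfolding E'_def using E(1) \<Delta>(1) by simp
      have "q (a, \<delta>) \<in> P ((c + 1) * k)" if "a \<in> E" "\<delta> \<in> \<Delta>" for a \<delta>
      proof -
        have "\<delta> \<in> P k" using sumset_power_mono[OF zero_V k] j(2) that by blast
        from sumset_power_add[OF s(1)[OF that(1)] this] show ?thesis
          by (simp add: q_def algebra_simps del: sumset_power.simps)
      qed
      then have sub: "E' \<subseteq> P ((c + 1) * k)" unfolding E'_def by blast
      obtain E1 where E1: "E1 \<subseteq> E'" "separated V E1" "card E' \<le> m * card E1"
      proof -
        have "\<exists>E1\<subseteq>E'. separated V E1 \<and> card E' \<le> m * card E1"
          by (rule separated_refine[of V W m]) (fact zero_V V_minus boundW finE' sepE')+
        then show thesis using that by blast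
      qed
      have "card E' = card E * card \<Delta>" by (simp add: E'_def card_image[OF inj] card_cartesian_product)
      then have "card E * card \<Delta> \<le> m * card E1" using E1(3) by simp
      then show ?thesis using E1(2) finite_subset[OF E1(1) finE'] subset_trans[OF E1(1) sub] by blast
    qed
    have lower: "\<exists>E. finite E \<and> separated V E \<and> E \<subseteq> P ((c + 1) ^ i * j) \<and> card \<Delta> ^ i \<le> m ^ i * card E" for i
    proof (induction i)
      case 0
      have "0 \<in> P j" using sumset_power_mono[OF zero_V, of 0 j] by auto
      then show ?case by (intro exI[of _ "{0}"]) (simp add: separated_def)
    next
      case (Suc i)
      then obtain E where E: "finite E" "separated V E" "E \<subseteq> P ((c + 1) ^ i * j)" "card \<Delta> ^ i \<le> m ^ i * card E"
        by blast
      have "j \<le> (c + 1) ^ i * j" by simp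
      from step[OF this E(1-3)] obtain E1 where E1: "finite E1" "separated V E1"
        "E1 \<subseteq> P ((c + 1) * ((c + 1) ^ i * j))" "card E * card \<Delta> \<le> m * card E1" by blast
      have "card \<Delta> ^ Suc i \<le> (m ^ i * card E) * card \<Delta>"
        unfolding power_Suc2 using E(4) by (rule mult_right_mono) simp
      also have "\<dots> = m ^ i * (card E * card \<Delta>)" by simp
      also have "\<dots> \<le> m ^ i * (m * card E1)" using E1(4) by (intro mult_left_mono) auto
      finally have "card \<Delta> ^ Suc i \<le> m ^ Suc i * card E1" by (simp add: ac_simps)
      moreover have "E1 \<subseteq> P ((c + 1) ^ Suc i * j)" using E1(3) by (simp only: power_Suc mult.assoc)
      ultimately show ?case using E1(1,2) by blast
    qed
    \<comment> \<open>After i rounds the lower bound meets the polynomial upper bound. As j \<ge> 1,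
      the radius is positive, and x + 1 \<le> 2 x moves the offset into the constant in
      front.\<close>
    have "card \<Delta> ^ i \<le> (m * (2 * j) ^ r) * (m * (c + 1) ^ r) ^ i" for i
    proof -
      obtain E where E: "separated V E" "E \<subseteq> P ((c + 1) ^ i * j)" "card \<Delta> ^ i \<le> m ^ i * card E"
        using lower[of i] by blast
      have "1 \<le> (c + 1) ^ i * j" using j(1) by simp
      then have "((c + 1) ^ i * j + 1) ^ r \<le> (2 * ((c + 1) ^ i * j)) ^ r" by (intro power_mono) auto
      also have "\<dots> = (2 * j) ^ r * ((c + 1) ^ r) ^ i"
        by (simp add: power_mult_distrib ac_simps flip: power_mult)
      finally have "((c + 1) ^ i * j + 1) ^ r * m \<le> ((2 * j) ^ r * ((c + 1) ^ r) ^ i) * m"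
        by (rule mult_right_mono) simp
      with upper[OF E(1,2)] have "card E \<le> ((2 * j) ^ r * ((c + 1) ^ r) ^ i) * m" by (rule order_trans)
      from order_trans[OF E(3) mult_left_mono[OF this]]
      show ?thesis by (simp add: power_mult_distrib ac_simps)
    qed
    then show ?thesis by (rule nat_le_of_power_bound)
  qed
  show ?thesis by (rule conjunct1[OF finite_if_finite_subsets_card_bdd, OF bdd])
qed

end

section \<open>The points of the arrangement in a fibre\<close>

context lie_type_group
begin

lemma imul_divisible:
  assumes "k \<noteq> 0"
  shows "\<exists>x :: 'g. imul k x = y"
proof -
  have "nat \<bar>k\<bar> \<ge> 1" using assms by linarith
  from divisible[OF this] obtain z :: 'g where z: "nmul (nat \<bar>k\<bar>) z = y" by blast
  have "imul k (imul (sgn k) z) = y"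
    unfolding imul_imul_commute[of k] imul_sgn by (rule z)
  then show ?thesis by (rule exI)
qed

text \<open>A nonempty fibre is contained in a translate of the finite |k|-torsion.\<close>

lemma finite_imul_fibre:
  assumes "k \<noteq> 0"
  shows "finite {x :: 'g. imul k x = y}"
proof (cases "{x :: 'g. imul k x = y} = {}")
  case True
  then show ?thesis by simp
next
  case False
  then obtain x0 where x0: "imul k x0 = y" by blast
  have fin: "finite {x :: 'g. nmul (nat \<bar>k\<bar>) x = 0}" using assms by (intro finite_torsion) auto
  have "{x. imul k x = y} \<subseteq> (\<lambda>x. x0 + x) ` {x. nmul (nat \<bar>k\<bar>) x = 0}"
  proof
    fix x assume "x \<in> {x. imul k x = y}"
    then have "imul k (x - x0) = 0" using x0 by (simp add: imul_diff)
    then have "nmul (nat \<bar>k\<bar>) (x - x0) = 0" unfolding imul_sgn[symmetric] by simp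
    then show "x \<in> (\<lambda>x. x0 + x) ` {x. nmul (nat \<bar>k\<bar>) x = 0}"
      by (intro image_eqI[of _ _ "x - x0"]) simp_all
  qed
  then show ?thesis using finite_imageI[OF fin] by (rule finite_subset)
qed

lemma imul_local_division:
  assumes "k \<noteq> 0"
  shows "\<exists>N \<rho>. open N \<and> (0 :: 'g) \<in> N \<and> continuous_on N \<rho> \<and> \<rho> 0 = 0 \<and> (\<forall>y\<in>N. imul k (\<rho> y) = y)"
proof -
  have "nat \<bar>k\<bar> \<ge> 1" using assms by linarith
  from local_division[OF this] obtain N \<rho> where N: "open N" "(0 :: 'g) \<in> N" "continuous_on N \<rho>"
    "\<rho> 0 = 0" "\<forall>y\<in>N. nmul (nat \<bar>k\<bar>) (\<rho> y) = y" by (elim exE conjE)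
  show ?thesis
  proof (intro exI conjI ballI)
    show "continuous_on N (\<lambda>y. imul (sgn k) (\<rho> y))" by (rule continuous_on_imul[OF N(3)])
    show "imul (sgn k) (\<rho> 0) = 0" by (simp add: N(4))
    show "imul k (imul (sgn k) (\<rho> y)) = y" if "y \<in> N" for y
      unfolding imul_imul_commute[of k] imul_sgn by (rule bspec[OF N(5) that])
  qed (fact N)+
qed

end

section \<open>The torus and its splitting into base and fibre\<close>

lemma torus_memI: "(\<And>x y. t (x + y) = t x + t y) \<Longrightarrow> t \<in> torus"
  by (simp add: torus_def Modules.additive_def)

lemma torus_add: "t \<in> torus \<Longrightarrow> t (x + y) = t x + t y"
  by (simp add: torus_def Modules.additive_def)

lemma torus_zero: "t \<in> torus \<Longrightarrow> t 0 = 0"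
  using torus_add[of t 0 0] by simp

lemma torus_imul: "t \<in> torus \<Longrightarrow> t (imul k x) = imul k (t x)"
  by (rule additive_imul) (simp add: torus_def)

lemma torus_sum: "t \<in> torus \<Longrightarrow> t (\<Sum>i\<in>A. f i) = (\<Sum>i\<in>A. t (f i))"
  by (induction A rule: infinite_finite_induct) (simp_all add: torus_zero torus_add)

lemma continuous_on_coordinate [continuous_intros]:
  "continuous_on S (\<lambda>t :: 'a \<Rightarrow> 'b::topological_space. t x)"
  by (rule continuous_on_subset[OF continuous_on_product_coordinates subset_UNIV])

text \<open>The splitting of \<open>\<gamma>\<close> along \<open>\<Gamma>' \<oplus> \<Gamma>''\<close> is \<open>imul (\<kappa> \<gamma>) e + \<pi> \<gamma>\<close>, and \<open>coord\<close>, \<open>basis\<close> present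
  \<open>\<Gamma>\<close> as a free group of rank \<open>d\<close>.\<close>

locale fibered_arrangement = lie_type_group K
  for K :: "'g::{topological_ab_group_add, t2_space} set" +
  fixes \<XX> :: "'c::ab_group_add set" and Y :: "('c \<Rightarrow> 'g) set"
    and \<kappa> :: "'c \<Rightarrow> int" and e :: 'c and \<pi> :: "'c \<Rightarrow> 'c"
    and d :: nat and basis :: "nat \<Rightarrow> 'c" and coord :: "'c \<Rightarrow> nat \<Rightarrow> int"
  assumes finite_\<XX>: "finite \<XX>"
    and M_ideal: "M_ideal \<XX> Y"
    and \<kappa>_add: "\<kappa> (x + y) = \<kappa> x + \<kappa> y" and \<pi>_add: "\<pi> (x + y) = \<pi> x + \<pi> y"
    and split: "x = imul (\<kappa> x) e + \<pi> x"
    and \<kappa>_e: "\<kappa> e = 1" and \<pi>_e: "\<pi> e = 0" and \<kappa>_\<pi>: "\<kappa> (\<pi> x) = 0" and \<pi>_\<pi>: "\<pi> (\<pi> x) = \<pi> x"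
    and Y: "Y = {t \<in> torus. \<forall>x. t (\<pi> x) = 0}"
    and expand: "x = (\<Sum>i<d. imul (coord x i) (basis i))"
    and coord_add: "coord (x + y) i = coord x i + coord y i"
    and vertical: "\<not> \<XX> \<subseteq> sub_characters \<XX> Y"
begin

text \<open>The point with value x at e over the restriction of t to \<Gamma>''. The base point is
  given by any t in its coset: only the values at \<open>\<pi> \<gamma>\<close> enter.\<close>

definition insert_fibre :: "('c \<Rightarrow> 'g) \<Rightarrow> 'g \<Rightarrow> 'c \<Rightarrow> 'g" where
  "insert_fibre t x = (\<lambda>\<gamma>. t (\<pi> \<gamma>) + imul (\<kappa> \<gamma>) x)"

definition "\<XX>h = sub_characters \<XX> Y"

definition "\<XX>v = \<XX> - \<XX>h"

text \<open>The preimage of M(\<A>/Y) in T, see \<open>coset_in_quotient_complement_iff\<close>. The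
  horizontal characters \<open>\<XX>h\<close> are those whose components descend to T/Y; the
  vertical ones \<open>\<XX>v\<close> cut the fibres.\<close>

definition good :: "('c \<Rightarrow> 'g) set" where
  "good = {t \<in> torus. \<forall>\<eta>\<in>\<XX>h. t \<notin> hyper \<eta>}"

definition S :: "('c \<Rightarrow> 'g) \<Rightarrow> 'g set" where
  "S t = {x. \<exists>\<eta>\<in>\<XX>v. insert_fibre t x \<in> hyper \<eta>}"

lemma insert_fibre_in_torus: "t \<in> torus \<Longrightarrow> insert_fibre t x \<in> torus"
  by (rule torus_memI) (simp add: insert_fibre_def \<pi>_add \<kappa>_add torus_add imul_add)

lemma insert_fibre_self:
  assumes "t \<in> torus"
  shows "insert_fibre t (t e) = t"
proof
  fix \<gamma>
  have "t \<gamma> = t (imul (\<kappa> \<gamma>) e + \<pi> \<gamma>)" using split[of \<gamma>] by (rule arg_cong)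
  also have "\<dots> = insert_fibre t (t e) \<gamma>"
    by (simp add: torus_add[OF assms] torus_imul[OF assms] insert_fibre_def)
  finally show "insert_fibre t (t e) \<gamma> = t \<gamma>" by (rule sym)
qed

lemma insert_fibre_e: "t \<in> torus \<Longrightarrow> insert_fibre t x e = x"
  by (simp add: insert_fibre_def \<pi>_e \<kappa>_e torus_zero)

lemma insert_fibre_\<pi>: "insert_fibre t x (\<pi> \<gamma>) = t (\<pi> \<gamma>)"
  by (simp add: insert_fibre_def \<pi>_\<pi> \<kappa>_\<pi>)

lemma insert_fibre_hyper:
  "t \<in> torus \<Longrightarrow> insert_fibre t x \<in> hyper \<eta> \<longleftrightarrow> imul (\<kappa> \<eta>) x = - t (\<pi> \<eta>)"
  using insert_fibre_in_torus[of t x]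
  by (simp add: hyper_def insert_fibre_def eq_neg_iff_add_eq_0 add.commute)

lemma continuous_on_insert_fibre [continuous_intros]:
  assumes "continuous_on A f" "continuous_on A g"
  shows "continuous_on A (\<lambda>z. insert_fibre (f z) (g z))"
proof (rule continuous_on_coordinatewise_then_product)
  fix \<gamma>
  show "continuous_on A (\<lambda>z. insert_fibre (f z) (g z) \<gamma>)"
    unfolding insert_fibre_def
    by (rule continuous_on_add[OF continuous_on_product_then_coordinatewise[OF assms(1)] continuous_on_imul[OF assms(2)]])
qed

lemma coset_eq:
  assumes t: "t \<in> torus"
  shows "coset Y t = {s \<in> torus. \<forall>\<gamma>. s (\<pi> \<gamma>) = t (\<pi> \<gamma>)}"
proof (rule set_eqI, rule iffI)
  fix s assume "s \<in> coset Y t"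
  then obtain y where y: "y \<in> Y" "s = (\<lambda>x. t x + y x)" unfolding coset_def by (rule imageE)
  have "y \<in> torus" "\<forall>\<gamma>. y (\<pi> \<gamma>) = 0" using y(1) by (simp_all add: Y)
  then show "s \<in> {s \<in> torus. \<forall>\<gamma>. s (\<pi> \<gamma>) = t (\<pi> \<gamma>)}"
    using t by (auto intro!: torus_memI simp: y(2) torus_add)
next
  fix s assume s: "s \<in> {s \<in> torus. \<forall>\<gamma>. s (\<pi> \<gamma>) = t (\<pi> \<gamma>)}"
  then have "(\<lambda>x. s x - t x) \<in> Y" using t by (auto intro!: torus_memI simp: Y torus_add)
  then show "s \<in> coset Y t" unfolding coset_def by (rule rev_image_eqI) simp
qed

lemma coset_self: "t \<in> torus \<Longrightarrow> t \<in> coset Y t"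
  by (simp add: coset_eq)

lemma coset_eq_iff:
  "t \<in> torus \<Longrightarrow> s \<in> torus \<Longrightarrow> coset Y t = coset Y s \<longleftrightarrow> (\<forall>\<gamma>. t (\<pi> \<gamma>) = s (\<pi> \<gamma>))"
  by (auto simp: coset_eq set_eq_iff)

lemma coset_eq_range:
  assumes t: "t \<in> torus"
  shows "coset Y t = range (insert_fibre t)"
proof (rule set_eqI, rule iffI)
  fix s assume "s \<in> coset Y t"
  then have s: "s \<in> torus" "\<And>\<gamma>. s (\<pi> \<gamma>) = t (\<pi> \<gamma>)" by (auto simp: coset_eq[OF t])
  have "insert_fibre t (s e) = insert_fibre s (s e)" by (simp add: insert_fibre_def s(2))
  then have "s = insert_fibre t (s e)" by (simp only: insert_fibre_self[OF s(1)])
  then show "s \<in> range (insert_fibre t)" by (rule range_eqI)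
next
  fix s assume "s \<in> range (insert_fibre t)"
  then show "s \<in> coset Y t" by (auto simp: coset_eq[OF t] insert_fibre_in_torus[OF t] insert_fibre_\<pi>)
qed

lemma union_of_cosetsD:
  assumes H: "union_of_cosets Y H" "t \<in> H" and s: "s \<in> torus" "\<And>\<gamma>. s (\<pi> \<gamma>) = t (\<pi> \<gamma>)"
  shows "s \<in> H"
proof -
  obtain C where C: "C \<subseteq> coset Y ` torus" "H = \<Union>C" using H(1) unfolding union_of_cosets_def by (elim exE conjE)
  obtain c where c: "c \<in> C" "t \<in> c" using H(2) C(2) by blast
  obtain u where u: "u \<in> torus" "c = coset Y u" using C(1) c(1) by blast
  have "s \<in> coset Y u" using c(2) s by (simp add: u(2) coset_eq[OF u(1)])
  then show ?thesis using c(1) u(2) C(2) by blast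
qed

lemma hyper_subset_torus: "hyper \<eta> \<subseteq> torus"
  by (auto simp: hyper_def)

lemma component_subset_torus: "H \<in> components (hyper \<eta>) \<Longrightarrow> H \<subseteq> torus"
  using in_components_subset hyper_subset_torus by (rule subset_trans)

lemma component_of_hyper:
  fixes t :: "'c \<Rightarrow> 'g"
  assumes "t \<in> hyper \<eta>"
  obtains H where "H \<in> components (hyper \<eta>)" "t \<in> H"
proof -
  have "t \<in> \<Union>(components (hyper \<eta>))" using assms by (simp only: Union_components)
  then show ?thesis using that by blast
qed

text \<open>If the coefficient at e vanished, the equation would not see the fibre coordinate. A
  fibre is an image of the connected group, so it would lie in one component, and every component
  would be a union of cosets.\<close>

lemma \<kappa>_nonzero:
  assumes "\<eta> \<in> \<XX>v"
  shows "\<kappa> \<eta> \<noteq> 0"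
proof
  assume 0: "\<kappa> \<eta> = 0"
  have "components (hyper \<eta> :: ('c \<Rightarrow> 'g) set) \<subseteq> sub_arrangement \<XX> Y"
  proof
    fix C :: "('c \<Rightarrow> 'g) set" assume C: "C \<in> components (hyper \<eta>)"
    have sub: "coset Y t \<subseteq> C" if t: "t \<in> C" for t
    proof (rule components_maximal[OF C])
      have tor: "t \<in> torus" using component_subset_torus[OF C] t by (rule subsetD)
      show "connected (coset Y t)" unfolding coset_eq_range[OF tor]
        by (intro connected_continuous_image conn continuous_on_insert_fibre continuous_on_const continuous_on_id)
      have "t \<in> hyper \<eta>" using in_components_subset[OF C] t by (rule subsetD)
      then have "t (\<pi> \<eta>) = 0"
        using insert_fibre_hyper[OF tor, of "t e" \<eta>] by (simp add: insert_fibre_self[OF tor] 0)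
      then show "coset Y t \<subseteq> hyper \<eta>"
        unfolding coset_eq_range[OF tor] by (auto simp: insert_fibre_hyper[OF tor] 0)
      show "C \<inter> coset Y t \<noteq> {}" using t coset_self[OF tor] by blast
    qed
    have "C = \<Union>(coset Y ` C)"
    proof
      show "C \<subseteq> \<Union>(coset Y ` C)" using coset_self component_subset_torus[OF C] by blast
      show "\<Union>(coset Y ` C) \<subseteq> C" using sub by blast
    qed
    moreover have "coset Y ` C \<subseteq> coset Y ` torus" using component_subset_torus[OF C] by (rule image_mono)
    ultimately have "union_of_cosets Y C" unfolding union_of_cosets_def by (intro exI[of _ "coset Y ` C"] conjI)
    moreover have "C \<in> arrangement \<XX>" using C assms by (auto simp: arrangement_def \<XX>v_def)
    ultimately show "C \<in> sub_arrangement \<XX> Y" by (simp add: sub_arrangement_def)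
  qed
  then have "\<eta> \<in> \<XX>h" using assms by (simp add: \<XX>h_def \<XX>v_def sub_characters_def)
  then show False using assms by (simp add: \<XX>v_def)
qed

text \<open>That \<eta> is vertical says only that some component is not a union of cosets;
  components of one \<open>hyper\<close> are translates of each other, so none is.\<close>

lemma vertical_component:
  assumes \<eta>: "\<eta> \<in> \<XX>v" and H: "H \<in> components (hyper \<eta>)"
  shows "H \<in> arrangement \<XX> - sub_arrangement \<XX> Y"
proof -
  have \<XX>: "\<eta> \<in> \<XX>" using \<eta> by (simp add: \<XX>v_def)
  have "\<not> components (hyper \<eta> :: ('c \<Rightarrow> 'g) set) \<subseteq> sub_arrangement \<XX> Y"
    using \<eta> by (simp add: \<XX>v_def \<XX>h_def sub_characters_def)
  then obtain C :: "('c \<Rightarrow> 'g) set" where C: "C \<in> components (hyper \<eta>)" "C \<notin> sub_arrangement \<XX> Y" by blast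
  have "C \<in> arrangement \<XX>" unfolding arrangement_def using \<XX> C(1) by (rule UN_I)
  then have "\<not> union_of_cosets Y C" using C(2) by (simp add: sub_arrangement_def)
  then have "\<not> union_of_cosets Y H" using union_of_cosets_component[OF H C(1)] by blast
  moreover have "H \<in> arrangement \<XX>" unfolding arrangement_def using \<XX> H by (rule UN_I)
  ultimately show ?thesis by (simp add: sub_arrangement_def)
qed

text \<open>A common point would lie in a member H3 of the sub-arrangement. As H3 contains whole
  cosets, it would contain t itself, which is excluded for good t.\<close>

lemma vertical_disjoint:
  assumes t: "t \<in> good" and H: "H1 \<in> arrangement \<XX> - sub_arrangement \<XX> Y" "H2 \<in> arrangement \<XX> - sub_arrangement \<XX> Y"
    and x: "insert_fibre t x \<in> H1" "insert_fibre t x \<in> H2"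
  shows "H1 = H2"
proof (rule ccontr)
  assume ne: "H1 \<noteq> H2"
  have tor: "t \<in> torus" using t by (simp add: good_def)
  have "insert_fibre t x \<in> \<Union>(components (H1 \<inter> H2))" using x by (simp only: Union_components Int_iff)
  then obtain X where X: "X \<in> components (H1 \<inter> H2)" "insert_fibre t x \<in> X" by blast
  obtain H3 where H3: "H3 \<in> sub_arrangement \<XX> Y" "X \<subseteq> H3"
    using M_ideal[unfolded M_ideal_def] H ne X(1) by meson
  have u: "union_of_cosets Y H3" using H3(1) by (simp add: sub_arrangement_def)
  have "t \<in> H3" by (rule union_of_cosetsD[OF u subsetD[OF H3(2) X(2)] tor]) (simp add: insert_fibre_\<pi>)
  have "H3 \<in> arrangement \<XX>h" using H3(1) by (simp add: \<XX>h_def arrangement_sub_characters)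
  then obtain \<eta> where \<eta>: "\<eta> \<in> \<XX>h" "H3 \<in> components (hyper \<eta>)" unfolding arrangement_def by (rule UN_E)
  have "t \<in> hyper \<eta>" using in_components_subset[OF \<eta>(2)] \<open>t \<in> H3\<close> by (rule subsetD)
  then show False using t \<eta>(1) by (simp add: good_def)
qed

section \<open>Connectedness and divisibility of the torus\<close>

lemma torus_parametrization:
  assumes "t \<in> torus"
  shows "t \<gamma> = (\<Sum>i<d. imul (coord \<gamma> i) (t (basis i)))"
proof -
  have "t \<gamma> = t (\<Sum>i<d. imul (coord \<gamma> i) (basis i))" using expand[of \<gamma>] by (rule arg_cong)
  then show ?thesis by (simp only: torus_sum[OF assms] torus_imul[OF assms])
qed

lemma torus_of_coordinates: "(\<lambda>\<gamma>. \<Sum>i<d. imul (coord \<gamma> i) (y i)) \<in> torus"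
  by (rule torus_memI) (simp add: coord_add imul_add sum.distrib)

text \<open>The torus is a continuous image of a countable power of the group, in which only the
  first d coordinates are used.\<close>

lemma connected_torus: "connected (torus :: ('c \<Rightarrow> 'g) set)"
proof -
  let ?f = "\<lambda>(y :: nat \<Rightarrow> 'g) \<gamma>. \<Sum>i<d. imul (coord \<gamma> i) (y i)"
  have "connected_space (euclidean :: 'g topology)"
    using conn connectedin_topspace[of "euclidean :: 'g topology"] by simp
  then have "connected_space (product_topology (\<lambda>_ :: nat. euclidean :: 'g topology) UNIV)"
    unfolding connected_space_product_topology by simp
  then have "connected_space (euclidean :: (nat \<Rightarrow> 'g) topology)" by (simp only: euclidean_product_topology)
  then have "connected (UNIV :: (nat \<Rightarrow> 'g) set)"
    using connectedin_topspace[of "euclidean :: (nat \<Rightarrow> 'g) topology"] by simp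
  moreover have "continuous_on UNIV ?f"
    by (intro continuous_on_coordinatewise_then_product continuous_on_sum continuous_on_imul continuous_on_coordinate)
  ultimately have "connected (range ?f)" by (intro connected_continuous_image)
  moreover have "range ?f = torus"
  proof
    show "range ?f \<subseteq> torus" using torus_of_coordinates by (rule image_subsetI)
    show "torus \<subseteq> range ?f"
    proof
      fix t :: "'c \<Rightarrow> 'g" assume t: "t \<in> torus"
      have "t = ?f (\<lambda>i. t (basis i))" using torus_parametrization[OF t] by (rule ext)
      then show "t \<in> range ?f" by (intro image_eqI[of t ?f "\<lambda>i. t (basis i)"] UNIV_I)
    qed
  qed
  ultimately show ?thesis by simp
qed

lemma torus_divisible:
  fixes t :: "'c \<Rightarrow> 'g"
  assumes t: "t \<in> torus" and k: "k \<noteq> 0"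
  shows "\<exists>s\<in>torus. \<forall>\<gamma>. imul k (s \<gamma>) = t \<gamma>"
proof -
  define y where "y i = (SOME x. imul k x = t (basis i))" for i
  have y: "imul k (y i) = t (basis i)" for i
    unfolding y_def by (rule someI_ex[OF imul_divisible[OF k]])
  have "imul k (\<Sum>i<d. imul (coord \<gamma> i) (y i)) = t \<gamma>" for \<gamma>
    unfolding torus_parametrization[OF t, of \<gamma>] imul_sum imul_imul_commute[of k] y ..
  then show ?thesis by (intro bexI[OF _ torus_of_coordinates[of y]] allI)
qed

text \<open>\<open>H\<close> is invariant under translation by the connected group of all \<open>insert_fibre (k v) (- v (\<pi> \<eta>))\<close>,
  \<open>k = \<kappa> \<eta>\<close>, which acts transitively on the base.\<close>

lemma fibre_shift:
  assumes \<eta>: "\<eta> \<in> \<XX>v" and H: "H \<in> components (hyper \<eta>)" and t: "t \<in> torus" "t' \<in> torus"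
  shows "\<exists>s :: 'g. \<forall>x. insert_fibre t x \<in> H \<longrightarrow> insert_fibre t' (x + s) \<in> H"
proof -
  define k where "k = \<kappa> \<eta>"
  have diff: "(\<lambda>\<gamma>. t' \<gamma> - t \<gamma>) \<in> torus" using t by (intro torus_memI) (simp add: torus_add)
  \<comment> \<open>Division by k makes the translation by \<open>\<phi> u\<close> lead exactly from
    the fibre over t to the fibre over t'.\<close>
  obtain u where u: "u \<in> torus" "\<And>\<gamma>. imul k (u \<gamma>) = t' \<gamma> - t \<gamma>"
    using torus_divisible[OF diff \<kappa>_nonzero[OF \<eta>]] unfolding k_def by blast
  \<comment> \<open>Over a base point of the form k v the equation k x = - k v
    (\<open>\<pi> \<eta>\<close>) has the root - v (\<open>\<pi> \<eta>\<close>), continuous and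
    additive in v. A general base point would require a choice of root.\<close>
  define \<phi> where "\<phi> v = (\<lambda>\<gamma>. imul k (v (\<pi> \<gamma>)) - imul (\<kappa> \<gamma>) (v (\<pi> \<eta>)))" for v :: "'c \<Rightarrow> 'g"
  have \<phi>hyper: "\<phi> v \<in> hyper \<eta>" if "v \<in> torus" for v
  proof -
    have "\<phi> v \<in> torus"
      by (rule torus_memI) (simp add: \<phi>_def \<pi>_add \<kappa>_add torus_add[OF that] imul_add imul_plus)
    moreover have "\<phi> v \<eta> = 0" by (simp add: \<phi>_def k_def)
    ultimately show ?thesis by (simp add: hyper_def)
  qed
  have shift: "(\<lambda>\<gamma>. z \<gamma> + \<phi> u \<gamma>) \<in> H" if z: "z \<in> H" for z
  proof -
    let ?f = "\<lambda>v \<gamma>. z \<gamma> + \<phi> v \<gamma>"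
    have zh: "z \<in> hyper \<eta>" using in_components_subset[OF H] z by (rule subsetD)
    have "?f ` torus \<subseteq> H"
    proof (rule components_maximal[OF H])
      have "continuous_on torus ?f"
      proof (rule continuous_on_coordinatewise_then_product)
        fix \<gamma> show "continuous_on torus (\<lambda>v. z \<gamma> + \<phi> v \<gamma>)"
          unfolding \<phi>_def
          by (intro continuous_on_add continuous_on_diff continuous_on_const continuous_on_imul continuous_on_coordinate)
      qed
      then show "connected (?f ` torus)" using connected_torus by (rule connected_continuous_image)
      show "?f ` torus \<subseteq> hyper \<eta>" using hyper_translate(1)[OF zh \<phi>hyper] by (rule image_subsetI)
      have "(\<lambda>_. 0) \<in> torus" by (rule torus_memI) simp
      moreover have "?f (\<lambda>_. 0) = z" by (simp add: \<phi>_def)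
      ultimately have "z \<in> ?f ` torus" by (intro image_eqI[of z ?f "\<lambda>_. 0"]) (rule sym)
      then show "H \<inter> ?f ` torus \<noteq> {}" using z by blast
    qed
    then show ?thesis using imageI[OF u(1)] by (rule subsetD)
  qed
  have eq: "insert_fibre t' (x + - u (\<pi> \<eta>)) = (\<lambda>\<gamma>. insert_fibre t x \<gamma> + \<phi> u \<gamma>)" for x
    by (rule ext) (simp add: insert_fibre_def \<phi>_def u(2) imul_plus imul_minus imul_diff)
  show ?thesis
  proof (intro exI allI impI)
    show "insert_fibre t' (x + - u (\<pi> \<eta>)) \<in> H" if "insert_fibre t x \<in> H" for x
      unfolding eq using that by (rule shift)
  qed
qed

lemma S_eq: "t \<in> torus \<Longrightarrow> S t = (\<Union>\<eta>\<in>\<XX>v. {x. imul (\<kappa> \<eta>) x = - t (\<pi> \<eta>)})"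
  by (auto simp: S_def insert_fibre_hyper)

lemma finite_S: "t \<in> torus \<Longrightarrow> finite (S t)"
  unfolding S_eq using finite_\<XX> \<kappa>_nonzero by (intro finite_UN_I finite_imul_fibre) (simp_all add: \<XX>v_def)

lemma S_nonempty:
  assumes "t \<in> torus"
  shows "S t \<noteq> {}"
proof -
  obtain \<eta> where \<eta>: "\<eta> \<in> \<XX>v" using vertical by (auto simp: \<XX>v_def \<XX>h_def)
  obtain x where "imul (\<kappa> \<eta>) x = - t (\<pi> \<eta>)" using imul_divisible[OF \<kappa>_nonzero[OF \<eta>]] by blast
  then show ?thesis using \<eta> by (auto simp: S_eq[OF assms])
qed

text \<open>Each point is shifted by an amount depending only on its chosen component. If two images
  coincide, the two components meet over t', hence are equal, hence the shifts and the original
  points are equal. Only the target t' has to be good.\<close>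

lemma card_S_le:
  assumes t: "t \<in> torus" and t': "t' \<in> good"
  shows "card (S t) \<le> card (S t')"
proof -
  have tor': "t' \<in> torus" using t' by (simp add: good_def)
  have "\<exists>\<eta> H. \<eta> \<in> \<XX>v \<and> H \<in> components (hyper \<eta>) \<and> insert_fibre t x \<in> H" if x: "x \<in> S t" for x
  proof -
    obtain \<eta> where \<eta>: "\<eta> \<in> \<XX>v" "insert_fibre t x \<in> hyper \<eta>" using x by (auto simp: S_def)
    obtain H where "H \<in> components (hyper \<eta>)" "insert_fibre t x \<in> H" by (rule component_of_hyper[OF \<eta>(2)])
    then show ?thesis using \<eta>(1) by blast
  qed
  then obtain X H where XH: "\<And>x. x \<in> S t \<Longrightarrow> X x \<in> \<XX>v" "\<And>x. x \<in> S t \<Longrightarrow> H x \<in> components (hyper (X x))"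
    "\<And>x. x \<in> S t \<Longrightarrow> insert_fibre t x \<in> H x" by metis
  define s where "s H = (SOME s :: 'g. \<forall>x. insert_fibre t x \<in> H \<longrightarrow> insert_fibre t' (x + s) \<in> H)" for H
  have shift: "insert_fibre t' (x + s (H x)) \<in> H x" if "x \<in> S t" for x
    using someI_ex[OF fibre_shift[OF XH(1)[OF that] XH(2)[OF that] t tor']] XH(3)[OF that]
    unfolding s_def by blast
  have inj: "inj_on (\<lambda>x. x + s (H x)) (S t)"
  proof (rule inj_onI)
    fix x y assume xy: "x \<in> S t" "y \<in> S t" and eq: "x + s (H x) = y + s (H y)"
    have "H x = H y"
      by (rule vertical_disjoint[OF t' vertical_component[OF XH(1)[OF xy(1)] XH(2)[OF xy(1)]]
            vertical_component[OF XH(1)[OF xy(2)] XH(2)[OF xy(2)]] shift[OF xy(1)]])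
        (unfold eq, rule shift[OF xy(2)])
    then show "x = y" using eq by simp
  qed
  have "(\<lambda>x. x + s (H x)) ` S t \<subseteq> S t'"
  proof (rule image_subsetI)
    fix x assume x: "x \<in> S t"
    have "insert_fibre t' (x + s (H x)) \<in> hyper (X x)"
      using in_components_subset[OF XH(2)[OF x]] shift[OF x] by (rule subsetD)
    then show "x + s (H x) \<in> S t'" using XH(1)[OF x] by (auto simp: S_def)
  qed
  then show ?thesis using inj finite_S[OF tor'] by (intro card_inj_on_le)
qed

text \<open>Between good points the inequality holds in both directions; over an empty base any
  positive k serves.\<close>

lemma card_S: "\<exists>k>0. \<forall>t\<in>good. card (S t) = k"
proof (cases "good = {}")
  case True
  then show ?thesis by (intro exI[of _ 1]) simp
next
  case False
  then obtain t0 where t0: "t0 \<in> good" by blast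
  have tor: "t \<in> torus" if "t \<in> good" for t using that by (simp add: good_def)
  have "card (S t0) > 0" using S_nonempty[OF tor[OF t0]] finite_S[OF tor[OF t0]] by (simp add: card_gt_0_iff)
  moreover have "card (S t) = card (S t0)" if "t \<in> good" for t
    using card_S_le[OF tor[OF that] t0] card_S_le[OF tor[OF t0] that] by (rule le_antisym)
  ultimately show ?thesis by blast
qed

lemma complement_eq: "arrangement_complement \<XX> = {t \<in> good. t e \<notin> S t}"
proof -
  have "t e \<in> S t \<longleftrightarrow> (\<exists>\<eta>\<in>\<XX>v. t \<in> hyper \<eta>)" if "t \<in> torus" for t
    by (simp add: S_def insert_fibre_self[OF that])
  moreover have "\<XX> = \<XX>h \<union> \<XX>v" by (auto simp: \<XX>h_def \<XX>v_def sub_characters_def)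
  ultimately show ?thesis by (auto simp: arrangement_complement_def good_def)
qed

text \<open>Members of the sub-arrangement contain whole cosets, so meeting the coset of t is the
  same as containing t; their union is that of all \<open>hyper \<eta>\<close> with \<eta>
  horizontal.\<close>

lemma coset_in_quotient_complement_iff:
  assumes t: "t \<in> torus"
  shows "coset Y t \<in> quotient_complement \<XX> Y \<longleftrightarrow> t \<in> good"
proof -
  have "coset Y t \<in> \<Union>(quotient_arrangement \<XX> Y) \<longleftrightarrow> t \<notin> good"
  proof
    assume "coset Y t \<in> \<Union>(quotient_arrangement \<XX> Y)"
    then obtain H where H: "H \<in> sub_arrangement \<XX> Y" "coset Y t \<in> coset Y ` H"
      unfolding quotient_arrangement_def by blast
    obtain s where s: "s \<in> H" "coset Y t = coset Y s" using H(2) by (rule imageE)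
    have "H \<in> arrangement \<XX>h" using H(1) by (simp add: \<XX>h_def arrangement_sub_characters)
    then obtain \<eta> where \<eta>: "\<eta> \<in> \<XX>h" "H \<in> components (hyper \<eta>)" unfolding arrangement_def by (rule UN_E)
    have stor: "s \<in> torus" using component_subset_torus[OF \<eta>(2)] s(1) by (rule subsetD)
    have u: "union_of_cosets Y H" using H(1) by (simp add: sub_arrangement_def)
    have "t \<in> H" using s(2) coset_eq_iff[OF t stor] by (intro union_of_cosetsD[OF u s(1) t]) simp
    then have "t \<in> hyper \<eta>" by (rule subsetD[OF in_components_subset[OF \<eta>(2)]])
    then show "t \<notin> good" using \<eta>(1) by (auto simp: good_def)
  next
    assume "t \<notin> good"
    then obtain \<eta> where \<eta>: "\<eta> \<in> \<XX>h" "t \<in> hyper \<eta>" using t by (auto simp: good_def)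
    obtain H where H: "H \<in> components (hyper \<eta>)" "t \<in> H" by (rule component_of_hyper[OF \<eta>(2)])
    have "H \<in> arrangement \<XX>h" unfolding arrangement_def using \<eta>(1) H(1) by (rule UN_I)
    then have "H \<in> sub_arrangement \<XX> Y" by (simp add: \<XX>h_def arrangement_sub_characters)
    then show "coset Y t \<in> \<Union>(quotient_arrangement \<XX> Y)" using H(2) unfolding quotient_arrangement_def by blast
  qed
  then show ?thesis using imageI[OF t, of "coset Y"] unfolding quotient_complement_def Diff_iff by simp
qed

lemma quotient_complement_eq: "quotient_complement \<XX> Y = coset Y ` good"
proof
  show "quotient_complement \<XX> Y \<subseteq> coset Y ` good"
  proof
    fix c assume c: "c \<in> quotient_complement \<XX> Y"
    then obtain t where t: "t \<in> torus" "c = coset Y t" unfolding quotient_complement_def by blast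
    have "t \<in> good" using c coset_in_quotient_complement_iff[OF t(1)] by (simp only: t(2))
    then show "c \<in> coset Y ` good" unfolding t(2) by (rule imageI)
  qed
  show "coset Y ` good \<subseteq> quotient_complement \<XX> Y"
  proof (rule image_subsetI)
    fix t assume t: "t \<in> good"
    then have "t \<in> torus" by (simp add: good_def)
    from coset_in_quotient_complement_iff[OF this] show "coset Y t \<in> quotient_complement \<XX> Y" using t by simp
  qed
qed

end

section \<open>The pullback square\<close>

lemma continuous_map_locally:
  assumes "\<And>w. w \<in> topspace X \<Longrightarrow> \<exists>U. openin X U \<and> w \<in> U \<and> continuous_map (subtopology X U) Z f"
  shows "continuous_map X Z f"
proof (rule pasting_lemma[where I = "{U. openin X U \<and> continuous_map (subtopology X U) Z f}"
      and T = "\<lambda>U. U" and f = "\<lambda>_. f"])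
  fix w assume "w \<in> topspace X"
  from assms[OF this] show "\<exists>U. U \<in> {U. openin X U \<and> continuous_map (subtopology X U) Z f} \<and> w \<in> U \<and> f w = f w"
    by blast
qed simp_all

text \<open>Configurations are extensional functions, whence the restriction to the index
  set.\<close>

lemma continuous_map_Conf:
  assumes cont: "\<And>i. i < k \<Longrightarrow> continuous_map X Z (\<lambda>w. x w i)"
    and inj: "\<And>w. w \<in> topspace X \<Longrightarrow> inj_on (x w) {..<k}"
  shows "continuous_map X (Conf k Z) (\<lambda>w. restrict (x w) {..<k})"
proof -
  have "continuous_map X (product_topology (\<lambda>_. Z) {..<k}) (\<lambda>w. restrict (x w) {..<k})"
    unfolding continuous_map_componentwise
  proof (intro conjI ballI)
    show "continuous_map X Z (\<lambda>w. restrict (x w) {..<k} i)" if "i \<in> {..<k}" for i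
      using cont that by simp
  qed auto
  then show ?thesis
    unfolding Conf_def continuous_map_in_subtopology using inj by (auto simp: inj_on_def)
qed

lemma continuous_map_block_sets:
  "continuous_map (Conf (sum_list ks) Z) (Conf_colored ks Z) (block_sets ks)"
  unfolding Conf_colored_def by (rule quotient_imp_continuous_map[OF quotient_map_quotient_topology])

lemma topspace_Conf_colored: "topspace (Conf_colored ks Z) = block_sets ks ` topspace (Conf (sum_list ks) Z)"
  by (simp add: Conf_colored_def)

lemma continuous_map_from_Conf_colored:
  assumes "continuous_map (Conf (sum_list ks) Z) Z' (\<lambda>x. f (block_sets ks x))"
  shows "continuous_map (Conf_colored ks Z) Z' f"
  unfolding Conf_colored_def
  by (rule continuous_compose_quotient_map[OF quotient_map_quotient_topology]) (use assms in \<open>simp add: comp_def\<close>)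

lemma block_sets_single: "block_sets [k] x = [x ` {..<k}]"
  by (simp add: block_sets_def block_def lessThan_atLeast0)

lemma block_sets_pair: "block_sets [k, 1] x = [x ` {..<k}, {x k}]"
  by (simp add: block_sets_def block_def lessThan_atLeast0 upt_rec)

lemma continuous_map_Conf_coordinate: "i < k \<Longrightarrow> continuous_map (Conf k Z) Z (\<lambda>x. x i)"
  unfolding Conf_def
  by (rule continuous_map_from_subtopology) (rule continuous_map_product_projection, simp)

lemma continuous_map_butlast:
  "continuous_map (Conf_colored [k, 1] Z) (Conf_colored [k] Z) butlast"
proof (rule continuous_map_from_Conf_colored)
  have "continuous_map (Conf (sum_list [k, 1]) Z) (Conf (sum_list [k]) Z) (\<lambda>x. restrict x {..<sum_list [k]})"
  proof (rule continuous_map_Conf)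
    show "continuous_map (Conf (sum_list [k, 1]) Z) Z (\<lambda>x. x i)" if "i < sum_list [k]" for i
      using that by (intro continuous_map_Conf_coordinate) simp
    show "inj_on x {..<sum_list [k]}" if "x \<in> topspace (Conf (sum_list [k, 1]) Z)" for x
      using that by (auto simp: topspace_Conf inj_on_def)
  qed
  from continuous_map_compose[OF this continuous_map_block_sets]
  show "continuous_map (Conf (sum_list [k, 1]) Z) (Conf_colored [k] Z) (\<lambda>x. butlast (block_sets [k, 1] x))"
    unfolding block_sets_pair by (simp add: comp_def block_sets_single)
qed

lemma continuous_map_last_point:
  "continuous_map (Conf_colored [k, 1] Z) Z (\<lambda>c. the_elem (last c))"
proof (rule continuous_map_from_Conf_colored)
  show "continuous_map (Conf (sum_list [k, 1]) Z) Z (\<lambda>x. the_elem (last (block_sets [k, 1] x)))"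
    unfolding block_sets_pair using continuous_map_Conf_coordinate[of k "sum_list [k, 1]" Z] by simp
qed

lemma Conf_colored_pair_elements:
  assumes "c \<in> topspace (Conf_colored [k, 1] Z)"
  obtains A x where "c = [A, {x}]" "x \<notin> A"
proof -
  obtain y where y: "y \<in> topspace (Conf (sum_list [k, 1]) Z)" "c = block_sets [k, 1] y"
    using assms unfolding topspace_Conf_colored by (elim imageE)
  have "inj_on y {..<k + 1}" using y(1) by (simp add: topspace_Conf)
  then have "y k \<notin> y ` {..<k}" by (auto dest: inj_onD)
  then show ?thesis by (rule that[rotated]) (simp only: y(2) block_sets_pair)
qed

context fibered_arrangement
begin

lemma good_torus: "t \<in> good \<Longrightarrow> t \<in> torus"
  by (simp add: good_def)

text \<open>The root p is corrected by a local quotient of the small difference t0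
  (\<open>\<pi> \<eta>\<close>) - t (\<open>\<pi> \<eta>\<close>), which vanishes at t0.\<close>

lemma local_root:
  assumes t0: "t0 \<in> torus" and \<eta>: "\<eta> \<in> \<XX>v" and p: "imul (\<kappa> \<eta>) p = - t0 (\<pi> \<eta>)"
  shows "\<exists>x W. open W \<and> t0 \<in> W \<and> continuous_on W x \<and> x t0 = p \<and> (\<forall>t\<in>W. t \<in> torus \<longrightarrow> x t \<in> S t)"
proof -
  obtain N \<rho> where N: "open N" "(0 :: 'g) \<in> N" "continuous_on N \<rho>" "\<rho> 0 = 0" "\<forall>y\<in>N. imul (\<kappa> \<eta>) (\<rho> y) = y"
    using imul_local_division[OF \<kappa>_nonzero[OF \<eta>]] by (elim exE conjE)
  define D where "D t = t0 (\<pi> \<eta>) - t (\<pi> \<eta>)" for t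
  have D: "continuous_on A D" for A
    unfolding D_def by (intro continuous_on_diff continuous_on_const continuous_on_coordinate)
  show ?thesis
  proof (intro exI conjI ballI impI)
    show "open (D -` N)" by (rule open_vimage[OF N(1) D])
    show "t0 \<in> D -` N" using N(2) by (simp add: D_def)
    show "continuous_on (D -` N) (\<lambda>t. p + \<rho> (D t))"
      by (intro continuous_on_add continuous_on_const continuous_on_compose2[OF N(3) D]) blast
    show "p + \<rho> (D t0) = p" by (simp add: D_def N(4))
    fix t assume t: "t \<in> D -` N" "t \<in> torus"
    have "imul (\<kappa> \<eta>) (\<rho> (D t)) = D t" using N(5) t(1) by simp
    then have "imul (\<kappa> \<eta>) (p + \<rho> (D t)) = - t (\<pi> \<eta>)" by (simp add: imul_plus p D_def)
    then show "p + \<rho> (D t) \<in> S t" using \<eta> by (auto simp: S_eq[OF t(2)])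
  qed
qed

text \<open>Since \<open>card (S t)\<close> is constant, local roots through the points of \<open>S t0\<close> exhaust \<open>S t\<close> as long as
  they stay distinct.\<close>

lemma local_enumeration:
  assumes k: "\<forall>t\<in>good. card (S t) = k" and t0: "t0 \<in> good"
  shows "\<exists>W x. open W \<and> t0 \<in> W \<and> (\<forall>i<k. continuous_on W (\<lambda>t. x t i)) \<and>
    (\<forall>t\<in>W \<inter> good. inj_on (x t) {..<k} \<and> x t ` {..<k} = S t)"
proof -
  have tor: "t0 \<in> torus" by (rule good_torus[OF t0])
  obtain p where p: "bij_betw p {..<k} (S t0)"
    using ex_bij_betw_nat_finite[OF finite_S[OF tor]] k t0 by (auto simp: lessThan_atLeast0)
  have "\<forall>i\<in>{..<k}. \<exists>x W. open W \<and> t0 \<in> W \<and> continuous_on W x \<and> x t0 = p i \<and>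
      (\<forall>t\<in>W. t \<in> torus \<longrightarrow> x t \<in> S t)"
  proof
    fix i assume i: "i \<in> {..<k}"
    have "p i \<in> S t0" using bij_betwE[OF p] i by simp
    then obtain \<eta> where \<eta>: "\<eta> \<in> \<XX>v" "imul (\<kappa> \<eta>) (p i) = - t0 (\<pi> \<eta>)" unfolding S_eq[OF tor] by blast
    then show "\<exists>x W. open W \<and> t0 \<in> W \<and> continuous_on W x \<and> x t0 = p i \<and>
      (\<forall>t\<in>W. t \<in> torus \<longrightarrow> x t \<in> S t)" by (rule local_root[OF tor])
  qed
  from bchoice[OF this] obtain x where "\<forall>i\<in>{..<k}. \<exists>W. open W \<and> t0 \<in> W \<and> continuous_on W (x i) \<and> x i t0 = p i \<and>
      (\<forall>t\<in>W. t \<in> torus \<longrightarrow> x i t \<in> S t)" ..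
  from bchoice[OF this] obtain V where V: "\<forall>i\<in>{..<k}. open (V i) \<and> t0 \<in> V i \<and>
      continuous_on (V i) (x i) \<and> x i t0 = p i \<and> (\<forall>t\<in>V i. t \<in> torus \<longrightarrow> x i t \<in> S t)" ..
  have xV: "open (V i) \<and> t0 \<in> V i \<and> continuous_on (V i) (x i) \<and> x i t0 = p i \<and>
      (\<forall>t\<in>V i. t \<in> torus \<longrightarrow> x i t \<in> S t)" if "i < k" for i
    by (rule bspec[OF V]) (use that in simp)
  have ne: "\<forall>\<^sub>F t in nhds t0. i \<noteq> j \<longrightarrow> x i t \<noteq> x j t" if ij: "i < k" "j < k" for i j
  proof (cases "i = j")
    case False
    have "p i \<noteq> p j" using p ij False by (auto simp: bij_betw_def dest: inj_onD)
    then have mem: "(x i t0, x j t0) \<in> {(a, b) | a b. a \<noteq> b}" using xV[OF ij(1)] xV[OF ij(2)] by simp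
    define Q where "Q = (V i \<inter> V j) \<inter> (\<lambda>t. (x i t, x j t)) -` {(a, b) | a b. a \<noteq> b}"
    have "open Q" unfolding Q_def
    proof (rule continuous_open_preimage)
      show "continuous_on (V i \<inter> V j) (\<lambda>t. (x i t, x j t))"
        by (rule continuous_on_Pair; rule continuous_on_subset[OF _ Int_lower1] continuous_on_subset[OF _ Int_lower2])
          (simp_all only: xV[OF ij(1)] xV[OF ij(2)])
      show "open (V i \<inter> V j)" using xV[OF ij(1)] xV[OF ij(2)] by (intro open_Int) simp_all
    qed (rule open_diagonal_complement)
    moreover have "t0 \<in> Q" using mem xV[OF ij(1)] xV[OF ij(2)] by (simp add: Q_def)
    moreover have "i \<noteq> j \<longrightarrow> x i t \<noteq> x j t" if "t \<in> Q" for t using that by (simp add: Q_def)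
    ultimately show ?thesis unfolding eventually_nhds by blast
  qed simp
  have "\<forall>\<^sub>F t in nhds t0. \<forall>i\<in>{..<k}. \<forall>j\<in>{..<k}. i \<noteq> j \<longrightarrow> x i t \<noteq> x j t"
  proof (rule eventually_ball_finite[OF finite_lessThan], rule ballI)
    fix i assume "i \<in> {..<k}"
    then show "\<forall>\<^sub>F t in nhds t0. \<forall>j\<in>{..<k}. i \<noteq> j \<longrightarrow> x i t \<noteq> x j t"
      by (intro eventually_ball_finite[OF finite_lessThan] ballI) (rule ne, simp_all)
  qed
  then obtain W where W: "open W" "t0 \<in> W" "\<And>t. t \<in> W \<Longrightarrow> \<forall>i\<in>{..<k}. \<forall>j\<in>{..<k}. i \<noteq> j \<longrightarrow> x i t \<noteq> x j t"
    unfolding eventually_nhds by (elim exE conjE) simp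
  define W' where "W' = W \<inter> (\<Inter>i\<in>{..<k}. V i)"
  show ?thesis
  proof (intro exI conjI allI impI ballI)
    show "open W'" unfolding W'_def using W(1) xV by (intro open_Int open_INT finite_lessThan ballI) simp_all
    show "t0 \<in> W'" unfolding W'_def using W(2) xV by simp
    show "continuous_on W' (\<lambda>t. x i t)" if "i < k" for i
    proof (rule continuous_on_subset[of "V i"])
      show "continuous_on (V i) (x i)" using xV[OF that] by simp
      show "W' \<subseteq> V i" unfolding W'_def using that by blast
    qed
    fix t assume t: "t \<in> W' \<inter> good"
    show inj: "inj_on (\<lambda>i. x i t) {..<k}"
    proof (rule inj_onI)
      fix i j assume ij: "i \<in> {..<k}" "j \<in> {..<k}" "x i t = x j t"
      have "t \<in> W" using t by (simp add: W'_def)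
      from bspec[OF bspec[OF W(3)[OF this] ij(1)] ij(2)] show "i = j" using ij(3) by blast
    qed
    have "x i t \<in> S t" if "i < k" for i
    proof -
      have "t \<in> V i" "t \<in> torus" using t that by (auto simp: W'_def good_torus)
      then show ?thesis using xV[OF that] by blast
    qed
    then have "(\<lambda>i. x i t) ` {..<k} \<subseteq> S t" by auto
    moreover have "card ((\<lambda>i. x i t) ` {..<k}) = card (S t)"
      using k t by (simp add: card_image[OF inj])
    ultimately show "(\<lambda>i. x i t) ` {..<k} = S t"
      using finite_S[OF good_torus] t by (intro card_subset_eq) auto
  qed
qed

text \<open>The set \<open>S (f w)\<close> has no global ordering, but a local enumeration lifts the
  map to ordered configurations, and the quotient map is continuous. A general source X covers both
  uses: g with the section \<open>base\<close>, and h with the identity of the complement.\<close>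

lemma continuous_map_into_Conf_colored:
  fixes f :: "'z \<Rightarrow> 'c \<Rightarrow> 'g"
  assumes k: "\<forall>t\<in>good. card (S t) = k" and f: "continuous_map X (top_of_set good) f"
  shows "continuous_map X (Conf_colored [k] euclidean) (\<lambda>w. [S (f w)])"
    and "continuous_map X euclidean y \<Longrightarrow> (\<And>w. w \<in> topspace X \<Longrightarrow> y w \<notin> S (f w)) \<Longrightarrow>
      continuous_map X (Conf_colored [k, 1] euclidean) (\<lambda>w. [S (f w), {y w}])"
proof -
  have loc: "\<exists>U x. openin X U \<and> w \<in> U \<and> (\<forall>i<k. continuous_map (subtopology X U) euclidean (\<lambda>v. x v i)) \<and>
      (\<forall>v\<in>topspace (subtopology X U). inj_on (x v) {..<k} \<and> x v ` {..<k} = S (f v))"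
    if w: "w \<in> topspace X" for w
  proof -
    have im: "f v \<in> good" if "v \<in> topspace X" for v
      using continuous_map_funspace[OF f] that by auto
    obtain W x where W: "open W" "f w \<in> W" "\<forall>i<k. continuous_on W (\<lambda>t. x t i)"
      "\<forall>t\<in>W \<inter> good. inj_on (x t) {..<k} \<and> x t ` {..<k} = S t"
      using local_enumeration[OF k im[OF w]] by (elim exE conjE)
    define U where "U = {v \<in> topspace X. f v \<in> W}"
    have fe: "continuous_map X euclidean f" using f by (simp add: continuous_map_in_subtopology)
    have "openin X U"
      unfolding U_def using openin_continuous_map_preimage[OF fe, of W] W(1) by simp
    moreover have "w \<in> U" using w W(2) by (simp add: U_def)
    moreover have "continuous_map (subtopology X U) euclidean (\<lambda>v. x (f v) i)" if i: "i < k" for i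
    proof -
      have "continuous_map (subtopology X U) (top_of_set W) f"
        using continuous_map_from_subtopology[OF fe] by (auto simp: continuous_map_in_subtopology U_def)
      moreover have "continuous_map (top_of_set W) euclidean (\<lambda>t. x t i)" using W(3) i by simp
      ultimately show ?thesis using continuous_map_compose[of _ _ f _ "\<lambda>t. x t i"] by (simp add: comp_def)
    qed
    moreover have "\<forall>v\<in>topspace (subtopology X U). inj_on (x (f v)) {..<k} \<and> x (f v) ` {..<k} = S (f v)"
      using W(4) im by (auto simp: U_def)
    ultimately show ?thesis by (intro exI[of _ U] exI[of _ "\<lambda>v. x (f v)"]) simp
  qed
  show "continuous_map X (Conf_colored [k] euclidean) (\<lambda>w. [S (f w)])"
  proof (rule continuous_map_locally)
    fix w assume "w \<in> topspace X"
    from loc[OF this] obtain U x where U: "openin X U" "w \<in> U"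
      "\<forall>i<k. continuous_map (subtopology X U) euclidean (\<lambda>v. x v i)"
      "\<forall>v\<in>topspace (subtopology X U). inj_on (x v) {..<k} \<and> x v ` {..<k} = S (f v)" by (elim exE conjE)
    have "continuous_map (subtopology X U) (Conf (sum_list [k]) euclidean) (\<lambda>v. restrict (x v) {..<sum_list [k]})"
      using U(3,4) by (intro continuous_map_Conf) simp_all
    from continuous_map_compose[OF this continuous_map_block_sets]
    have "continuous_map (subtopology X U) (Conf_colored [k] euclidean) (\<lambda>w. [S (f w)])"
      by (rule continuous_map_eq) (use U(4) in \<open>simp add: block_sets_single\<close>)
    then show "\<exists>U. openin X U \<and> w \<in> U \<and> continuous_map (subtopology X U) (Conf_colored [k] euclidean) (\<lambda>w. [S (f w)])"
      using U(1,2) by (intro exI[of _ U]) simp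
  qed
  assume y: "continuous_map X euclidean y" and yS: "\<And>w. w \<in> topspace X \<Longrightarrow> y w \<notin> S (f w)"
  show "continuous_map X (Conf_colored [k, 1] euclidean) (\<lambda>w. [S (f w), {y w}])"
  proof (rule continuous_map_locally)
    fix w assume "w \<in> topspace X"
    from loc[OF this] obtain U x where U: "openin X U" "w \<in> U"
      "\<forall>i<k. continuous_map (subtopology X U) euclidean (\<lambda>v. x v i)"
      "\<forall>v\<in>topspace (subtopology X U). inj_on (x v) {..<k} \<and> x v ` {..<k} = S (f v)" by (elim exE conjE)
    \<comment> \<open>The extra point takes index k, the only index in the second block of
      \<open>[k, 1]\<close>.\<close>
    define z where "z v = (x v)(k := y v)" for v
    have z: "z v ` {..<k} = x v ` {..<k}" "z v k = y v" for v by (auto simp: z_def)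
    have "continuous_map (subtopology X U) (Conf (sum_list [k, 1]) euclidean) (\<lambda>v. restrict (z v) {..<sum_list [k, 1]})"
    proof (rule continuous_map_Conf)
      show "continuous_map (subtopology X U) euclidean (\<lambda>v. z v i)" if "i < sum_list [k, 1]" for i
        using U(3) that continuous_map_from_subtopology[OF y, of U] by (cases "i = k") (simp_all add: z_def)
      fix v assume v: "v \<in> topspace (subtopology X U)"
      have "inj_on (x v) {..<k}" "y v \<notin> x v ` {..<k}" using U(4) v yS[of v] by auto
      then have "inj_on (z v) (insert k {..<k})"
        unfolding inj_on_insert z(2) by (simp add: z(1) z_def inj_on_def)
      then show "inj_on (z v) {..<sum_list [k, 1]}" by (simp add: lessThan_Suc)
    qed
    from continuous_map_compose[OF this continuous_map_block_sets]
    have "continuous_map (subtopology X U) (Conf_colored [k, 1] euclidean) (\<lambda>w. [S (f w), {y w}])"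
    proof (rule continuous_map_eq)
      fix v assume v: "v \<in> topspace (subtopology X U)"
      have "restrict (z v) {..<sum_list [k, 1]} ` {..<k} = z v ` {..<k}" by (rule image_cong) simp_all
      then show "(block_sets [k, 1] \<circ> (\<lambda>v. restrict (z v) {..<sum_list [k, 1]})) v = [S (f v), {y v}]"
        using bspec[OF U(4) v] unfolding comp_def block_sets_pair by (simp add: z)
    qed
    then show "\<exists>U. openin X U \<and> w \<in> U \<and> continuous_map (subtopology X U) (Conf_colored [k, 1] euclidean) (\<lambda>w. [S (f w), {y w}])"
      using U(1,2) by (intro exI[of _ U]) simp
  qed
qed

text \<open>A section of the projection to T/Y: the point of the coset with value 0 at e. Setting
  this value removes the dependence on the chosen representative.\<close>

definition base :: "('c \<Rightarrow> 'g) set \<Rightarrow> 'c \<Rightarrow> 'g" where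
  "base c = insert_fibre (SOME t. t \<in> c) 0"

lemma base_coset:
  assumes "t \<in> torus"
  shows "base (coset Y t) = insert_fibre t 0"
proof -
  have "(SOME s. s \<in> coset Y t) \<in> coset Y t" by (rule someI[of "\<lambda>s. s \<in> coset Y t", OF coset_self[OF assms]])
  then show ?thesis by (simp add: base_def insert_fibre_def coset_eq[OF assms])
qed

lemma insert_fibre_insert_fibre: "insert_fibre (insert_fibre t x) y = insert_fibre t y"
  by (rule ext) (simp add: insert_fibre_def \<pi>_\<pi> \<kappa>_\<pi>)

lemma S_insert_fibre: "S (insert_fibre t x) = S t"
  by (simp add: S_def insert_fibre_insert_fibre)

lemma coset_insert_fibre: "t \<in> torus \<Longrightarrow> coset Y (insert_fibre t x) = coset Y t"
  by (subst coset_eq_iff) (simp_all add: insert_fibre_in_torus insert_fibre_\<pi>)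

lemma good_insert_fibre: "t \<in> good \<Longrightarrow> insert_fibre t x \<in> good"
  using coset_in_quotient_complement_iff[of t] coset_in_quotient_complement_iff[of "insert_fibre t x"]
  by (simp add: good_torus insert_fibre_in_torus coset_insert_fibre)

lemma continuous_map_base: "continuous_map (torus_quotient_topology Y) torus_topology base"
  unfolding torus_quotient_topology_def
proof (rule continuous_compose_quotient_map[OF quotient_map_quotient_topology])
  have "continuous_on torus (\<lambda>t. insert_fibre t 0)"
    by (intro continuous_on_insert_fibre continuous_on_id continuous_on_const)
  then have "continuous_map torus_topology torus_topology (\<lambda>t. insert_fibre t 0)"
    unfolding torus_topology_def continuous_map_in_subtopology by (auto intro: insert_fibre_in_torus)
  then show "continuous_map torus_topology torus_topology (base \<circ> coset Y)"
    by (rule continuous_map_eq) (simp add: torus_topology_def base_coset)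
qed

text \<open>A point of the complement is recovered from its coset and its value at e, and the latter
  is the single point in the last block of h. This gives a continuous inverse to the comparison map
  into the fibre product.\<close>

theorem complement_pullback:
  "\<exists>k>0. \<exists>g h. pullback_square
     (subtopology torus_topology (arrangement_complement \<XX>)) (Conf_colored [k, 1] (euclidean :: 'g topology))
     (subtopology (torus_quotient_topology Y) (quotient_complement \<XX> Y)) (Conf_colored [k] (euclidean :: 'g topology))
     h (coset Y) butlast g"
proof -
  obtain k where k: "k > 0" "\<forall>t\<in>good. card (S t) = k" using card_S by blast
  let ?M = "subtopology torus_topology (arrangement_complement \<XX> :: ('c \<Rightarrow> 'g) set)"
  let ?B = "subtopology (torus_quotient_topology Y) (quotient_complement \<XX> Y)"
  let ?E = "Conf_colored [k, 1] (euclidean :: 'g topology)"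
  let ?C = "Conf_colored [k] (euclidean :: 'g topology)"
  define g where "g c = [S (base c)]" for c
  define h where "h w = [S w, {w e}]" for w
  have M: "?M = top_of_set (arrangement_complement \<XX>)" "(arrangement_complement \<XX> :: ('c \<Rightarrow> 'g) set) \<subseteq> torus"
    by (auto simp: torus_topology_def subtopology_subtopology arrangement_complement_def Int_absorb1)
  have topM: "topspace ?M = {t \<in> good. t e \<notin> S t}" 
    unfolding M(1) topspace_euclidean_subtopology by (rule complement_eq)
  have topB: "topspace ?B = coset Y ` good"
    by (auto simp: torus_quotient_topology_def torus_topology_def quotient_complement_eq intro: good_torus)
  have idM: "continuous_map ?M euclidean (\<lambda>w. w)" by (simp add: M(1))
  have g_coset: "g (coset Y w) = [S w]" if "w \<in> good" for w
    by (simp add: g_def base_coset[OF good_torus[OF that]] S_insert_fibre)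
  have contbase: "continuous_map ?B euclidean base"
    using continuous_map_from_subtopology[OF continuous_map_base]
    by (simp add: torus_topology_def continuous_map_in_subtopology)
  have base_good: "base b \<in> good" if b: "b \<in> topspace ?B" for b
  proof -
    obtain t where t: "t \<in> good" "b = coset Y t" using b unfolding topB by (elim imageE)
    then show ?thesis by (simp add: base_coset[OF good_torus] good_insert_fibre)
  qed
  have contg: "continuous_map ?B ?C g"
    unfolding g_def
    by (rule continuous_map_into_Conf_colored(1)[OF k(2)])
      (use contbase base_good in \<open>auto simp: continuous_map_in_subtopology\<close>)
  have conth: "continuous_map ?M ?E h"
    unfolding h_def
  proof (rule continuous_map_into_Conf_colored(2)[OF k(2)])
    show "continuous_map ?M (top_of_set good) (\<lambda>w. w)"
      unfolding continuous_map_in_subtopology topM using idM by auto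
    show "continuous_map ?M euclidean (\<lambda>w. w e)" by (simp add: M(1) continuous_on_coordinate)
    show "w e \<notin> S w" if "w \<in> topspace ?M" for w using that unfolding topM by simp
  qed
  have contp: "continuous_map ?M ?B (coset Y)"
    unfolding continuous_map_in_subtopology
  proof
    show "continuous_map ?M (torus_quotient_topology Y) (coset Y)"
      unfolding torus_quotient_topology_def
      by (intro continuous_map_from_subtopology quotient_imp_continuous_map quotient_map_quotient_topology)
    show "coset Y \<in> topspace ?M \<rightarrow> quotient_complement \<XX> Y"
      unfolding topM quotient_complement_eq by auto
  qed
  have comm: "butlast (h w) = g (coset Y w)" if "w \<in> topspace ?M" for w
    using that unfolding topM by (simp add: h_def g_coset)
  let ?P = "subtopology (prod_topology ?B ?E) {(b, e). g b = butlast e}"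
  define q where "q = (\<lambda>(b, c). insert_fibre (base b) (the_elem (last c :: 'g set)))"
  \<comment> \<open>The fibre product condition forces the first block to be \<open>S t\<close>;
    disjointness of the blocks then says that x avoids it.\<close>
  have P: "\<exists>t x. t \<in> good \<and> x \<notin> S t \<and> z = (coset Y t, [S t, {x}])" if z: "z \<in> topspace ?P" for z
  proof -
    obtain b c where bc: "z = (b, c)" "b \<in> topspace ?B" "c \<in> topspace ?E" "g b = butlast c"
      using z by (cases z) auto
    obtain t where t: "t \<in> good" "b = coset Y t" using bc(2) unfolding topB by (elim imageE)
    obtain A x where c: "c = [A, {x}]" "x \<notin> A" by (rule Conf_colored_pair_elements[OF bc(3)])
    have "A = S t" using bc(4) g_coset[OF t(1)] by (simp add: t(2) c(1))
    then show ?thesis using t c bc(1) by blast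
  qed
  have q: "q (coset Y t, [A, {x}]) = insert_fibre t x" if "t \<in> good" for t A x
    by (simp add: q_def base_coset[OF good_torus[OF that]] insert_fibre_insert_fibre)
  have "homeomorphic_maps ?M ?P (\<lambda>w. (coset Y w, h w)) q"
    unfolding homeomorphic_maps_def
  proof (intro conjI ballI)
    show "continuous_map ?M ?P (\<lambda>w. (coset Y w, h w))"
      unfolding continuous_map_in_subtopology
    proof
      show "continuous_map ?M (prod_topology ?B ?E) (\<lambda>w. (coset Y w, h w))"
        by (rule continuous_map_pairedI[OF contp conth])
      show "(\<lambda>w. (coset Y w, h w)) \<in> topspace ?M \<rightarrow> {(b, e). g b = butlast e}"
        using comm[symmetric] by (intro funcsetI CollectI case_prodI)
    qed
    have "continuous_map ?P euclidean (\<lambda>z. (base (fst z), the_elem (last (snd z) :: 'g set)))"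
      unfolding prod_topology_euclidean[symmetric]
    proof (rule continuous_map_pairedI)
      show "continuous_map ?P euclidean (\<lambda>z. base (fst z))"
        using continuous_map_compose[OF continuous_map_subtopology_fst contbase] by (simp add: comp_def)
      show "continuous_map ?P euclidean (\<lambda>z. the_elem (last (snd z)))"
        using continuous_map_compose[OF continuous_map_subtopology_snd continuous_map_last_point] by (simp add: comp_def)
    qed
    moreover have "continuous_map euclidean euclidean (\<lambda>z :: ('c \<Rightarrow> 'g) \<times> 'g. insert_fibre (fst z) (snd z))"
      by (simp add: continuous_on_insert_fibre continuous_on_fst continuous_on_snd continuous_on_id)
    ultimately have "continuous_map ?P euclidean
        ((\<lambda>z. insert_fibre (fst z) (snd z)) \<circ> (\<lambda>z. (base (fst z), the_elem (last (snd z) :: 'g set))))"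
      by (rule continuous_map_compose)
    then have contq: "continuous_map ?P euclidean q" by (simp add: q_def comp_def split_beta')
    show "continuous_map ?P ?M q"
      unfolding M(1) continuous_map_in_subtopology
    proof (intro conjI contq funcsetI)
      fix z assume "z \<in> topspace ?P"
      from P[OF this] obtain t x where z: "t \<in> good" "x \<notin> S t" "z = (coset Y t, [S t, {x}])" by (elim exE conjE)
      show "q z \<in> arrangement_complement \<XX>"
        unfolding z(3) q[OF z(1)] complement_eq
        by (simp add: good_insert_fibre[OF z(1)] insert_fibre_e[OF good_torus[OF z(1)]] S_insert_fibre z(2))
    qed
  next
    fix w assume "w \<in> topspace ?M"
    then have "w \<in> good" unfolding topM by simp
    then show "q (coset Y w, h w) = w" unfolding h_def by (simp add: q insert_fibre_self good_torus)
  next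
    fix z assume "z \<in> topspace ?P"
    from P[OF this] obtain t x where z: "t \<in> good" "x \<notin> S t" "z = (coset Y t, [S t, {x}])" by (elim exE conjE)
    show "(coset Y (q z), h (q z)) = z"
      unfolding z(3) q[OF z(1)] h_def
      by (simp add: coset_insert_fibre good_torus[OF z(1)] S_insert_fibre insert_fibre_e)
  qed
  then have "homeomorphic_map ?M ?P (\<lambda>w. (coset Y w, h w))" 
    unfolding homeomorphic_map_maps by (rule exI[where x = q])
  then have "pullback_square ?M ?E ?B ?C h (coset Y) butlast g"
    unfolding pullback_square_def using contg conth contp comm continuous_map_butlast by (intro conjI ballI)
  then show ?thesis using k(1) by (intro exI[of _ k] conjI exI)
qed

end

section \<open>From the hypotheses of the theorem to the two locales\<close>

lemma lie_type_group_exists: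
  fixes atlas :: "('g::{topological_ab_group_add, t2_space, second_countable_topology} set
                    \<times> ('g \<Rightarrow> 'e::real_normed_vector)) set"
  assumes "abelian_lie_group_atlas atlas" "connected (UNIV :: 'g set)"
  shows "\<exists>K :: 'g set. lie_type_group K"
proof -
  obtain U and \<phi> :: "'g \<Rightarrow> 'e" and B where "lie_chart U \<phi> B"
    by (rule abelian_lie_group_chart[OF assms(1)])
  then interpret lie_chart U \<phi> B .
  obtain K :: "'g set" where K: "compact K" "0 \<in> interior K" using compact_nbhd by (elim exE conjE)
  have "lie_type_group K"
    by (rule lie_type_group.intro[OF assms(2) K discrete_torsion local_division])
  then show ?thesis by (rule exI)
qed

lemma has_rank_unique:
  assumes "has_rank P r" "has_rank P s"
  shows "r = s"
  using assms by (metis has_rank_def linorder_neqE_nat)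

text \<open>If all characters were horizontal, both posets of layers would coincide and have ranks r
  and r + 1 at once.\<close>

lemma corank_one_vertical:
  fixes Y :: "('c::ab_group_add \<Rightarrow> 'g::topological_ab_group_add) set"
  assumes "corank_one_M_ideal \<XX> Y"
  shows "\<not> \<XX> \<subseteq> sub_characters \<XX> Y"
proof
  assume "\<XX> \<subseteq> sub_characters \<XX> Y"
  then have eq: "sub_characters \<XX> Y = \<XX>" by (auto simp: sub_characters_def)
  obtain r where "has_rank (layers \<XX> :: ('c \<Rightarrow> 'g) set set) r" "has_rank (layers \<XX> :: ('c \<Rightarrow> 'g) set set) (Suc r)"
    using assms unfolding corank_one_M_ideal_def eq by (elim conjE exE)
  then have "r = Suc r" by (rule has_rank_unique)
  then show False by simp
qed

text \<open>The component in A is obtained by choice; A \<inter> B = {0} makes it unique, and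
  uniqueness makes the choice additive.\<close>

lemma direct_sum_projection:
  assumes "direct_sum_decomposition A B"
  shows "\<exists>p :: 'c::ab_group_add \<Rightarrow> 'c. (\<forall>x. p x \<in> A) \<and> (\<forall>x. x - p x \<in> B) \<and>
    (\<forall>x y. p (x + y) = p x + p y) \<and> (\<forall>x\<in>A. p x = x) \<and> (\<forall>x\<in>B. p x = 0)"
proof -
  have A: "0 \<in> A" "\<And>x y. x \<in> A \<Longrightarrow> y \<in> A \<Longrightarrow> x + y \<in> A" "\<And>x. x \<in> A \<Longrightarrow> - x \<in> A"
    and B: "0 \<in> B" "\<And>x y. x \<in> B \<Longrightarrow> y \<in> B \<Longrightarrow> x + y \<in> B" "\<And>x. x \<in> B \<Longrightarrow> - x \<in> B"
    and AB: "A \<inter> B = {0}" and ex: "\<forall>x. \<exists>a\<in>A. \<exists>b\<in>B. x = a + b"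
    using assms unfolding direct_sum_decomposition_def add_subgroup_def by (elim conjE; blast)+
  have "\<exists>a. a \<in> A \<and> x - a \<in> B" for x
  proof -
    obtain a b where ab: "a \<in> A" "b \<in> B" "x = a + b" using ex by blast
    have "x - a \<in> B" using ab(2) by (simp add: ab(3))
    then show ?thesis using ab(1) by blast
  qed
  then obtain p where p: "\<And>x. p x \<in> A \<and> x - p x \<in> B" by metis
  have unique: "p x = a" if "a \<in> A" "x - a \<in> B" for x a
  proof -
    have "a + - p x \<in> A" using that(1) p[of x] by (intro A(2,3)) auto
    moreover have "(x - p x) + - (x - a) \<in> B" using that(2) p[of x] by (intro B(2,3)) auto
    then have "a + - p x \<in> B" by (simp add: algebra_simps)
    ultimately have "a + - p x \<in> {0}" using AB by blast
    then show ?thesis by simp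
  qed
  show ?thesis
  proof (intro exI conjI allI ballI)
    show "p x \<in> A" "x - p x \<in> B" for x using p[of x] by simp_all
    show "p (x + y) = p x + p y" for x y
    proof (rule unique)
      show "p x + p y \<in> A" using p[of x] p[of y] by (intro A(2)) simp_all
      have "(x - p x) + (y - p y) \<in> B" using p[of x] p[of y] by (intro B(2)) simp_all
      then show "x + y - (p x + p y) \<in> B" by (simp add: algebra_simps)
    qed
    show "p x = x" if "x \<in> A" for x using that B(1) by (intro unique) simp_all
    show "p x = 0" if "x \<in> B" for x using that A(1) by (intro unique) simp_all
  qed
qed

theorem theorem2p5p1:
  fixes atlas :: "('g::{topological_ab_group_add, t2_space, second_countable_topology} set
                    \<times> ('g \<Rightarrow> 'e::real_normed_vector)) set"
    and \<XX> :: "'c::ab_group_add set"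
    and Y :: "('c \<Rightarrow> 'g) set"
    and d :: nat
  assumes "abelian_lie_group_atlas atlas"
    and "connected (UNIV :: 'g set)"
    and "free_abelian_of_rank d (UNIV :: 'c set)"
    and "finite \<XX>"
    and "0 \<notin> \<XX>"
    and "corank_one_M_ideal \<XX> Y"
  shows "\<exists>ks. composition ks \<and>
    (\<exists>g. continuous_map (subtopology (torus_quotient_topology Y) (quotient_complement \<XX> Y))
            (Conf_colored ks (euclidean :: 'g topology)) g \<and>
      (\<exists>h. continuous_map (subtopology torus_topology (arrangement_complement \<XX>))
              (Conf_colored (ks @ [1]) (euclidean :: 'g topology)) h \<and>
        pullback_square
          (subtopology torus_topology (arrangement_complement \<XX>))
          (Conf_colored (ks @ [1]) (euclidean :: 'g topology))
          (subtopology (torus_quotient_topology Y) (quotient_complement \<XX> Y))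
          (Conf_colored ks (euclidean :: 'g topology))
          h (coset Y) butlast g))"
proof -
  obtain K :: "'g set" where "lie_type_group K"
    using lie_type_group_exists[OF assms(1,2)] by (rule exE)
  then interpret lie_type_group K .
  have M: "M_ideal \<XX> Y" using assms(6) unfolding corank_one_M_ideal_def by (elim conjE)
  have "admissible Y" using assms(6) unfolding corank_one_M_ideal_def by (elim conjE)
  then obtain \<Gamma>1 \<Gamma>2 where dec: "direct_sum_decomposition \<Gamma>1 \<Gamma>2" and free: "free_abelian_of_rank 1 \<Gamma>1"
    and Y: "Y = {t \<in> torus. \<forall>\<gamma>\<in>\<Gamma>2. t \<gamma> = 0}"
    unfolding admissible_def by (elim exE conjE)
  obtain p where p: "\<forall>x. p x \<in> \<Gamma>1" "\<forall>x. x - p x \<in> \<Gamma>2" "\<forall>x y. p (x + y) = p x + p y"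
    "\<forall>x\<in>\<Gamma>1. p x = x" "\<forall>x\<in>\<Gamma>2. p x = 0"
    using direct_sum_projection[OF dec] by (elim exE conjE)
  note p = p[rule_format]
  obtain b1 :: "nat \<Rightarrow> 'c" and c1 where b1: "\<forall>i<1. b1 i \<in> \<Gamma>1"
    "\<forall>x\<in>\<Gamma>1. x = (\<Sum>i<1. imul (c1 x i) (b1 i))"
    "\<forall>x\<in>\<Gamma>1. \<forall>y\<in>\<Gamma>1. \<forall>i. c1 (x + y) i = c1 x i + c1 y i"
    "\<forall>i<1. \<forall>j. c1 (b1 i) j = (if i = j then 1 else 0)"
    using free_abelian_coordinates[OF free] by (elim exE conjE)
  note b1 = b1[rule_format]
  obtain b :: "nat \<Rightarrow> 'c" and c where b: "\<forall>x\<in>UNIV. x = (\<Sum>i<d. imul (c x i) (b i))"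
    "\<forall>x\<in>UNIV. \<forall>y\<in>UNIV. \<forall>i. c (x + y) i = c x i + c y i"
    using free_abelian_coordinates[OF assms(3)] by (elim exE conjE)
  note b = b[rule_format]
  have zero: "0 \<in> \<Gamma>1" "p 0 = 0" using p(1)[of 0] p(3)[of 0 0] by simp_all
  have c10: "c1 0 i = 0" for i using b1(3)[OF zero(1) zero(1), of i] by simp
  have pp: "p (x - p x) = 0" for x by (rule p(5)[OF p(2)])
  \<comment> \<open>With p the projection to \<Gamma>1, e is the generator \<open>b1 0\<close>,
    \<kappa> is the coordinate of p x along it, and \<pi> is the complementary projection.\<close>
  have "fibered_arrangement K \<XX> Y (\<lambda>x. c1 (p x) 0) (b1 0) (\<lambda>x. x - p x) d b c"
  proof (intro fibered_arrangement.intro fibered_arrangement_axioms.intro)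
    show "lie_type_group K" by (rule lie_type_group_axioms)
    show "x = imul (c1 (p x) 0) (b1 0) + (x - p x)" for x
      using b1(2)[OF p(1), of x] by simp
    show "c1 (p (b1 0)) 0 = 1" using b1(4)[of 0 0] p(4)[OF b1(1)[of 0]] by simp
    show "b1 0 - p (b1 0) = 0" using p(4)[OF b1(1)[of 0]] by simp
    show "c1 (p (x + y)) 0 = c1 (p x) 0 + c1 (p y) 0" for x y
      unfolding p(3) by (rule b1(3)[OF p(1) p(1)])
    show "x + y - p (x + y) = (x - p x) + (y - p y)" for x y by (simp add: p(3))
    show "c1 (p (x - p x)) 0 = 0" for x by (simp add: pp c10)
    show "x - p x - p (x - p x) = x - p x" for x by (simp add: pp)
    \<comment> \<open>Vanishing on \<Gamma>2 becomes vanishing at all values of the projection, the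
      form of Y in the locale.\<close>
    have "\<Gamma>2 = range (\<lambda>x. x - p x)"
    proof
      show "range (\<lambda>x. x - p x) \<subseteq> \<Gamma>2" using p(2) by (rule image_subsetI)
      show "\<Gamma>2 \<subseteq> range (\<lambda>x. x - p x)"
      proof
        fix x assume "x \<in> \<Gamma>2"
        then show "x \<in> range (\<lambda>x. x - p x)" by (intro image_eqI[of _ _ x]) (simp_all add: p(5))
      qed
    qed
    then show "Y = {t \<in> torus. \<forall>x. t (x - p x) = 0}" by (simp add: Y)
    show "x = (\<Sum>i<d. imul (c x i) (b i))" for x by (rule b(1)) simp
    show "c (x + y) i = c x i + c y i" for x y i by (rule b(2)) simp_all
    show "\<not> \<XX> \<subseteq> sub_characters \<XX> Y" by (rule corank_one_vertical[OF assms(6)])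
  qed (fact assms(4) M)+
  from fibered_arrangement.complement_pullback[OF this]
  obtain k g h where k: "k > 0" and sq: "pullback_square
     (subtopology torus_topology (arrangement_complement \<XX>)) (Conf_colored [k, 1] (euclidean :: 'g topology))
     (subtopology (torus_quotient_topology Y) (quotient_complement \<XX> Y)) (Conf_colored [k] (euclidean :: 'g topology))
     h (coset Y) butlast g" by (elim exE conjE)
  show ?thesis
  proof (intro exI conjI)
    show "composition [k]" using k by (simp add: composition_def)
    show "continuous_map (subtopology (torus_quotient_topology Y) (quotient_complement \<XX> Y))
            (Conf_colored [k] (euclidean :: 'g topology)) g"
      using sq unfolding pullback_square_def by (elim conjE)
    show "continuous_map (subtopology torus_topology (arrangement_complement \<XX>))
              (Conf_colored ([k] @ [1]) (euclidean :: 'g topology)) h"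
      using sq unfolding pullback_square_def append.simps by (elim conjE)
    show "pullback_square
          (subtopology torus_topology (arrangement_complement \<XX>))
          (Conf_colored ([k] @ [1]) (euclidean :: 'g topology))
          (subtopology (torus_quotient_topology Y) (quotient_complement \<XX> Y))
          (Conf_colored [k] (euclidean :: 'g topology))
          h (coset Y) butlast g"
      using sq unfolding append.simps .
  qed
qed

end
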